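(* Let $X$ be a hyperelliptic curve of genus $g$ over a field $F$ of characteristic $\ne2$, with affine model $y^2=f(x)$, $\deg f=2g+1$. Whenever $\ell\le g$ and $\ell\equiv1\pmod4$ ($\ell\ge1$), the local Euler index in $\mathrm{GW}(F)$ of the complete linear series $|2\ell\infty_X|$, with basis $\lambda=(1,x,\dots,x^\ell)$, at a ramification point $(\gamma,0)\in R_\pi\setminus\{\infty_X\}$ of the hyperelliptic projection $\pi:X\to\mathbb{P}^1$ is $$\mathrm{ind}_{(\gamma,0)}w(\lambda)=\mathrm{Tr}_{k(\gamma)/F}\left(\frac{\binom{\ell+1}2-1}{2}\cdot\mathbb{H}+\left\langle\frac{(D^1f)(\gamma)}{2}\right\rangle\right).$$
   Context: $X$ is smooth and projective, $\pi$ is $(x,y)\mapsto x$, $\infty_X=\pi^{-1}(\infty)$, $R_\pi$ is the ramification divisor, consisting of $\infty_X$ and the points $(\gamma,0)$ with $f(\gamma)=0$; $k(\gamma)=F(\gamma)$; $D^1f$ is the derivative of $f$. $\mathrm{GW}(F)$ is the Grothendieck--Witt group of nondegenerate symmetric bilinear forms, $\langle a\rangle$ the class of $(u,v)\mapsto auv$, $\mathbb{H}=\langle1\rangle+\langle-1\rangle$, and $\mathrm{Tr}_{k/F}:\mathrm{GW}(k)\to\mathrm{GW}(F)$ is post-composition of a bilinear form with the field trace. Hasse derivatives: for an étale coordinate $t$ on an open $U\subset X$, $D^k_t:\mathcal{O}_U\to\mathcal{O}_U$ are the unique $F$-linear maps with $D^0_t=\mathrm{id}$, $D^k_t(\phi\psi)=\sum_iD^i_t\phi\,D^{k-i}_t\psi$,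 $D^k_tt^n=\binom nkt^{n-k}$. Hasse Wronskian: with $L=\mathcal{O}_X(2\ell\infty_X)$ and $r+1=h^0(L)=\ell+1$, $w(\lambda)$ is the section of $\det J^{r+1}(L)\cong L^{\otimes(r+1)}\otimes K_X^{\otimes\binom{r+1}2}$ (with $J^{r+1}(L)$ the bundle of order-$r$ principal parts) represented, for a local generator $s$ of $L$ and étale coordinate $t$, by $\det(D^i_t(\lambda_j/s))_{0\le i,j\le r}$. On $X\setminus\{\infty_X\}$ one uses $s=1$. Since $\ell\equiv1\pmod 4$, both $r+1$ and $\binom{r+1}2+1$ are even, so $\mathcal{H}om(T_X,\det J^{r+1}(L))\cong L^{\otimes(r+1)}\otimes K_X^{\otimes(\binom{r+1}2+1)}$ is canonically a tensor square; this is the relative orientation, and the trivializations given by $s$ and $dt$ are compatible with it. Local Euler index at a closed point $p\ne\infty_X$ that is an isolated zero of $w(\lambda)$: choose $t=ax+by$ ($a,b\in F$) étale near $p$ with $k(t(p))\cong k(p)$ (a Nisnevich coordinate), put $\phi=\det(D^i_t\lambda_j)$, choose $n$ with $\mathfrak{m}_p^n\subset(\phi)$ and $G\in F[t]$ with $G-\phi\in\mathfrak{m}_p^{2n}$, and let $A=\mathcal{O}_{X,p}/(\phi)\cong F[t]_{t(p)}/(G)$. Write the image of $\frac{G(t_1)-G(t_2)}{t_1-t_2}$ in $A\otimes_FA$ as $\sum a_i\otimes b_i$; there is a unique $F$-linear $\eta:A\to F$ with $\sum\eta(a_i)b_i=1$, and $\mathrm{ind}_pw(\lambda)\in\mathrm{GW}(F)$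 is the class of $(a,b)\mapsto\eta(ab)$ (known to be independent of choices). *)

theory Defs
  imports Complex_Main "Jordan_Normal_Form.Char_Poly" "HOL-Computational_Algebra.Polynomial"
begin

section \<open>Isometry classes of nondegenerate symmetric bilinear forms\<close>

text \<open>A symmetric bilinear form on a finite-dimensional space is recorded by a Gram matrix; two Gram
  matrices give isometric forms iff they are congruent.\<close>

definition nondeg_sym :: "'a::field mat \<Rightarrow> bool" where
  "nondeg_sym A \<longleftrightarrow> square_mat A \<and> transpose_mat A = A \<and> invertible_mat A"

definition isometric :: "'a::field mat \<Rightarrow> 'a mat \<Rightarrow> bool" where
  "isometric A B \<longleftrightarrow> nondeg_sym A \<and> nondeg_sym B \<and>
     (\<exists>P \<in> carrier_mat (dim_row A) (dim_row A). invertible_mat P \<and> B = transpose_mat P * A * P)"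

definition orth_sum :: "'a::field mat \<Rightarrow> 'a mat \<Rightarrow> 'a mat" where
  "orth_sum A B = four_block_mat A (0\<^sub>m (dim_row A) (dim_col B)) (0\<^sub>m (dim_row B) (dim_col A)) B"

lemma invertible_mat_iff:
  assumes "P \<in> carrier_mat n n"
  shows "invertible_mat P \<longleftrightarrow> (\<exists>Q \<in> carrier_mat n n. P * Q = 1\<^sub>m n \<and> Q * P = 1\<^sub>m n)"
proof
  assume "invertible_mat P"
  then obtain Q where 1: "P * Q = 1\<^sub>m (dim_row P)" and 2: "Q * P = 1\<^sub>m (dim_row Q)"
    unfolding invertible_mat_def inverts_mat_def by auto
  have "dim_col Q = n" using arg_cong[OF 1, of dim_col] assms by simp
  moreover have "dim_row Q = n" using arg_cong[OF 2, of dim_col] assms by simp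
  ultimately show "\<exists>Q \<in> carrier_mat n n. P * Q = 1\<^sub>m n \<and> Q * P = 1\<^sub>m n"
    using 1 2 assms by (intro bexI[of _ Q]) auto
next
  assume "\<exists>Q \<in> carrier_mat n n. P * Q = 1\<^sub>m n \<and> Q * P = 1\<^sub>m n"
  then show "invertible_mat P"
    using assms unfolding invertible_mat_def inverts_mat_def by auto
qed

lemma mat_cancel_left:
  fixes P Q X :: "'a::field mat"
  assumes "P * Q = 1\<^sub>m n" "P \<in> carrier_mat n n" "Q \<in> carrier_mat n n" "X \<in> carrier_mat n m"
  shows "P * (Q * X) = X"
  using assms(1,4) by (simp flip: assoc_mult_mat[OF assms(2-4)])

lemma invertible_mat_times:
  fixes P Q :: "'a::field mat"
  assumes "P \<in> carrier_mat n n" "Q \<in> carrier_mat n n" "invertible_mat P" "invertible_mat Q"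
  shows "invertible_mat (P * Q)"
proof -
  obtain P' where P': "P' \<in> carrier_mat n n" "P * P' = 1\<^sub>m n" "P' * P = 1\<^sub>m n"
    using assms invertible_mat_iff by blast
  obtain Q' where Q': "Q' \<in> carrier_mat n n" "Q * Q' = 1\<^sub>m n" "Q' * Q = 1\<^sub>m n"
    using assms invertible_mat_iff by blast
  have "(P * Q) * (Q' * P') = P * (Q * (Q' * P'))"
    using assms P' Q' by (simp add: assoc_mult_mat[of _ n n _ n _ n])
  also have "\<dots> = 1\<^sub>m n" using assms P' Q' by (subst mat_cancel_left[of Q Q']) auto
  finally have 1: "(P * Q) * (Q' * P') = 1\<^sub>m n" .
  have "(Q' * P') * (P * Q) = Q' * (P' * (P * Q))"
    using assms P' Q' by (simp add: assoc_mult_mat[of _ n n _ n _ n])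
  also have "\<dots> = 1\<^sub>m n" using assms P' Q' by (subst mat_cancel_left[of P' P]) auto
  finally have 2: "(Q' * P') * (P * Q) = 1\<^sub>m n" .
  show ?thesis
    using 1 2 assms P' Q' by (subst invertible_mat_iff[of _ n]) (auto intro!: bexI[of _ "Q' * P'"] simp del: assoc_mult_mat)
qed

lemma invertible_mat_transpose:
  fixes P :: "'a::field mat"
  assumes "P \<in> carrier_mat n n" "invertible_mat P"
  shows "invertible_mat (transpose_mat P)"
proof -
  obtain Q where Q: "Q \<in> carrier_mat n n" "P * Q = 1\<^sub>m n" "Q * P = 1\<^sub>m n"
    using assms invertible_mat_iff by blast
  have "transpose_mat P * transpose_mat Q = 1\<^sub>m n"
    unfolding transpose_mult[OF Q(1) assms(1), symmetric] Q(3) by simp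
  moreover have "transpose_mat Q * transpose_mat P = 1\<^sub>m n"
    unfolding transpose_mult[OF assms(1) Q(1), symmetric] Q(2) by simp
  ultimately show ?thesis
    using assms Q by (subst invertible_mat_iff[of _ n]) (auto intro!: bexI[of _ "transpose_mat Q"])
qed

lemma nondeg_sym_dest:
  assumes "nondeg_sym A"
  shows "A \<in> carrier_mat (dim_row A) (dim_row A)" "dim_col A = dim_row A"
    "transpose_mat A = A" "invertible_mat A"
  using assms unfolding nondeg_sym_def by auto

lemma isometricI:
  assumes "nondeg_sym A" "A \<in> carrier_mat n n" "P \<in> carrier_mat n n" "invertible_mat P"
    "B = transpose_mat P * A * P"
  shows "isometric A B"
proof -
  have B: "B \<in> carrier_mat n n" using assms by auto
  have "transpose_mat B = transpose_mat P * (transpose_mat A * P)"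
    unfolding assms(5) using assms
    by (simp add: transpose_mult[of _ n n _ n])
  also have "\<dots> = B"
    using assms by (simp add: nondeg_sym_def assoc_mult_mat[of _ n n _ n _ n])
  finally have "transpose_mat B = B" .
  moreover have "invertible_mat B"
    unfolding assms(5) using assms
    by (intro invertible_mat_times[of _ n] invertible_mat_transpose[of _ n])
       (auto simp: nondeg_sym_def)
  ultimately have "nondeg_sym B" using B by (auto simp: nondeg_sym_def)
  then show ?thesis unfolding isometric_def using assms by auto
qed

lemma isometricE:
  assumes "isometric A B"
  obtains P where "P \<in> carrier_mat (dim_row A) (dim_row A)" "invertible_mat P"
    "B = transpose_mat P * A * P" "nondeg_sym A" "nondeg_sym B"
  using assms unfolding isometric_def by blast

lemma isometric_refl: "nondeg_sym A \<Longrightarrow> isometric A A"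
  by (rule isometricI[of _ "dim_row A" "1\<^sub>m (dim_row A)"])
     (auto simp: nondeg_sym_def invertible_mat_iff[of _ "dim_row A"] dest: nondeg_sym_dest)

lemma isometric_sym:
  assumes iso: "isometric A B"
  shows "isometric B A"
proof -
  define n where "n = dim_row A"
  obtain P where P: "P \<in> carrier_mat n n" "invertible_mat P" "B = transpose_mat P * A * P"
    and A: "nondeg_sym A" and B: "nondeg_sym B"
    unfolding n_def using iso by (rule isometricE)
  have cA: "A \<in> carrier_mat n n" unfolding n_def by (rule nondeg_sym_dest(1)[OF A])
  obtain Q where Q: "Q \<in> carrier_mat n n" "P * Q = 1\<^sub>m n" "Q * P = 1\<^sub>m n"
    using P invertible_mat_iff by blast
  have QP: "transpose_mat Q * transpose_mat P = 1\<^sub>m n"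
    unfolding transpose_mult[OF P(1) Q(1), symmetric] Q(2) by simp
  have cB: "B \<in> carrier_mat n n" unfolding P(3) using P(1) cA by simp
  have "transpose_mat Q * B * Q = transpose_mat Q * (transpose_mat P * (A * (P * Q)))"
    unfolding P(3) using P(1) Q(1) cA by (simp add: assoc_mult_mat[of _ n n _ n _ n])
  also have "\<dots> = A"
    unfolding Q(2) using QP P(1) Q(1) cA by (subst mat_cancel_left[of _ _ n _ n]) auto
  finally have eq: "A = transpose_mat Q * B * Q" ..
  have "invertible_mat Q" using Q P(1) by (subst invertible_mat_iff[of _ n]) auto
  then show ?thesis using B cB Q(1) eq by (intro isometricI[of _ n Q])
qed

lemma isometric_trans:
  assumes iso: "isometric A B" and iso': "isometric B C"
  shows "isometric A C"
proof -
  define n where "n = dim_row A"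
  obtain P where P: "P \<in> carrier_mat n n" "invertible_mat P" "B = transpose_mat P * A * P"
    and A: "nondeg_sym A" and B: "nondeg_sym B"
    unfolding n_def using iso by (rule isometricE)
  have cA: "A \<in> carrier_mat n n" unfolding n_def by (rule nondeg_sym_dest(1)[OF A])
  have "dim_row B = n" unfolding P(3) using P(1) by simp
  then obtain Q where Q: "Q \<in> carrier_mat n n" "invertible_mat Q" "C = transpose_mat Q * B * Q"
    using iso' by (metis isometricE)
  have "C = transpose_mat (P * Q) * A * (P * Q)"
    unfolding Q(3) P(3) transpose_mult[OF P(1) Q(1)] using P(1) Q(1) cA
    by (simp add: assoc_mult_mat[of _ n n _ n _ n])
  then show ?thesis
    using P(1,2) Q(1,2) A cA
    by (intro isometricI[of _ n "P * Q"]) (auto intro: invertible_mat_times simp del: assoc_mult_mat)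
qed

lemma orth_sum_carrier:
  assumes "A \<in> carrier_mat n n" "B \<in> carrier_mat m m"
  shows "orth_sum A B \<in> carrier_mat (n + m) (n + m)"
  using assms unfolding orth_sum_def by auto

lemma orth_sum_mult:
  assumes "A \<in> carrier_mat n n" "B \<in> carrier_mat m m" "C \<in> carrier_mat n n" "D \<in> carrier_mat m m"
  shows "orth_sum A B * orth_sum C D = orth_sum (A * C) (B * D)"
  using assms unfolding orth_sum_def
  by (subst mult_four_block_mat[of _ n n _ m _ m]) auto

lemma orth_sum_transpose:
  assumes "A \<in> carrier_mat n n" "B \<in> carrier_mat m m"
  shows "transpose_mat (orth_sum A B) = orth_sum (transpose_mat A) (transpose_mat B)"
  using assms unfolding orth_sum_def by (subst transpose_four_block_mat[of _ n n _ m _ m]) auto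

lemma orth_sum_one: "orth_sum (1\<^sub>m n) (1\<^sub>m m) = 1\<^sub>m (n + m)"
  unfolding orth_sum_def by simp

lemma orth_sum_invertible:
  assumes "A \<in> carrier_mat n n" "B \<in> carrier_mat m m" "invertible_mat A" "invertible_mat B"
  shows "invertible_mat (orth_sum A B)"
proof -
  obtain A' where A': "A' \<in> carrier_mat n n" "A * A' = 1\<^sub>m n" "A' * A = 1\<^sub>m n"
    using assms invertible_mat_iff by blast
  obtain B' where B': "B' \<in> carrier_mat m m" "B * B' = 1\<^sub>m m" "B' * B = 1\<^sub>m m"
    using assms invertible_mat_iff by blast
  show ?thesis
    using assms A' B'
    by (subst invertible_mat_iff[of _ "n + m"])
       (auto intro!: bexI[of _ "orth_sum A' B'"] orth_sum_carrier simp: orth_sum_mult[of _ n _ m] orth_sum_one)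
qed

lemma nondeg_sym_orth_sum:
  assumes "nondeg_sym A" "nondeg_sym B"
  shows "nondeg_sym (orth_sum A B)"
proof -
  note A = nondeg_sym_dest[OF assms(1)] and B = nondeg_sym_dest[OF assms(2)]
  have "transpose_mat (orth_sum A B) = orth_sum A B"
    unfolding orth_sum_transpose[OF A(1) B(1)] A(3) B(3) ..
  moreover have "invertible_mat (orth_sum A B)"
    by (rule orth_sum_invertible[OF A(1) B(1) A(4) B(4)])
  moreover have "square_mat (orth_sum A B)"
    using orth_sum_carrier[OF A(1) B(1)] by auto
  ultimately show ?thesis unfolding nondeg_sym_def by blast
qed

lemma isometric_orth_sum:
  assumes iso: "isometric A B" and iso': "isometric C D"
  shows "isometric (orth_sum A C) (orth_sum B D)"
proof -
  define n m where nm: "n = dim_row A" "m = dim_row C"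
  obtain P where P: "P \<in> carrier_mat n n" "invertible_mat P" "B = transpose_mat P * A * P"
    and A: "nondeg_sym A"
    unfolding nm using iso by (rule isometricE)
  obtain Q where Q: "Q \<in> carrier_mat m m" "invertible_mat Q" "D = transpose_mat Q * C * Q"
    and C: "nondeg_sym C"
    unfolding nm using iso' by (rule isometricE)
  have c: "A \<in> carrier_mat n n" "C \<in> carrier_mat m m"
    unfolding nm using nondeg_sym_dest(1) A C by auto
  have "orth_sum B D = transpose_mat (orth_sum P Q) * orth_sum A C * orth_sum P Q"
    unfolding P(3) Q(3) orth_sum_transpose[OF P(1) Q(1)] using P(1) Q(1) c
    by (simp add: orth_sum_mult[of _ n _ m])
  moreover have "invertible_mat (orth_sum P Q)"
    by (rule orth_sum_invertible[OF P(1) Q(1) P(2) Q(2)])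
  ultimately show ?thesis
    using nondeg_sym_orth_sum[OF A C] orth_sum_carrier[OF c] orth_sum_carrier[OF P(1) Q(1)]
    by (intro isometricI[of _ "n + m" "orth_sum P Q"])
qed

lemma orth_sum_assoc: "orth_sum (orth_sum A B) C = orth_sum A (orth_sum B C)"
  unfolding orth_sum_def by (rule assoc_four_block_mat[symmetric])

lemma isometric_orth_sum_commute:
  fixes A B :: "'a::field mat"
  assumes A: "nondeg_sym A" and B: "nondeg_sym B"
  shows "isometric (orth_sum A B) (orth_sum B A)"
proof -
  define n m where nm: "n = dim_row A" "m = dim_row B"
  have c: "A \<in> carrier_mat n n" "B \<in> carrier_mat m m"
    unfolding nm using nondeg_sym_dest(1) A B by auto
  define P :: "'a mat" where "P = four_block_mat (0\<^sub>m n m) (1\<^sub>m n) (1\<^sub>m m) (0\<^sub>m m n)"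
  define Q :: "'a mat" where "Q = four_block_mat (0\<^sub>m m n) (1\<^sub>m m) (1\<^sub>m n) (0\<^sub>m n m)"
  have cP: "P \<in> carrier_mat (n + m) (n + m)" and cQ: "Q \<in> carrier_mat (n + m) (n + m)"
    unfolding P_def Q_def using four_block_carrier_mat[of "0\<^sub>m n m" n m "0\<^sub>m m n" m n]
      four_block_carrier_mat[of "0\<^sub>m m n" m n "0\<^sub>m n m" n m] by (auto simp: add.commute)
  have "transpose_mat P = Q"
    unfolding P_def Q_def by (subst transpose_four_block_mat[of _ n m _ n _ m]) auto
  moreover have "P * Q = 1\<^sub>m (n + m)"
    unfolding P_def Q_def by (subst mult_four_block_mat[of _ n m _ n _ m]) auto
  moreover have "Q * P = 1\<^sub>m (n + m)"
    unfolding P_def Q_def by (subst mult_four_block_mat[of _ m n _ m _ n]) (auto simp: add.commute)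
  moreover have "Q * orth_sum A B = four_block_mat (0\<^sub>m m n) B A (0\<^sub>m n m)"
    unfolding Q_def orth_sum_def using c
    by (subst mult_four_block_mat[of _ m n _ m _ n]) auto
  moreover have "four_block_mat (0\<^sub>m m n) B A (0\<^sub>m n m) * P = orth_sum B A"
    unfolding P_def orth_sum_def using c
    by (subst mult_four_block_mat[of _ m n _ m _ n]) auto
  ultimately have "invertible_mat P" "orth_sum B A = transpose_mat P * orth_sum A B * P"
    using cP cQ by (auto simp: invertible_mat_iff[of _ "n + m"])
  then show ?thesis
    using nondeg_sym_orth_sum[OF A B] orth_sum_carrier[OF c] cP
    by (intro isometricI[of _ "n + m" P])
qed

lemma nondeg_sym_empty: "nondeg_sym (0\<^sub>m 0 0)"
  unfolding nondeg_sym_def by (auto simp: invertible_mat_iff[of _ 0] intro!: bexI[of _ "0\<^sub>m 0 0"])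

lemma orth_sum_empty: "orth_sum (0\<^sub>m 0 0) A = A"
  unfolding orth_sum_def by (rule eq_matI) auto

quotient_type (overloaded) 'a isometry_class = "'a::field mat" / partial: isometric
proof (rule part_equivpI)
  show "\<exists>A::'a mat. isometric A A" using isometric_refl nondeg_sym_empty by blast
  show "symp (isometric :: 'a mat \<Rightarrow> _)" using isometric_sym by (blast intro: sympI)
  show "transp (isometric :: 'a mat \<Rightarrow> _)" using isometric_trans by (blast intro: transpI)
qed

instantiation isometry_class :: (field) comm_monoid_add
begin

lift_definition zero_isometry_class :: "'a isometry_class" is "0\<^sub>m 0 0"
  by (rule isometric_refl[OF nondeg_sym_empty])

lift_definition plus_isometry_class ::
    "'a isometry_class \<Rightarrow> 'a isometry_class \<Rightarrow> 'a isometry_class" is orth_sum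
  by (rule isometric_orth_sum)

instance
proof
  fix a b c :: "'a isometry_class"
  show "a + b + c = a + (b + c)"
    by transfer (metis orth_sum_assoc isometric_refl nondeg_sym_orth_sum isometric_def)
  show "a + b = b + a"
    by transfer (metis isometric_orth_sum_commute isometric_def)
  show "0 + a = a"
    by transfer (simp add: orth_sum_empty)
qed

end

section \<open>Group completion and the Grothendieck--Witt group\<close>

definition completion_rel :: "'m::comm_monoid_add \<times> 'm \<Rightarrow> 'm \<times> 'm \<Rightarrow> bool" where
  "completion_rel p q \<longleftrightarrow> (\<exists>e. fst p + snd q + e = fst q + snd p + e)"

lemma completion_rel_trans:
  assumes "completion_rel p q" "completion_rel q r"
  shows "completion_rel p r"
proof -
  obtain d where d: "fst p + snd q + d = fst q + snd p + d" using assms completion_rel_def by blast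
  obtain e where e: "fst q + snd r + e = fst r + snd q + e" using assms completion_rel_def by blast
  have "fst p + snd r + (snd q + d + e) = (fst p + snd q + d) + snd r + e" by (simp add: ac_simps)
  also have "\<dots> = (fst q + snd r + e) + snd p + d" unfolding d by (simp add: ac_simps)
  also have "\<dots> = fst r + snd p + (snd q + d + e)" unfolding e by (simp add: ac_simps)
  finally show ?thesis unfolding completion_rel_def by blast
qed

quotient_type (overloaded) 'm group_completion = "'m::comm_monoid_add \<times> 'm" / completion_rel
proof (rule equivpI)
  show "reflp (completion_rel :: 'm \<times> 'm \<Rightarrow> _)" by (auto simp: reflp_def completion_rel_def)
  show "symp (completion_rel :: 'm \<times> 'm \<Rightarrow> _)" by (auto simp: symp_def completion_rel_def intro: sym)
  show "transp (completion_rel :: 'm \<times> 'm \<Rightarrow> _)" using completion_rel_trans by (blast intro: transpI)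
qed

instantiation group_completion :: (comm_monoid_add) ab_group_add
begin

lift_definition zero_group_completion :: "'a group_completion" is "(0, 0)" .

lift_definition plus_group_completion ::
    "'a group_completion \<Rightarrow> 'a group_completion \<Rightarrow> 'a group_completion"
  is "\<lambda>(a, b) (c, d). (a + c, b + d)"
proof (clarsimp simp: completion_rel_def)
  fix a b a' b' c d c' d' e e' :: 'a
  assume 1: "a + b' + e = a' + b + e" and 2: "c + d' + e' = c' + d + e'"
  have "a + c + (b' + d') + (e + e') = (a + b' + e) + (c + d' + e')" by (simp add: ac_simps)
  also have "\<dots> = a' + c' + (b + d) + (e + e')" unfolding 1 2 by (simp add: ac_simps)
  finally show "\<exists>u. a + c + (b' + d') + u = a' + c' + (b + d) + u" by blast
qed

lift_definition uminus_group_completion :: "'a group_completion \<Rightarrow> 'a group_completion"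
  is "\<lambda>(a, b). (b, a)"
  by (auto simp: completion_rel_def ac_simps) metis

definition minus_group_completion ::
    "'a group_completion \<Rightarrow> 'a group_completion \<Rightarrow> 'a group_completion" where
  "minus_group_completion u v = u + - v"

instance
proof
  fix u v w :: "'a group_completion"
  show "u + v + w = u + (v + w)" by transfer (auto simp: completion_rel_def ac_simps)
  show "u + v = v + u" by transfer (auto simp: completion_rel_def ac_simps)
  show "0 + u = u" by transfer (auto simp: completion_rel_def ac_simps)
  show "- u + u = 0" by transfer (auto simp: completion_rel_def ac_simps)
  show "u - v = u + - v" by (rule minus_group_completion_def)
qed

end

lift_definition to_completion :: "'m::comm_monoid_add \<Rightarrow> 'm group_completion" is "\<lambda>a. (a, 0)" .

text \<open>The extension of an additive map of monoids to the group completions.\<close>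

definition completion_map ::
    "('m::comm_monoid_add \<Rightarrow> 'n::comm_monoid_add) \<Rightarrow> 'm group_completion \<Rightarrow> 'n group_completion" where
  "completion_map h u = (case rep_group_completion u of (a, b) \<Rightarrow> to_completion (h a) - to_completion (h b))"

type_synonym 'a GW = "'a isometry_class group_completion"

text \<open>\<open>gw_class M\<close> is meaningful only for \<open>nondeg_sym M\<close>.\<close>

definition gw_class :: "'a::field mat \<Rightarrow> 'a GW" where
  "gw_class M = to_completion (abs_isometry_class M)"

definition gw_unit :: "'a::field \<Rightarrow> 'a GW" where
  "gw_unit a = gw_class (mat 1 1 (\<lambda>_. a))"

definition gw_hyperbolic :: "'a::field GW" where
  "gw_hyperbolic = gw_unit 1 + gw_unit (-1)"

section \<open>Forms on subquotients, and the trace\<close>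

text \<open>Throughout, a field homomorphism \<open>\<iota>\<close> from \<open>F\<close> makes its target an \<open>F\<close>-algebra.
  \<open>basis_mod \<iota> V W bs\<close>: \<open>bs\<close> is a list in \<open>V\<close> whose classes form an \<open>F\<close>-basis of \<open>V / W\<close>.\<close>

definition basis_mod :: "('a::field \<Rightarrow> 'l::field) \<Rightarrow> 'l set \<Rightarrow> 'l set \<Rightarrow> 'l list \<Rightarrow> bool" where
  "basis_mod \<iota> V W bs \<longleftrightarrow> set bs \<subseteq> V \<and>
     (\<forall>v\<in>V. \<exists>!c. c \<in> carrier_vec (length bs) \<and> v - (\<Sum>i<length bs. \<iota> (c $ i) * bs ! i) \<in> W)"

text \<open>\<open>\<beta>\<close> is a bilinear form on \<open>V\<close> with \<open>W\<close> in its radical; \<open>c\<close> is the class of the induced form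
  on \<open>V / W\<close>, which is required to be finite-dimensional, symmetric and nondegenerate.\<close>

definition has_gw_class ::
    "('a::field \<Rightarrow> 'l::field) \<Rightarrow> 'l set \<Rightarrow> 'l set \<Rightarrow> ('l \<Rightarrow> 'l \<Rightarrow> 'a) \<Rightarrow> 'a GW \<Rightarrow> bool" where
  "has_gw_class \<iota> V W \<beta> c \<longleftrightarrow>
     (\<exists>bs. basis_mod \<iota> V W bs \<and>
       (let M = mat (length bs) (length bs) (\<lambda>(i, j). \<beta> (bs ! i) (bs ! j))
        in nondeg_sym M \<and> c = gw_class M))"

text \<open>For a finite extension \<open>\<kappa> : F \<rightarrow> k\<close>; the trace and the class of the transferred form do
  not depend on the basis.\<close>

definition ext_basis :: "('a::field \<Rightarrow> 'k::field) \<Rightarrow> 'k list" where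
  "ext_basis \<kappa> = (SOME bs. basis_mod \<kappa> UNIV {0} bs)"

definition ext_coords :: "('a::field \<Rightarrow> 'k::field) \<Rightarrow> 'k \<Rightarrow> 'a vec" where
  "ext_coords \<kappa> z = (THE c. c \<in> carrier_vec (length (ext_basis \<kappa>)) \<and>
     z = (\<Sum>i<length (ext_basis \<kappa>). \<kappa> (c $ i) * ext_basis \<kappa> ! i))"

definition field_trace :: "('a::field \<Rightarrow> 'k::field) \<Rightarrow> 'k \<Rightarrow> 'a" where
  "field_trace \<kappa> z = (\<Sum>j<length (ext_basis \<kappa>). ext_coords \<kappa> (z * ext_basis \<kappa> ! j) $ j)"

text \<open>The Gram matrix of \<open>(u, v) \<mapsto> Tr (u\<^sup>T M v)\<close> on \<open>k\<^sup>n\<close>, over \<open>F\<close>, in the basis formed by the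
  products \<open>e\<^sub>r b\<^sub>s\<close> of the standard basis of \<open>k\<^sup>n\<close> with the basis \<open>b\<close> of \<open>k\<close>.\<close>

definition trace_mat :: "('a::field \<Rightarrow> 'k::field) \<Rightarrow> 'k mat \<Rightarrow> 'a mat" where
  "trace_mat \<kappa> M = (let b = ext_basis \<kappa>; d = length b; n = dim_row M in
     mat (n * d) (n * d)
       (\<lambda>(i, j). field_trace \<kappa> (M $$ (i div d, j div d) * (b ! (i mod d)) * (b ! (j mod d)))))"

definition gw_trace :: "('a::field \<Rightarrow> 'k::field) \<Rightarrow> 'k GW \<Rightarrow> 'a GW" where
  "gw_trace \<kappa> = completion_map (\<lambda>c. abs_isometry_class (trace_mat \<kappa> (rep_isometry_class c)))"

section \<open>Hyperelliptic curves\<close>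

text \<open>Elements of \<open>F[X, Y]\<close> are polynomials in \<open>Y\<close> over \<open>F[X]\<close>.\<close>

definition eval2 ::
    "('a::comm_ring_1 \<Rightarrow> 'b::comm_ring_1) \<Rightarrow> 'b \<Rightarrow> 'b \<Rightarrow> 'a poly poly \<Rightarrow> 'b" where
  "eval2 h X Y P = poly (map_poly (\<lambda>q. poly (map_poly h q) X) P) Y"

definition partial_X :: "'a::field poly poly \<Rightarrow> 'a poly poly" where
  "partial_X P = map_poly pderiv P"

abbreviation partial_Y :: "'a::field poly poly \<Rightarrow> 'a poly poly" where
  "partial_Y P \<equiv> pderiv P"

text \<open>The equation \<open>Y\<^sup>2 - f(X)\<close>.\<close>

definition curve_eq :: "'a::field poly \<Rightarrow> 'a poly poly" where
  "curve_eq f = [:- f, 0, 1:]"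

definition smooth_affine_plane_curve :: "'a::field poly poly \<Rightarrow> bool" where
  "smooth_affine_plane_curve P \<longleftrightarrow> (\<exists>a b c. a * P + b * partial_X P + c * partial_Y P = 1)"

text \<open>The rational functions in \<open>X\<close>, \<open>Y\<close> regular at a point with coordinates \<open>(px, py)\<close> in an
  extension of \<open>F\<close>, evaluated at \<open>(X, Y)\<close>; and those that moreover vanish there.\<close>

definition local_ring ::
    "('a::field \<Rightarrow> 'l::field) \<Rightarrow> 'l \<Rightarrow> 'l \<Rightarrow> ('a \<Rightarrow> 'k::field) \<Rightarrow> 'k \<Rightarrow> 'k \<Rightarrow> 'l set" where
  "local_ring \<iota> X Y \<kappa> px py =
     {eval2 \<iota> X Y A / eval2 \<iota> X Y B | A B. eval2 \<kappa> px py B \<noteq> 0}"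

definition local_max_ideal ::
    "('a::field \<Rightarrow> 'l::field) \<Rightarrow> 'l \<Rightarrow> 'l \<Rightarrow> ('a \<Rightarrow> 'k::field) \<Rightarrow> 'k \<Rightarrow> 'k \<Rightarrow> 'l set" where
  "local_max_ideal \<iota> X Y \<kappa> px py =
     {eval2 \<iota> X Y A / eval2 \<iota> X Y B | A B. eval2 \<kappa> px py A = 0 \<and> eval2 \<kappa> px py B \<noteq> 0}"

text \<open>Powers of an ideal \<open>I\<close> of a ring \<open>R\<close>.\<close>

fun ideal_power :: "'l::comm_ring_1 set \<Rightarrow> 'l set \<Rightarrow> nat \<Rightarrow> 'l set" where
  "ideal_power R I 0 = R"
| "ideal_power R I (Suc n) =
     {\<Sum>(a, b)\<leftarrow>zs. a * b | zs. set zs \<subseteq> I \<times> ideal_power R I n}"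

text \<open>The curve \<open>X\<close> enters through its rational functions: \<open>x\<close>, \<open>y\<close> are elements of a field \<open>L\<close>
  over \<open>F\<close> with \<open>y\<^sup>2 = f(x)\<close> and \<open>x\<close> transcendental, so that \<open>F(x, y) \<subseteq> L\<close> is the function field of
  \<open>X\<close> and \<open>F[x, y]\<close> is the coordinate ring of \<open>X\<close> minus its single point at infinity. Nothing
  depends on \<open>L\<close> beyond \<open>F(x, y)\<close>.\<close>

locale hyperelliptic_curve = field_hom \<iota>
  for \<iota> :: "'a::field \<Rightarrow> 'l::field" and x y :: 'l and f :: "'a poly" and g :: nat +
  assumes char_ne_2: "CHAR('a) \<noteq> 2"
    and degree_f: "degree f = 2 * g + 1"
    and smooth: "smooth_affine_plane_curve (curve_eq f)"
    and x_transcendental: "\<And>q. poly (map_poly \<iota> q) x = 0 \<Longrightarrow> q = 0"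
    and on_curve: "eval2 \<iota> x y (curve_eq f) = 0"
begin

definition coordinate_ring :: "'l set" where
  "coordinate_ring = range (eval2 \<iota> x y)"

text \<open>The chart at infinity is \<open>v\<^sup>2 = u\<^bsup>2g+2\<^esup> f(1/u)\<close>, \<open>u = 1/x\<close>, \<open>v = y/x\<^bsup>g+1\<^esup>\<close>, with the point at
  infinity at the origin; \<open>u\<close> has divisor \<open>2\<infinity>\<close> near \<open>\<infinity>\<close>.\<close>

definition local_ring_infinity :: "'l set" where
  "local_ring_infinity = local_ring \<iota> (1 / x) (y / x ^ (g + 1)) id 0 0"

text \<open>\<open>H\<^sup>0(X, O(2l\<infinity>))\<close>\<close>

definition sections_infinity :: "nat \<Rightarrow> 'l set" where
  "sections_infinity l = {s \<in> coordinate_ring. s * (1 / x) ^ l \<in> local_ring_infinity}"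

text \<open>The ring of functions on the principal open subset \<open>D(h)\<close> of \<open>X\<close> minus infinity.\<close>

definition functions_on :: "'a poly poly \<Rightarrow> 'l set" where
  "functions_on h = {eval2 \<iota> x y A / eval2 \<iota> x y h ^ n | A n. True}"

text \<open>The function \<open>T(x, y)\<close> is an etale coordinate on \<open>D(h)\<close>: the Jacobian determinant of
  \<open>(Y\<^sup>2 - f(X), T(X, Y))\<close> is a unit there.\<close>

definition etale_coordinate_on :: "'a poly poly \<Rightarrow> 'a poly poly \<Rightarrow> bool" where
  "etale_coordinate_on h T \<longleftrightarrow>
     (\<exists>u \<in> functions_on h. u * eval2 \<iota> x y
        (partial_X (curve_eq f) * partial_Y T - partial_Y (curve_eq f) * partial_X T) = 1)"

definition hasse_derivatives :: "'l set \<Rightarrow> 'l \<Rightarrow> (nat \<Rightarrow> 'l \<Rightarrow> 'l) \<Rightarrow> bool" where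
  "hasse_derivatives R t D \<longleftrightarrow>
     (\<forall>k. \<forall>\<phi>\<in>R. D k \<phi> \<in> R) \<and>
     (\<forall>k. \<forall>\<phi>\<in>R. \<forall>\<psi>\<in>R. D k (\<phi> + \<psi>) = D k \<phi> + D k \<psi>) \<and>
     (\<forall>k c. \<forall>\<phi>\<in>R. D k (\<iota> c * \<phi>) = \<iota> c * D k \<phi>) \<and>
     (\<forall>\<phi>\<in>R. D 0 \<phi> = \<phi>) \<and>
     (\<forall>k. \<forall>\<phi>\<in>R. \<forall>\<psi>\<in>R. D k (\<phi> * \<psi>) = (\<Sum>i\<le>k. D i \<phi> * D (k - i) \<psi>)) \<and>
     (\<forall>k n. D k (t ^ n) = of_nat (n choose k) * t ^ (n - k))"

text \<open>The Wronskian section on \<open>X\<close> minus infinity, in the trivialization given by \<open>s = 1\<close> and the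
  coordinate whose Hasse derivatives are \<open>D\<close>.\<close>

definition hasse_wronskian :: "(nat \<Rightarrow> 'l \<Rightarrow> 'l) \<Rightarrow> 'l list \<Rightarrow> 'l" where
  "hasse_wronskian D fs = det (mat (length fs) (length fs) (\<lambda>(i, j). D i (fs ! j)))"

text \<open>\<open>B(T\<^sub>1, T\<^sub>2)\<close> is the quotient \<open>(G(T\<^sub>1) - G(T\<^sub>2)) / (T\<^sub>1 - T\<^sub>2)\<close>; the inner variable is \<open>T\<^sub>1\<close>.\<close>

definition difference_quotient :: "'a poly \<Rightarrow> 'a poly poly \<Rightarrow> bool" where
  "difference_quotient G B \<longleftrightarrow>
     B * ([:[:0, 1:]:] - [:0, 1:]) = [:G:] - map_poly (\<lambda>c. [:c:]) G"

text \<open>\<open>\<eta>\<close> is a linear form on \<open>A = R / I\<close> with \<open>(\<eta> \<otimes> id)(B(t \<otimes> 1, 1 \<otimes> t)) = 1\<close> in \<open>A\<close>.\<close>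

definition bezoutian_form :: "'l set \<Rightarrow> 'l set \<Rightarrow> 'l \<Rightarrow> 'a poly \<Rightarrow> ('l \<Rightarrow> 'a) \<Rightarrow> bool" where
  "bezoutian_form R I t G \<eta> \<longleftrightarrow>
     (\<forall>u\<in>R. \<forall>v\<in>R. \<eta> (u + v) = \<eta> u + \<eta> v) \<and>
     (\<forall>c. \<forall>u\<in>R. \<eta> (\<iota> c * u) = c * \<eta> u) \<and>
     (\<forall>u\<in>I. \<eta> u = 0) \<and>
     (\<exists>B. difference_quotient G B \<and>
        (\<Sum>j\<le>degree B. \<Sum>i\<le>degree (coeff B j). \<iota> (\<eta> (\<iota> (coeff (coeff B j) i) * t ^ i)) * t ^ j) - 1 \<in> I)"

text \<open>The local index at a closed point of the complete linear series of \<open>O(2l\<infinity>)\<close> with basis \<open>fs\<close>: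
  \<open>c\<close> is the class obtained from some admissible choice of a Nisnevich coordinate
  \<open>t = ax + by\<close> on a neighbourhood \<open>D(h)\<close> of the point, of \<open>n\<close> and of \<open>G\<close>. The closed point is given
  by its coordinates in its residue field \<open>\<kappa> : F \<rightarrow> k\<close>.\<close>

definition is_local_index ::
    "nat \<Rightarrow> 'l list \<Rightarrow> ('a \<Rightarrow> 'k::field) \<Rightarrow> 'k \<Rightarrow> 'k \<Rightarrow> 'a GW \<Rightarrow> bool" where
  "is_local_index l fs \<kappa> px py c \<longleftrightarrow>
     basis_mod \<iota> (sections_infinity l) {0} fs \<and>
     (\<exists>a b h D n G \<eta>.
       let R = local_ring \<iota> x y \<kappa> px py;
           \<mm> = local_max_ideal \<iota> x y \<kappa> px py;
           t = \<iota> a * x + \<iota> b * y;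
           \<phi> = hasse_wronskian D fs;
           I = (\<lambda>u. \<phi> * u) ` R
       in eval2 \<kappa> px py h \<noteq> 0 \<and>
          etale_coordinate_on h [:[:0, a:], [:b:]:] \<and>
          (\<forall>z. \<exists>q. z = poly (map_poly \<kappa> q) (\<kappa> a * px + \<kappa> b * py)) \<and>
          hasse_derivatives (functions_on h) t D \<and>
          ideal_power R \<mm> n \<subseteq> I \<and>
          poly (map_poly \<iota> G) t - \<phi> \<in> ideal_power R \<mm> (2 * n) \<and>
          bezoutian_form R I t G \<eta> \<and>
          has_gw_class \<iota> R I (\<lambda>u v. \<eta> (u * v)) c)"

definition local_index ::
    "nat \<Rightarrow> 'l list \<Rightarrow> ('a \<Rightarrow> 'k::field) \<Rightarrow> 'k \<Rightarrow> 'k \<Rightarrow> 'a GW" where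
  "local_index l fs \<kappa> px py = (THE c. is_local_index l fs \<kappa> px py c)"

text \<open>The rest of the locale shows that \<open>1, x, ..., x\<^sup>l\<close> is a basis of \<open>H\<^sup>0(X, O(2l\<infinity>))\<close> for
  \<open>l \<le> g\<close>, so that \<open>is_local_index\<close> applies to it.\<close>

abbreviation (input) ev :: "'a poly \<Rightarrow> 'l" where
  "ev A \<equiv> poly (map_poly \<iota> A) x"

lemma ev_simps:
  "ev 0 = 0" "ev 1 = 1" "ev (A + B) = ev A + ev B" "ev (A * B) = ev A * ev B"
  "ev (A - B) = ev A - ev B" "ev (- A) = - ev A" "ev (pCons c A) = \<iota> c + x * ev A"
  "ev (monom c n) = \<iota> c * x ^ n"
proof -
  interpret mp: map_poly_comm_ring_hom \<iota> ..
  show "ev 0 = 0" "ev 1 = 1" "ev (A + B) = ev A + ev B" "ev (A * B) = ev A * ev B"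
    "ev (A - B) = ev A - ev B" "ev (- A) = - ev A" "ev (pCons c A) = \<iota> c + x * ev A"
    "ev (monom c n) = \<iota> c * x ^ n"
    by (simp_all add: hom_distribs mp.hom_mult mp.hom_minus mp.hom_uminus poly_monom)
qed

lemma ev_eq_iff: "ev A = ev B \<longleftrightarrow> A = B"
  using x_transcendental[of "A - B"] by (auto simp: ev_simps)

lemma y_square: "y * y = ev f"
proof -
  have "eval2 \<iota> x y (curve_eq f) = y * y - ev f"
    by (simp add: eval2_def curve_eq_def map_poly_pCons ev_simps algebra_simps)
  then show ?thesis using on_curve by simp
qed

lemma eval2_pCons:
  assumes "h 0 = 0"
  shows "eval2 h X Y (pCons c P) = poly (map_poly h c) X + Y * eval2 h X Y P"
  using assms by (cases "c = 0 \<and> P = 0") (auto simp: eval2_def map_poly_pCons)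

lemma coordinate_ring_normal_form:
  assumes "s \<in> coordinate_ring"
  obtains A B where "s = ev A + ev B * y"
proof -
  have "\<exists>A B. eval2 \<iota> x y P = ev A + ev B * y" for P
  proof (induction P)
    case 0
    then show ?case by (intro exI[of _ 0]) (simp add: eval2_def)
  next
    case (pCons c P)
    then obtain A B where "eval2 \<iota> x y P = ev A + ev B * y" by blast
    then have "eval2 \<iota> x y (pCons c P) = ev (c + B * f) + ev A * y"
      by (simp add: eval2_pCons ev_simps y_square[symmetric] algebra_simps)
    then show ?case by blast
  qed
  then show ?thesis using assms that unfolding coordinate_ring_def by blast
qed

lemma degree_norm:
  assumes "B \<noteq> 0"
  shows "A * A - f * (B * B) \<noteq> 0" "2 * g + 1 \<le> degree (A * A - f * (B * B))"
proof -
  have f0: "f \<noteq> 0" using degree_f by auto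
  have dB: "degree (f * (B * B)) = 2 * g + 1 + 2 * degree B"
    using assms f0 degree_f by (simp add: degree_mult_eq)
  have dA: "degree (A * A) = 2 * degree A" by (cases "A = 0") (simp_all add: degree_mult_eq)
  have "degree (A * A) \<noteq> degree (f * (B * B))" unfolding dA dB by presburger
  then consider "degree (A * A) < degree (- (f * (B * B)))" | "degree (- (f * (B * B))) < degree (A * A)"
    by (metis degree_minus linorder_neqE_nat)
  then have "degree (A * A + - (f * (B * B))) \<ge> degree (- (f * (B * B)))"
    by cases (simp_all only: degree_add_eq_left degree_add_eq_right order_refl less_imp_le)
  then have "degree (A * A - f * (B * B)) \<ge> degree (f * (B * B))" by simp
  then show "2 * g + 1 \<le> degree (A * A - f * (B * B))" using dB by simp
  then show "A * A - f * (B * B) \<noteq> 0" by auto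
qed

lemma normal_form_zero:
  assumes "ev A + ev B * y = 0"
  shows "A = 0" "B = 0"
proof -
  have "ev (A * A - f * (B * B)) = (ev A + ev B * y) * (ev A - ev B * y)"
    by (simp add: ev_simps y_square[symmetric] algebra_simps)
  then have "A * A - f * (B * B) = 0" unfolding assms by (intro x_transcendental) simp
  then show "B = 0" using degree_norm(1) by blast
  then show "A = 0" using assms x_transcendental by (simp add: ev_simps)
qed

lemma normal_form_unique:
  assumes "ev A + ev B * y = ev A' + ev B' * y"
  shows "A = A'" "B = B'"
  using normal_form_zero[of "A - A'" "B - B'"] assms by (simp_all add: ev_simps algebra_simps)

text \<open>Normal forms of pole order at most \<open>2M\<close> at infinity, with leading coefficient \<open>c\<close>.\<close>

definition pole_bounded :: "nat \<Rightarrow> 'a \<Rightarrow> 'l \<Rightarrow> bool" where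
  "pole_bounded M c s \<longleftrightarrow> (\<exists>A B. s = ev A + ev B * y \<and> degree A \<le> M \<and>
     (B = 0 \<or> degree B + g + 1 \<le> M) \<and> coeff A M = c)"

lemma pole_bounded_add:
  assumes "pole_bounded M c s" "pole_bounded M c' s'"
  shows "pole_bounded M (c + c') (s + s')"
proof -
  obtain A B where 1: "s = ev A + ev B * y" "degree A \<le> M" "B = 0 \<or> degree B + g + 1 \<le> M" "coeff A M = c"
    using assms unfolding pole_bounded_def by blast
  obtain A' B' where 2: "s' = ev A' + ev B' * y" "degree A' \<le> M" "B' = 0 \<or> degree B' + g + 1 \<le> M" "coeff A' M = c'"
    using assms unfolding pole_bounded_def by blast
  have "degree (B + B') \<le> max (degree B) (degree B')" by (rule degree_add_le_max)
  then have "B + B' = 0 \<or> degree (B + B') + g + 1 \<le> M" using 1(3) 2(3) by auto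
  then show ?thesis
    using 1 2 unfolding pole_bounded_def
    by (intro exI[of _ "A + A'"] exI[of _ "B + B'"]) (auto simp: ev_simps algebra_simps degree_add_le)
qed

lemma pole_bounded_mult:
  assumes "pole_bounded M c s" "pole_bounded M' c' s'"
  shows "pole_bounded (M + M') (c * c') (s * s')"
proof -
  obtain A B where 1: "s = ev A + ev B * y" "degree A \<le> M" "B = 0 \<or> degree B + g + 1 \<le> M" "coeff A M = c"
    using assms unfolding pole_bounded_def by blast
  obtain A' B' where 2: "s' = ev A' + ev B' * y" "degree A' \<le> M'" "B' = 0 \<or> degree B' + g + 1 \<le> M'" "coeff A' M' = c'"
    using assms unfolding pole_bounded_def by blast
  have eq: "s * s' = ev (A * A' + f * (B * B')) + ev (A * B' + B * A') * y"
    by (simp add: 1 2 ev_simps y_square[symmetric] algebra_simps)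
  have dA: "degree (A * A') \<le> M + M'" using degree_mult_le[of A A'] 1 2 by simp
  have dB: "f * (B * B') = 0 \<or> degree (f * (B * B')) < M + M'"
  proof (cases "B = 0 \<or> B' = 0")
    case False
    then have "degree B + g + 1 \<le> M" "degree B' + g + 1 \<le> M'" using 1(3) 2(3) by auto
    moreover have "degree (f * (B * B')) \<le> 2 * g + 1 + (degree B + degree B')"
      using degree_mult_le[of f "B * B'"] degree_mult_le[of B B'] degree_f by simp
    ultimately show ?thesis by simp
  qed auto
  have "degree (A * A' + f * (B * B')) \<le> M + M'" using dA dB by (auto intro: degree_add_le)
  moreover have "coeff (A * A' + f * (B * B')) (M + M') = c * c'"
  proof -
    have "coeff (A * A') (M + M') = c * c'"
    proof (cases "degree A = M \<and> degree A' = M'")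
      case True
      then show ?thesis using 1(4) 2(4) coeff_mult_degree_sum[of A A'] by simp
    next
      case False
      then have "degree (A * A') < M + M'" using degree_mult_le[of A A'] 1(2) 2(2) by linarith
      moreover have "c * c' = 0" using False 1(2,4) 2(2,4)
        by (metis coeff_eq_0 mult_eq_0_iff le_neq_implies_less)
      ultimately show ?thesis by (simp add: coeff_eq_0)
    qed
    moreover have "coeff (f * (B * B')) (M + M') = 0" using dB by (auto simp: coeff_eq_0)
    ultimately show ?thesis by simp
  qed
  moreover have "A * B' + B * A' = 0 \<or> degree (A * B' + B * A') + g + 1 \<le> M + M'"
  proof -
    have "A * B' = 0 \<or> degree (A * B') + g + 1 \<le> M + M'"
      using degree_mult_le[of A B'] 1(2) 2(3) by auto
    moreover have "B * A' = 0 \<or> degree (B * A') + g + 1 \<le> M + M'"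
      using degree_mult_le[of B A'] 2(2) 1(3) by auto
    moreover have "degree (A * B' + B * A') \<le> max (degree (A * B')) (degree (B * A'))"
      by (rule degree_add_le_max)
    ultimately show ?thesis by auto
  qed
  ultimately show ?thesis unfolding pole_bounded_def using eq by blast
qed

lemma pole_bounded_x_power: "pole_bounded n 1 (x ^ n)"
  unfolding pole_bounded_def
  by (rule exI[of _ "monom 1 n"], rule exI[of _ 0]) (simp add: ev_simps degree_monom_le poly_monom)

definition infinity_value :: "'a \<Rightarrow> 'l \<Rightarrow> bool" where
  "infinity_value c s \<longleftrightarrow> (\<exists>M. pole_bounded M c (s * x ^ M))"

lemma infinity_value_add:
  assumes "infinity_value c s" "infinity_value c' s'"
  shows "infinity_value (c + c') (s + s')"
proof -
  obtain M M' where M: "pole_bounded M c (s * x ^ M)" "pole_bounded M' c' (s' * x ^ M')"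
    using assms unfolding infinity_value_def by blast
  have "pole_bounded (M + M') (c * 1 + 1 * c') ((s * x ^ M) * x ^ M' + x ^ M * (s' * x ^ M'))"
    by (intro pole_bounded_add pole_bounded_mult M pole_bounded_x_power)
  then show ?thesis unfolding infinity_value_def
    by (intro exI[of _ "M + M'"]) (simp add: algebra_simps power_add)
qed

lemma infinity_value_mult:
  assumes "infinity_value c s" "infinity_value c' s'"
  shows "infinity_value (c * c') (s * s')"
proof -
  obtain M M' where M: "pole_bounded M c (s * x ^ M)" "pole_bounded M' c' (s' * x ^ M')"
    using assms unfolding infinity_value_def by blast
  have "pole_bounded (M + M') (c * c') ((s * x ^ M) * (s' * x ^ M'))"
    by (intro pole_bounded_mult M)
  then show ?thesis unfolding infinity_value_def
    by (intro exI[of _ "M + M'"]) (simp add: algebra_simps power_add)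
qed

lemma x_nonzero: "x \<noteq> 0"
  using x_transcendental[of "[:0, 1:]"] by (auto simp: map_poly_pCons)

lemma infinity_value_const: "infinity_value c (\<iota> c)"
  unfolding infinity_value_def pole_bounded_def
  by (intro exI[of _ 0] exI[of _ "[:c:]"]) (simp add: ev_simps)

lemma infinity_value_u: "infinity_value 0 (1 / x)"
  unfolding infinity_value_def pole_bounded_def
  by (rule exI[of _ 1], rule exI[of _ 1], rule exI[of _ 0]) (simp add: ev_simps x_nonzero)

lemma infinity_value_v: "infinity_value 0 (y / x ^ (g + 1))"
  unfolding infinity_value_def pole_bounded_def
  by (rule exI[of _ "g + 1"], rule exI[of _ 0], rule exI[of _ 1]) (simp add: ev_simps x_nonzero)

lemma infinity_value_eval2:
  "infinity_value (eval2 id 0 0 P) (eval2 \<iota> (1 / x) (y / x ^ (g + 1)) P)"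
proof -
  have 1: "infinity_value (poly q 0) (poly (map_poly \<iota> q) (1 / x))" for q
  proof (induction q)
    case 0
    then show ?case using infinity_value_const[of 0] by simp
  next
    case (pCons c q)
    have "infinity_value (c + 0 * poly q 0) (\<iota> c + (1 / x) * poly (map_poly \<iota> q) (1 / x))"
      by (intro infinity_value_add infinity_value_mult infinity_value_const infinity_value_u pCons.IH)
    then show ?case by (simp add: hom_distribs)
  qed
  show ?thesis
  proof (induction P)
    case 0
    then show ?case using infinity_value_const[of 0] by (simp add: eval2_def)
  next
    case (pCons c P)
    have "infinity_value (poly c 0 + 0 * eval2 id 0 0 P)
      (poly (map_poly \<iota> c) (1 / x) + (y / x ^ (g + 1)) * eval2 \<iota> (1 / x) (y / x ^ (g + 1)) P)"
      by (intro infinity_value_add infinity_value_mult 1 infinity_value_v pCons.IH)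
    then show ?case by (simp add: eval2_pCons)
  qed
qed

lemma sections_infinity_normal_form:
  assumes s: "s \<in> sections_infinity l" and l: "l \<le> g"
  obtains A where "s = ev A" "degree A \<le> l"
proof -
  obtain A B where AB: "s = ev A + ev B * y"
    using s coordinate_ring_normal_form unfolding sections_infinity_def by blast
  obtain P Q where PQ: "s * (1 / x) ^ l
      = eval2 \<iota> (1 / x) (y / x ^ (g + 1)) P / eval2 \<iota> (1 / x) (y / x ^ (g + 1)) Q"
    and Q0: "eval2 id 0 0 Q \<noteq> 0"
    using s unfolding sections_infinity_def local_ring_infinity_def local_ring_def by auto
  define p q where "p = eval2 \<iota> (1 / x) (y / x ^ (g + 1)) P"
    and "q = eval2 \<iota> (1 / x) (y / x ^ (g + 1)) Q"
  define c d where "c = eval2 id 0 0 P" and "d = eval2 id 0 0 Q"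
  obtain M where "pole_bounded M c (p * x ^ M)"
    using infinity_value_eval2[of P] unfolding infinity_value_def p_def c_def by blast
  obtain N where "pole_bounded N d (q * x ^ N)"
    using infinity_value_eval2[of Q] unfolding infinity_value_def q_def d_def by blast
  have "pole_bounded (M + N) (d * 1) ((q * x ^ N) * x ^ M)"
    using \<open>pole_bounded N d _\<close> pole_bounded_x_power pole_bounded_mult by (metis add.commute)
  then obtain C E where CE: "q * x ^ (M + N) = ev C + ev E * y" "degree C \<le> M + N"
    "E = 0 \<or> degree E + g + 1 \<le> M + N" "coeff C (M + N) = d"
    unfolding pole_bounded_def by (auto simp: power_add mult_ac)
  have "pole_bounded (M + (N + l)) (c * 1) ((p * x ^ M) * x ^ (N + l))"
    by (intro pole_bounded_mult pole_bounded_x_power) fact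
  then obtain A' B' where AB': "p * x ^ (M + N + l) = ev A' + ev B' * y" "degree A' \<le> M + N + l"
    "B' = 0 \<or> degree B' + g + 1 \<le> M + N + l"
    unfolding pole_bounded_def by (auto simp: power_add mult_ac add_ac)
  have C0: "C \<noteq> 0" and dC: "degree C = M + N"
    using CE(2,4) Q0 le_degree[of C "M + N"] unfolding d_def by auto
  have "q \<noteq> 0"
  proof
    assume "q = 0"
    then have "C = 0" using CE(1) normal_form_zero[of C E] by simp
    then show False using C0 by simp
  qed
  then have "s * q = p * x ^ l"
    using PQ x_nonzero unfolding p_def[symmetric] q_def[symmetric] by (simp add: field_simps)
  then have "(ev A + ev B * y) * (ev C + ev E * y) = ev A' + ev B' * y"
    unfolding AB[symmetric] CE(1)[symmetric] AB'(1)[symmetric] by (simp add: power_add algebra_simps)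
  then have "ev (A * C + f * (B * E)) + ev (A * E + B * C) * y = ev A' + ev B' * y"
    by (simp add: ev_simps y_square[symmetric] algebra_simps)
  then have A': "A' = A * C + f * (B * E)" and B': "B' = A * E + B * C"
    using normal_form_unique by metis+
  define n where "n A B = A * A - f * (B * B)" for A B
  have n_mult: "n A B * n C E = n A' B'" unfolding n_def A' B' by (simp add: algebra_simps)
  have n_degree: "degree (n U V) \<le> 2 * m" if "degree U \<le> m" "V = 0 \<or> degree V + g + 1 \<le> m" for U V m
  proof -
    have "degree (U * U) \<le> 2 * m" using degree_mult_le[of U U] that(1) by simp
    moreover have "degree (f * (V * V)) \<le> 2 * m"
      using degree_mult_le[of f "V * V"] degree_mult_le[of V V] degree_f that(2) by auto
    ultimately show ?thesis unfolding n_def by (rule degree_diff_le)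
  qed
  have nCE: "degree (n C E) = 2 * (M + N)" "n C E \<noteq> 0"
  proof -
    have CC: "degree (C * C) = 2 * (M + N)" using C0 dC by (simp add: degree_mult_eq)
    have "degree (n C E) = 2 * (M + N) \<and> n C E \<noteq> 0"
    proof (cases "E = 0")
      case True
      then show ?thesis using CC C0 unfolding n_def by simp
    next
      case False
      then have "degree (f * (E * E)) < degree (C * C)"
        using degree_mult_le[of f "E * E"] degree_mult_le[of E E] degree_f CE(3) unfolding CC by auto
      then have "degree (C * C + - (f * (E * E))) = degree (C * C)"
        by (intro degree_add_eq_left) simp
      then show ?thesis using degree_norm(1)[OF False, of C] unfolding n_def CC[symmetric] by simp
    qed
    then show "degree (n C E) = 2 * (M + N)" "n C E \<noteq> 0" by auto
  qed
  have nA'B': "degree (n A' B') \<le> 2 * (M + N + l)" by (rule n_degree[OF AB'(2,3)])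
  have nAB: "degree (n A B) \<le> 2 * l"
  proof (cases "n A B = 0")
    case False
    then have "degree (n A B) + 2 * (M + N) = degree (n A' B')"
      using nCE by (simp flip: n_mult add: degree_mult_eq)
    then show ?thesis using nA'B' by simp
  qed simp
  have "B = 0"
  proof (rule ccontr)
    assume "B \<noteq> 0"
    then have "2 * g + 1 \<le> 2 * l" using degree_norm(2)[of B A] nAB unfolding n_def by simp
    then show False using l by simp
  qed
  then have "degree A \<le> l" using nAB unfolding n_def by (cases "A = 0") (simp_all add: degree_mult_eq)
  then show ?thesis using that AB \<open>B = 0\<close> by simp
qed

lemma basis_sections_infinity:
  assumes l: "l \<le> g"
  shows "basis_mod \<iota> (sections_infinity l) {0} (map (\<lambda>j. x ^ j) [0..<Suc l])"
proof -
  have "x ^ j \<in> sections_infinity l" if "j \<le> l" for j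
  proof -
    have "x ^ j = eval2 \<iota> x y [:monom 1 j:]"
      by (simp add: eval2_def map_poly_pCons ev_simps poly_monom)
    moreover have "x ^ j * (1 / x) ^ l
        = eval2 \<iota> (1 / x) (y / x ^ (g + 1)) [:monom 1 (l - j):] / eval2 \<iota> (1 / x) (y / x ^ (g + 1)) [:1:]"
      using that x_nonzero
      by (simp add: eval2_def map_poly_pCons hom_distribs poly_monom power_diff power_one_over field_simps)
    moreover have "eval2 id 0 0 [:1:] \<noteq> (0::'a)" by (simp add: eval2_def map_poly_pCons)
    ultimately show ?thesis
      unfolding sections_infinity_def coordinate_ring_def local_ring_infinity_def local_ring_def
      by blast
  qed
  moreover have "\<exists>!c. c \<in> carrier_vec (Suc l) \<and> s = (\<Sum>i<Suc l. \<iota> (c $ i) * x ^ i)"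
    if s: "s \<in> sections_infinity l" for s
  proof -
    obtain A where A: "s = ev A" "degree A \<le> l" using s l by (rule sections_infinity_normal_form)
    have sum: "(\<Sum>i<Suc l. \<iota> (c i) * x ^ i) = ev (\<Sum>i<Suc l. monom (c i) i)" for c
      by (induction l) (simp_all add: ev_simps poly_monom)
    have "A = (\<Sum>i<Suc l. monom (coeff A i) i)"
      using A(2) by (metis poly_as_sum_of_monoms' lessThan_Suc_atMost)
    then have ex: "s = (\<Sum>i<Suc l. \<iota> (coeff A i) * x ^ i)" unfolding A(1) sum by simp
    show ?thesis
    proof (rule ex1I[of _ "vec (Suc l) (coeff A)"])
      show "vec (Suc l) (coeff A) \<in> carrier_vec (Suc l) \<and>
          s = (\<Sum>i<Suc l. \<iota> (vec (Suc l) (coeff A) $ i) * x ^ i)"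
        using ex by simp
    next
      fix c assume c: "c \<in> carrier_vec (Suc l) \<and> s = (\<Sum>i<Suc l. \<iota> (c $ i) * x ^ i)"
      then have "A = (\<Sum>i<Suc l. monom (c $ i) i)" unfolding sum A(1) ev_eq_iff by simp
      then have "coeff A i = c $ i" if "i < Suc l" for i
        using that by (simp add: coeff_sum)
      then show "c = vec (Suc l) (coeff A)" using c by (intro eq_vecI) auto
    qed
  qed
  ultimately show ?thesis
    unfolding basis_mod_def by (auto simp del: upt_Suc sum.lessThan_Suc)
qed

end

end

theory Submission
  imports Defs "HOL-Computational_Algebra.Formal_Power_Series"
begin

text \<open>For a coordinate \<open>t = ax + by\<close> the Hasse Wronskian of \<open>1, x, ..., x\<^sup>l\<close> is \<open>(dx/dt)\<^sup>N\<close> with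
  \<open>N = l (l + 1) / 2 = 2r + 1\<close> and \<open>dx/dt = 2y / (2ay + b f'(x))\<close>. At a ramification point \<open>y\<close> is a
  uniformizer, so \<open>A = F[t] / (m\<^sup>N)\<close> for the minimal polynomial \<open>m\<close> of \<open>\<theta> = t(p)\<close>, and \<open>\<eta>\<close> is, up to a
  unit, the coefficient of the highest power of \<open>t\<close> modulo \<open>m\<^sup>N\<close>. The ideal \<open>(m\<^bsup>r+1\<^esup>)\<close> is totally
  isotropic with orthogonal complement \<open>(m\<^sup>r)\<close>; this splits off \<open>r [k : F]\<close> hyperbolic planes and leaves
  a form on \<open>k = F[t] / (m)\<close>, so that no embedding of \<open>k\<close> into \<open>A\<close> is needed. Euler's formula, by which
  the highest coefficient modulo \<open>m\<close> is \<open>u \<mapsto> Tr (u / m'(\<theta>))\<close>, identifies that form with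
  \<open>Tr \<langle>f'(\<gamma>) / 2\<rangle>\<close>, all other factors being squares because \<open>N\<close> is odd.\<close>

section \<open>Classes in the Grothendieck--Witt group\<close>

text \<open>\<open>local_index\<close> is a definite description over all admissible data, so two
  things are owed: every admissible choice gives the stated class, and some choice exists. The class
  is therefore computed for arbitrary data, which settles independence of choices on the way.
  Existence requires Hasse derivatives in positive characteristic too, where iterates of
  \<open>D 1\<close> cannot be divided by factorials; they are obtained from a formal deformation of
  the point (x, y). At the point x is ramified, so an etale t must involve y, while y vanishes there
  and leaves \<theta> = a \<gamma>. Smoothness makes f'(\<gamma>) nonzero, and this yields both the
  units in the local ring and the separability of k over F. Origin of the constant: to first order
  m(t) is b m'(\<theta>) y, and dx/dt is 2 y / (b f'(\<gamma>)). If m^N U agrees with the Wronskian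
  in leading term, then U(\<theta>) (b m'(\<theta>))^N = (2 / (b f'(\<gamma>)))^N. The inverse of U
  thus has value (b^2 m'(\<theta>) f'(\<gamma>) / 2)^N; one factor m'(\<theta>) survives modulo
  squares and is the one that the trace absorbs.\<close>

lemma gw_class_cong:
  assumes "isometric A B"
  shows "gw_class A = gw_class B"
  unfolding gw_class_def by (simp add: Quotient3_rel_abs[OF Quotient3_isometry_class assms])

lemma to_completion_add: "to_completion (a + b) = to_completion a + to_completion b"
  by transfer (simp add: completion_rel_def)

lemma gw_class_orth_sum:
  assumes "nondeg_sym A" "nondeg_sym B"
  shows "gw_class (orth_sum A B) = gw_class A + gw_class B"
  using plus_isometry_class.abs_eq[OF isometric_refl isometric_refl, OF assms]
  unfolding gw_class_def by (simp add: to_completion_add[symmetric])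

lemma gw_class_empty: "gw_class (0\<^sub>m 0 0) = 0"
  unfolding gw_class_def zero_isometry_class.abs_eq[symmetric] by transfer (simp add: completion_rel_def)

lemma invertible_matI:
  fixes A B :: "'a::field mat"
  assumes "A \<in> carrier_mat n n" "B \<in> carrier_mat n n" "A * B = 1\<^sub>m n"
  shows "invertible_mat A"
  using assms mat_mult_left_right_inverse invertible_mat_iff by blast

lemma nondeg_symI:
  assumes "A \<in> carrier_mat n n" "A\<^sup>T = A" "invertible_mat A"
  shows "nondeg_sym A"
  using assms unfolding nondeg_sym_def by auto

lemma nondeg_sym_smult_one:
  fixes a :: "'a::field"
  assumes "a \<noteq> 0"
  shows "nondeg_sym (a \<cdot>\<^sub>m 1\<^sub>m w)"
proof (rule nondeg_symI)
  have "(a \<cdot>\<^sub>m 1\<^sub>m w) * (inverse a \<cdot>\<^sub>m 1\<^sub>m w) = (1\<^sub>m w :: 'a mat)"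
    using assms by (intro eq_matI) (auto simp: mult_smult_assoc_mat[of _ w w _ w])
  then show "invertible_mat (a \<cdot>\<^sub>m 1\<^sub>m w :: 'a mat)" by (rule invertible_matI[rotated 2]) auto
  show "transpose_mat (a \<cdot>\<^sub>m 1\<^sub>m w) = (a \<cdot>\<^sub>m 1\<^sub>m w :: 'a mat)" by (intro eq_matI) auto
qed auto

lemma gw_class_smult_one:
  fixes a :: "'a::field"
  assumes "a \<noteq> 0"
  shows "gw_class (a \<cdot>\<^sub>m 1\<^sub>m w) = (\<Sum>_<w. gw_unit a)"
proof (induction w)
  case 0
  have "a \<cdot>\<^sub>m 1\<^sub>m 0 = (0\<^sub>m 0 0 :: 'a mat)" by (intro eq_matI) auto
  then show ?case by (simp add: gw_class_empty)
next
  case (Suc w)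
  have 1: "mat 1 1 (\<lambda>_. a) = a \<cdot>\<^sub>m 1\<^sub>m 1" by (intro eq_matI) auto
  have gw: "gw_unit a = gw_class (a \<cdot>\<^sub>m 1\<^sub>m 1)" unfolding gw_unit_def 1 ..
  have "a \<cdot>\<^sub>m 1\<^sub>m (Suc w) = orth_sum (a \<cdot>\<^sub>m 1\<^sub>m w) (a \<cdot>\<^sub>m 1\<^sub>m 1)"
    unfolding orth_sum_def by (intro eq_matI) (auto simp: less_Suc_eq)
  then show ?case
    using Suc gw_class_orth_sum[OF nondeg_sym_smult_one nondeg_sym_smult_one, OF assms assms, of w 1]
    by (simp add: gw)
qed

section \<open>Hyperbolic forms, Lagrangians and isotropic reduction\<close>

abbreviation hyp :: "nat \<Rightarrow> 'a::field GW" where "hyp w \<equiv> (\<Sum>_<w. gw_hyperbolic)"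

lemma transpose_smult_mat: "transpose_mat (a \<cdot>\<^sub>m A) = a \<cdot>\<^sub>m A\<^sup>T"
  by (intro eq_matI) auto

text \<open>In a plane with hyperbolic basis e, f the vectors e + f/2 and e - f/2 are orthogonal
  with squares 1 and -1. \<open>P\<close> makes this change in all planes at once and so links the
  split form to the diagonal form that defines \<open>gw_hyperbolic\<close>.\<close>

lemma gw_class_hyperbolic:
  assumes two: "(2::'a::field) \<noteq> 0"
  shows "gw_class (four_block_mat (0\<^sub>m w w) (1\<^sub>m w) (1\<^sub>m w) (0\<^sub>m w w) :: 'a mat) = hyp w"
    and "nondeg_sym (four_block_mat (0\<^sub>m w w) (1\<^sub>m w) (1\<^sub>m w) (0\<^sub>m w w) :: 'a mat)"
proof -
  define h :: 'a where "h = inverse 2"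
  have h: "h + h = 1" "h * 2 = 1" using two unfolding h_def by (simp_all add: mult_2[symmetric])
  let ?H = "four_block_mat (0\<^sub>m w w) (1\<^sub>m w) (1\<^sub>m w) (0\<^sub>m w w) :: 'a mat"
  have "?H * ?H = 1\<^sub>m (w + w)"
    by (subst mult_four_block_mat[of _ w w _ w _ w]) auto
  then have "invertible_mat ?H" by (rule invertible_matI[rotated 2]) auto
  moreover have "transpose_mat ?H = ?H"
    by (subst transpose_four_block_mat[of _ w w _ w _ w]) auto
  ultimately show nH: "nondeg_sym ?H" by (intro nondeg_symI[of _ "w + w"]) auto
  let ?s = "\<lambda>a. a \<cdot>\<^sub>m (1\<^sub>m w :: 'a mat)"
  define P where "P = four_block_mat (1\<^sub>m w) (1\<^sub>m w) (?s h) (?s (- h))"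
  define Q where "Q = four_block_mat (?s h) (1\<^sub>m w) (?s h) (?s (- 1))"
  have sm: "(?s a) * A = a \<cdot>\<^sub>m A" "A * (?s a) = a \<cdot>\<^sub>m A"
    if "A \<in> carrier_mat w w" for a and A :: "'a mat"
    using that by (simp_all add: mult_smult_assoc_mat[of _ w w _ w] mult_smult_distrib[of _ w w _ w])
  have ad: "?s a + b \<cdot>\<^sub>m 1\<^sub>m w = (a + b) \<cdot>\<^sub>m (1\<^sub>m w :: 'a mat)"
    "1\<^sub>m w + b \<cdot>\<^sub>m 1\<^sub>m w = (1 + b) \<cdot>\<^sub>m (1\<^sub>m w :: 'a mat)"
    "?s a + 1\<^sub>m w = (a + 1) \<cdot>\<^sub>m (1\<^sub>m w :: 'a mat)"
    "a \<cdot>\<^sub>m (b \<cdot>\<^sub>m 1\<^sub>m w) = (a * b) \<cdot>\<^sub>m (1\<^sub>m w :: 'a mat)"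
    "0 \<cdot>\<^sub>m 1\<^sub>m w = (0\<^sub>m w w :: 'a mat)" "?s 1 = (1\<^sub>m w :: 'a mat)" for a b
    by (intro eq_matI; auto simp: distrib_right)+
  have "P * Q = 1\<^sub>m (w + w)"
    unfolding P_def Q_def
    by (subst mult_four_block_mat[of _ w w _ w _ w]) (auto simp: sm ad h)
  then have iP: "invertible_mat P" by (rule invertible_matI[rotated 2]) (auto simp: P_def Q_def)
  have tP: "P\<^sup>T = four_block_mat (1\<^sub>m w) (?s h) (1\<^sub>m w) (?s (- h))"
    unfolding P_def by (subst transpose_four_block_mat[of _ w w _ w _ w]) (auto simp: transpose_smult_mat)
  have "P\<^sup>T * ?H = four_block_mat (?s h) (1\<^sub>m w) (?s (- h)) (1\<^sub>m w)"
    unfolding tP by (subst mult_four_block_mat[of _ w w _ w _ w]) (auto simp: sm ad h)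
  then have "P\<^sup>T * ?H * P = orth_sum (?s 1) (?s (- 1))"
    unfolding P_def orth_sum_def
    by (simp, subst mult_four_block_mat[of _ w w _ w _ w]) (auto simp: sm ad h algebra_simps)
  then have "isometric ?H (orth_sum (?s 1) (?s (- 1)))"
    using nH iP by (intro isometricI[of _ "w + w" P]) (auto simp: P_def)
  then show "gw_class ?H = hyp w"
    by (simp only: gw_class_cong gw_class_orth_sum nondeg_sym_smult_one one_neq_zero neg_equal_0_iff_equal
       gw_class_smult_one gw_hyperbolic_def sum.distrib not_False_eq_True)
qed

text \<open>A Lagrangian splits off hyperbolic planes: \<open>2\<close> is invertible, so the quadratic form on a
  complement can be made to vanish.\<close>

lemma gw_class_metabolic:
  fixes S Z :: "'a::field mat"
  assumes two: "(2::'a) \<noteq> 0" and S: "S \<in> carrier_mat w w" and Z: "Z \<in> carrier_mat w w"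
    and M: "nondeg_sym (four_block_mat (0\<^sub>m w w) S S\<^sup>T Z)"
  shows "gw_class (four_block_mat (0\<^sub>m w w) S S\<^sup>T Z) = hyp w"
proof -
  let ?M = "four_block_mat (0\<^sub>m w w) S S\<^sup>T Z"
  define h :: 'a where "h = inverse 2"
  have h: "h + h = 1" using two unfolding h_def by (simp add: mult_2[symmetric])
  have cM: "?M \<in> carrier_mat (w + w) (w + w)" using S Z by auto
  have tM: "transpose_mat ?M = four_block_mat (0\<^sub>m w w) S S\<^sup>T Z\<^sup>T"
    using S Z by (subst transpose_four_block_mat[of _ w w _ w _ w]) auto
  have tZ: "Z\<^sup>T = Z"
  proof (rule eq_matI)
    fix i j assume "i < dim_row Z" "j < dim_col Z"
    then show "Z\<^sup>T $$ (i, j) = Z $$ (i, j)"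
      using arg_cong[OF tM[unfolded nondeg_sym_dest(3)[OF M]], of "\<lambda>A. A $$ (i + w, j + w)"] S Z by simp
  qed (use Z in auto)
  obtain N where N: "N \<in> carrier_mat (w + w) (w + w)" "?M * N = 1\<^sub>m (w + w)"
    using nondeg_sym_dest(4)[OF M] invertible_mat_iff[OF cM] by blast
  obtain a b c d where N4: "split_block N w w = (a, b, c, d)" by (cases "split_block N w w")
  note sb = split_block[OF N4, of w w]
  have abcd: "a \<in> carrier_mat w w" "b \<in> carrier_mat w w" "c \<in> carrier_mat w w" "d \<in> carrier_mat w w"
    "N = four_block_mat a b c d" using sb N(1) by auto
  have "?M * N = four_block_mat (S * c) (S * d) (S\<^sup>T * a + Z * c) (S\<^sup>T * b + Z * d)"
    unfolding abcd(5) using abcd S Z by (subst mult_four_block_mat[of _ w w _ w _ w]) auto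
  then have e: "four_block_mat (S * c) (S * d) (S\<^sup>T * a + Z * c) (S\<^sup>T * b + Z * d) = 1\<^sub>m (w + w)"
    using N(2) by simp
  \<comment> \<open>The upper left block of \<open>?M * N = 1\<close>: nondegeneracy of the whole
    form makes the pairing \<open>S\<close> between the Lagrangian and its complement perfect, with
    inverse \<open>c\<close>.\<close>
  have Sc: "S * c = 1\<^sub>m w"
  proof (rule eq_matI)
    fix i j assume "i < dim_row (1\<^sub>m w :: 'a mat)" "j < dim_col (1\<^sub>m w :: 'a mat)"
    then show "(S * c) $$ (i, j) = 1\<^sub>m w $$ (i, j)"
      using arg_cong[OF e, of "\<lambda>A. A $$ (i, j)"] S abcd by simp
  qed (use S abcd in auto)
  then have cS: "c * S = 1\<^sub>m w" using mat_mult_left_right_inverse S abcd(3) by blast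
  define V where "V = transpose_mat c * Z * c"
  have V: "V \<in> carrier_mat w w" "V\<^sup>T = V"
  proof -
    show "V \<in> carrier_mat w w" using abcd Z unfolding V_def by auto
    show "V\<^sup>T = V" unfolding V_def using abcd(3) Z tZ
      by (simp add: transpose_mult[of _ w w _ w] assoc_mult_mat[of _ w w _ w _ w])
  qed
  \<comment> \<open>\<open>c\<close> turns the pairing into the identity and the form on the
    complement into \<open>V\<close>; moving the complement by - V/2 along the Lagrangian cancels
    \<open>V\<close>, since the correction enters twice.\<close>
  define P where "P = four_block_mat (1\<^sub>m w) ((- h) \<cdot>\<^sub>m V) (0\<^sub>m w w) c"
  define Q where "Q = four_block_mat (1\<^sub>m w) (h \<cdot>\<^sub>m (V * S)) (0\<^sub>m w w) S"
  have cP: "P \<in> carrier_mat (w + w) (w + w)" and cQ: "Q \<in> carrier_mat (w + w) (w + w)"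
    unfolding P_def Q_def using V S abcd by auto
  have hV: "h \<cdot>\<^sub>m A + (- h) \<cdot>\<^sub>m A = 0\<^sub>m w w" "((- h) \<cdot>\<^sub>m A + (- h) \<cdot>\<^sub>m A) + A = 0\<^sub>m w w"
    if "A \<in> carrier_mat w w" for A :: "'a mat"
  proof -
    show "h \<cdot>\<^sub>m A + (- h) \<cdot>\<^sub>m A = 0\<^sub>m w w" using that by (intro eq_matI) auto
    have "- (h * x) - h * x + x = 0" for x
      using arg_cong[OF h, of "\<lambda>u. u * x"] by (simp add: algebra_simps)
    then show "((- h) \<cdot>\<^sub>m A + (- h) \<cdot>\<^sub>m A) + A = 0\<^sub>m w w" using that by (intro eq_matI) auto
  qed
  have "P * Q = 1\<^sub>m (w + w)"
    unfolding P_def Q_def using V S abcd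
    by (subst mult_four_block_mat[of _ w w _ w _ w])
      (auto simp: mult_smult_assoc_mat[of _ w w _ w] cS hV)
  then have iP: "invertible_mat P" by (rule invertible_matI[OF cP cQ])
  have tP: "P\<^sup>T = four_block_mat (1\<^sub>m w) (0\<^sub>m w w) ((- h) \<cdot>\<^sub>m V) (transpose_mat c)"
    unfolding P_def using V abcd
    by (subst transpose_four_block_mat[of _ w w _ w _ w]) (auto simp: transpose_smult_mat)
  have cSt: "transpose_mat c * S\<^sup>T = 1\<^sub>m w"
    using arg_cong[OF Sc, of transpose_mat] S abcd by (simp add: transpose_mult[of _ w w _ w])
  have "?M * P = four_block_mat (0\<^sub>m w w) (1\<^sub>m w) S\<^sup>T (S\<^sup>T * ((- h) \<cdot>\<^sub>m V) + Z * c)"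
    unfolding P_def using V S Z abcd
    by (subst mult_four_block_mat[of _ w w _ w _ w]) (auto simp: Sc)
  moreover have "P\<^sup>T * four_block_mat (0\<^sub>m w w) (1\<^sub>m w) S\<^sup>T (S\<^sup>T * ((- h) \<cdot>\<^sub>m V) + Z * c)
      = four_block_mat (0\<^sub>m w w) (1\<^sub>m w) (1\<^sub>m w) (0\<^sub>m w w)"
  proof -
    have "transpose_mat c * (S\<^sup>T * ((- h) \<cdot>\<^sub>m V)) = (- h) \<cdot>\<^sub>m V"
      using V S abcd by (intro mat_cancel_left[OF cSt]) auto
    moreover have "transpose_mat c * (Z * c) = V"
      unfolding V_def using Z abcd by (simp add: assoc_mult_mat[of _ w w _ w _ w])
    ultimately have "transpose_mat c * (S\<^sup>T * ((- h) \<cdot>\<^sub>m V) + Z * c) = (- h) \<cdot>\<^sub>m V + V"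
      using S Z V abcd by (subst mult_add_distrib_mat[of _ w w _ w]) auto
    moreover have "(- h) \<cdot>\<^sub>m V + ((- h) \<cdot>\<^sub>m V + V) = 0\<^sub>m w w"
      using hV(2)[OF V(1)] V by (subst assoc_add_mat[symmetric, of _ w w]) auto
    ultimately show ?thesis
      unfolding tP using V S Z abcd
      by (subst mult_four_block_mat[of _ w w _ w _ w]) (auto simp: cSt)
  qed
  moreover have "P\<^sup>T * ?M * P = P\<^sup>T * (?M * P)"
    using cP cM by (intro assoc_mult_mat[of _ "w + w" "w + w" _ "w + w" _ "w + w"]) auto
  ultimately have "isometric ?M (four_block_mat (0\<^sub>m w w) (1\<^sub>m w) (1\<^sub>m w) (0\<^sub>m w w))"
    using M cM cP iP by (intro isometricI[of _ "w + w" P]) auto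
  then show ?thesis using gw_class_hyperbolic(1)[OF two] gw_class_cong by metis
qed

text \<open>The first \<open>e + w\<close> basis vectors span the orthogonal complement of the totally isotropic span
  of the vectors with indices in \<open>{e..<e + w}\<close>, so \<open>C\<close> is the form induced on the quotient.\<close>

lemma gw_class_isotropic_reduction:
  fixes M C :: "'a::field mat"
  assumes two: "(2::'a) \<noteq> 0" and M: "nondeg_sym M" "M \<in> carrier_mat (e + (w + w)) (e + (w + w))"
    and zero: "\<And>i j. i < e + w \<Longrightarrow> e \<le> j \<Longrightarrow> j < e + w \<Longrightarrow> M $$ (i, j) = 0"
    and C: "nondeg_sym C" "C \<in> carrier_mat e e" "\<And>i j. i < e \<Longrightarrow> j < e \<Longrightarrow> M $$ (i, j) = C $$ (i, j)"
  shows "gw_class M = gw_class C + hyp w"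
proof -
  define v where "v = w + w"
  define K where "K = mat e v (\<lambda>(i, j). M $$ (i, e + j))"
  define H where "H = mat v v (\<lambda>(i, j). M $$ (e + i, e + j))"
  have tM: "M $$ (i, j) = M $$ (j, i)" if "i < e + v" "j < e + v" for i j
    using arg_cong[OF nondeg_sym_dest(3)[OF M(1)], of "\<lambda>A. A $$ (i, j)"] that M(2) by (simp add: v_def)
  have cK: "K \<in> carrier_mat e v" and cH: "H \<in> carrier_mat v v" by (auto simp: K_def H_def)
  have M4: "M = four_block_mat C K K\<^sup>T H"
  proof (rule eq_matI)
    fix i j assume "i < dim_row (four_block_mat C K K\<^sup>T H)"
      "j < dim_col (four_block_mat C K K\<^sup>T H)"
    then have ij: "i < e + v" "j < e + v" using C(2) cK cH by auto
    show "M $$ (i, j) = four_block_mat C K K\<^sup>T H $$ (i, j)"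
      using ij C cK cH tM by (auto simp: K_def H_def)
  qed (use M C cH in \<open>auto simp: v_def\<close>)
  obtain D where D: "D \<in> carrier_mat e e" "C * D = 1\<^sub>m e" "D * C = 1\<^sub>m e"
    using nondeg_sym_dest(4)[OF C(1)] invertible_mat_iff[OF C(2)] by blast
  have tC: "C\<^sup>T = C" using nondeg_sym_dest(3)[OF C(1)] .
  have tD: "D\<^sup>T = D"
  proof -
    have "D\<^sup>T * C = 1\<^sub>m e"
      using arg_cong[OF D(2), of transpose_mat] D(1) C(2) by (simp add: transpose_mult[of _ e e _ e] tC)
    then have "D\<^sup>T * (C * D) = D"
      using D(1) C(2) by (subst assoc_mult_mat[symmetric, of _ e e _ e _ e]) auto
    then show ?thesis using D(1,2) by simp
  qed
  \<comment> \<open>Subtracting from each of the last \<open>v\<close> vectors its projection to the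
    span of the first \<open>e\<close>, possible as \<open>C\<close> is invertible, leaves the Schur
    complement \<open>H'\<close> as second summand.\<close>
  define P where "P = four_block_mat (1\<^sub>m e) (- (D * K)) (0\<^sub>m v e) (1\<^sub>m v)"
  define Q where "Q = four_block_mat (1\<^sub>m e) (D * K) (0\<^sub>m v e) (1\<^sub>m v)"
  define H' where "H' = H - K\<^sup>T * D * K"
  have cH': "H' \<in> carrier_mat v v" unfolding H'_def using cK cH by (intro minus_carrier_mat) auto
  have cP: "P \<in> carrier_mat (e + v) (e + v)" and cQ: "Q \<in> carrier_mat (e + v) (e + v)"
    unfolding P_def Q_def using D cK by auto
  have DK: "D * K + - (D * K) = 0\<^sub>m e v" "- (D * K) + D * K = 0\<^sub>m e v" "K + - K = 0\<^sub>m e v" "- K + K = 0\<^sub>m e v"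
    using D cK by (auto intro!: eq_matI)
  have "P * Q = 1\<^sub>m (e + v)"
    unfolding P_def Q_def using D cK
    by (subst mult_four_block_mat[of _ e e _ v _ v]) (auto simp: DK)
  then have iP: "invertible_mat P" by (rule invertible_matI[OF cP cQ])
  have tP: "P\<^sup>T = four_block_mat (1\<^sub>m e) (0\<^sub>m e v) (- (K\<^sup>T * D)) (1\<^sub>m v)"
    unfolding P_def using D cK
    by (subst transpose_four_block_mat[of _ e e _ v _ v])
      (auto simp: transpose_uminus transpose_mult[of _ e e _ v] tD)
  have CDK: "C * (D * K) = K" using D cK C(2) by (intro mat_cancel_left[OF D(2)]) auto
  have KDC: "K\<^sup>T * D * C = K\<^sup>T"
    using D cK C(2) by (simp add: assoc_mult_mat[of _ v e _ e _ e])
  have "M * P = four_block_mat C (0\<^sub>m e v) K\<^sup>T H'"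
    unfolding M4 P_def H'_def using D cK cH C(2)
    by (subst mult_four_block_mat[of _ e e _ v _ v])
      (auto simp: CDK DK minus_add_uminus_mat[of H v v] comm_add_mat[of H v v] assoc_mult_mat[of _ v e _ e _ v])
  moreover have "P\<^sup>T * four_block_mat C (0\<^sub>m e v) K\<^sup>T H' = orth_sum C H'"
    unfolding tP orth_sum_def using D cK cH' C(2)
    by (subst mult_four_block_mat[of _ e e _ v _ v])
      (auto simp: KDC uminus_l_inv_mat[of _ v e])
  moreover have "P\<^sup>T * M * P = P\<^sup>T * (M * P)"
    using cP M(2) by (intro assoc_mult_mat[of _ "e + v" "e + v" _ "e + v" _ "e + v"]) (auto simp: v_def)
  ultimately have iso: "isometric M (orth_sum C H')"
    using M cP iP by (intro isometricI[of _ "e + v" P]) (auto simp: v_def)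
  define S where "S = mat w w (\<lambda>(i, j). H' $$ (i, w + j))"
  define Z where "Z = mat w w (\<lambda>(i, j). H' $$ (w + i, w + j))"
  have tH: "H\<^sup>T = H" unfolding H_def by (intro eq_matI) (auto simp: tM)
  have tH': "H'\<^sup>T = H'"
  proof -
    have "transpose_mat (K\<^sup>T * D * K) = K\<^sup>T * D * K"
      using cK D(1) tD by (simp add: transpose_mult[of _ v e _ v] transpose_mult[of _ v e _ e]
        transpose_mult[of _ e e _ v] assoc_mult_mat[of _ v e _ e _ v])
    then show ?thesis unfolding H'_def using tH cK cH
      by (subst transpose_minus[of _ v v]) auto
  qed
  \<comment> \<open>The isotropic vectors are orthogonal to the first \<open>e\<close> ones, so
    their columns of \<open>K\<close> vanish and the Schur complement leaves their mutual products
    zero: they span a Lagrangian of \<open>H'\<close>.\<close>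
  have H'0: "H' $$ (i, j) = 0" if "i < w" "j < w" for i j
  proof -
    have "col K k = 0\<^sub>v e" if "k < w" for k
      using that zero[of _ "e + k"] by (intro eq_vecI) (auto simp: K_def v_def)
    moreover have "D *\<^sub>v 0\<^sub>v e = 0\<^sub>v e" using D(1) by (intro eq_vecI) auto
    ultimately have "(K\<^sup>T * D * K) $$ (i, j) = 0"
      using that cK D(1) by (simp add: v_def)
    moreover have "H $$ (i, j) = 0" using that zero[of "e + i" "e + j"] by (simp add: H_def v_def)
    ultimately show ?thesis using that cK cH by (simp add: H'_def v_def)
  qed
  have H'4: "H' = four_block_mat (0\<^sub>m w w) S S\<^sup>T Z"
  proof (rule eq_matI)
    fix i j assume "i < dim_row (four_block_mat (0\<^sub>m w w) S S\<^sup>T Z)"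
      "j < dim_col (four_block_mat (0\<^sub>m w w) S S\<^sup>T Z)"
    then have ij: "i < v" "j < v" by (auto simp: Z_def v_def)
    then have "H' $$ (i, j) = H' $$ (j, i)"
      using arg_cong[OF tH', of "\<lambda>A. A $$ (i, j)"] cH' by simp
    then show "H' $$ (i, j) = four_block_mat (0\<^sub>m w w) S S\<^sup>T Z $$ (i, j)"
      using ij by (auto simp: S_def Z_def v_def H'0)
  qed (use cH' in \<open>auto simp: v_def Z_def\<close>)
  have iH': "invertible_mat H'"
  proof -
    obtain N where N: "N \<in> carrier_mat (e + v) (e + v)" "orth_sum C H' * N = 1\<^sub>m (e + v)"
      using iso nondeg_sym_dest(4)[of "orth_sum C H'"] invertible_mat_iff[OF orth_sum_carrier[OF C(2) cH']]
      unfolding isometric_def by blast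
    obtain a b c d where N4: "split_block N e e = (a, b, c, d)" by (cases "split_block N e e")
    have abcd: "a \<in> carrier_mat e e" "b \<in> carrier_mat e v" "c \<in> carrier_mat v e" "d \<in> carrier_mat v v"
      "N = four_block_mat a b c d" using split_block[OF N4, of v v] N(1) by auto
    have "orth_sum C H' * N = four_block_mat (C * a) (C * b) (H' * c) (H' * d)"
      unfolding abcd(5) orth_sum_def using abcd C(2) cH' by (subst mult_four_block_mat[of _ e e _ v _ v]) auto
    then have eq: "four_block_mat (C * a) (C * b) (H' * c) (H' * d) = 1\<^sub>m (e + v)" using N(2) by simp
    have "H' * d = 1\<^sub>m v"
    proof (rule eq_matI)
      fix i j assume "i < dim_row (1\<^sub>m v :: 'a mat)" "j < dim_col (1\<^sub>m v :: 'a mat)"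
      then show "(H' * d) $$ (i, j) = 1\<^sub>m v $$ (i, j)"
        using arg_cong[OF eq, of "\<lambda>A. A $$ (e + i, e + j)"] C(2) abcd cH' by simp
    qed (use cH' abcd in auto)
    then show ?thesis using invertible_matI cH' abcd(4) by blast
  qed
  have nH': "nondeg_sym H'" using iH' tH' cH' nondeg_symI by blast
  then have "gw_class H' = hyp w"
    unfolding H'4 by (intro gw_class_metabolic[OF two]) (auto simp: S_def Z_def)
  then show ?thesis using gw_class_cong[OF iso] gw_class_orth_sum[OF C(1) nH'] by simp
qed

section \<open>Forms on subquotients\<close>

text \<open>Covers two cases at once: the algebra R / I, handled through representatives in the
  field L, and the residue field as UNIV / {0}. Representatives avoid a quotient type that would
  depend on the point.\<close>

locale subquotient = field_hom \<iota>
  for \<iota> :: "'a::field \<Rightarrow> 'l::field" and V W :: "'l set" +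
  assumes V_add: "u \<in> V \<Longrightarrow> v \<in> V \<Longrightarrow> u + v \<in> V"
    and V_scale: "v \<in> V \<Longrightarrow> \<iota> c * v \<in> V"
    and W_sub: "W \<subseteq> V" and W_zero: "0 \<in> W"
    and W_add: "u \<in> W \<Longrightarrow> v \<in> W \<Longrightarrow> u + v \<in> W"
    and W_scale: "v \<in> W \<Longrightarrow> \<iota> c * v \<in> W"
begin

lemma W_diff: "u \<in> W \<Longrightarrow> v \<in> W \<Longrightarrow> u - v \<in> W"
  using W_add[of u "\<iota> (-1) * v"] W_scale[of v "-1"] by (simp add: hom_distribs)

lemma V_comb: "finite S \<Longrightarrow> (\<And>i. i \<in> S \<Longrightarrow> b i \<in> V) \<Longrightarrow> (\<Sum>i\<in>S. \<iota> (c i) * b i) \<in> V"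
  by (induction S rule: finite_induct) (use W_zero W_sub in \<open>auto intro: V_add V_scale\<close>)

lemma W_comb: "finite S \<Longrightarrow> (\<And>i. i \<in> S \<Longrightarrow> b i \<in> W) \<Longrightarrow> (\<Sum>i\<in>S. \<iota> (c i) * b i) \<in> W"
  by (induction S rule: finite_induct) (use W_zero in \<open>auto intro: W_add W_scale\<close>)

abbreviation comb :: "'l list \<Rightarrow> (nat \<Rightarrow> 'a) \<Rightarrow> 'l" where
  "comb bs c \<equiv> (\<Sum>i<length bs. \<iota> (c i) * bs ! i)"

lemma basis_modI:
  assumes "\<And>i. i < length bs \<Longrightarrow> bs ! i \<in> V"
    and ex: "\<And>v. v \<in> V \<Longrightarrow> \<exists>c. v - comb bs c \<in> W"
    and indep: "\<And>c i. comb bs c \<in> W \<Longrightarrow> i < length bs \<Longrightarrow> c i = 0"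
  shows "basis_mod \<iota> V W bs"
  unfolding basis_mod_def
proof (intro conjI ballI)
  show "set bs \<subseteq> V" using assms(1) by (auto simp: in_set_conv_nth)
  fix v assume "v \<in> V"
  then obtain c where c: "v - comb bs c \<in> W" using ex by blast
  show "\<exists>!c. c \<in> carrier_vec (length bs) \<and> v - (\<Sum>i<length bs. \<iota> (c $ i) * bs ! i) \<in> W"
  proof (rule ex1I[of _ "vec (length bs) c"])
    show "vec (length bs) c \<in> carrier_vec (length bs) \<and>
        v - (\<Sum>i<length bs. \<iota> (vec (length bs) c $ i) * bs ! i) \<in> W"
      using c by simp
  next
    fix d assume d: "d \<in> carrier_vec (length bs) \<and> v - (\<Sum>i<length bs. \<iota> (d $ i) * bs ! i) \<in> W"
    then have "(v - comb bs c) - (v - (\<Sum>i<length bs. \<iota> (d $ i) * bs ! i)) \<in> W"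
      using c W_diff by blast
    then have "(\<Sum>i<length bs. \<iota> (d $ i - c i) * bs ! i) \<in> W"
      by (simp add: hom_distribs left_diff_distrib sum_subtractf)
    then have "d $ i - c i = 0" if "i < length bs" for i
      using that indep[of "\<lambda>i. d $ i - c i"] by blast
    then show "d = vec (length bs) c" using d by (intro eq_vecI) auto
  qed
qed

lemma basis_modE:
  assumes b: "basis_mod \<iota> V W bs"
  obtains co where "\<And>v. v \<in> V \<Longrightarrow> v - comb bs (co v) \<in> W"
    "\<And>c i. comb bs c \<in> W \<Longrightarrow> i < length bs \<Longrightarrow> c i = 0"
    "\<And>i. i < length bs \<Longrightarrow> bs ! i \<in> V"
proof -
  have 1: "\<exists>c. v - comb bs c \<in> W" if "v \<in> V" for v
    using b that unfolding basis_mod_def by (meson ex1_implies_ex)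
  have 2: "c i = 0" if s: "comb bs c \<in> W" and i: "i < length bs" for c i
  proof -
    define v where "v = comb bs c"
    have "v \<in> V" using s W_sub v_def by blast
    then have "\<exists>!d. d \<in> carrier_vec (length bs) \<and> v - (\<Sum>i<length bs. \<iota> (d $ i) * bs ! i) \<in> W"
      using b unfolding basis_mod_def by blast
    moreover have "vec (length bs) c \<in> carrier_vec (length bs) \<and>
        v - (\<Sum>i<length bs. \<iota> (vec (length bs) c $ i) * bs ! i) \<in> W"
      using W_zero by (simp add: v_def)
    moreover have "0\<^sub>v (length bs) \<in> carrier_vec (length bs) \<and>
        v - (\<Sum>i<length bs. \<iota> (0\<^sub>v (length bs) $ i) * bs ! i) \<in> W"
      using s by (simp add: v_def)
    ultimately have "vec (length bs) c = 0\<^sub>v (length bs)" by blast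
    then have "vec (length bs) c $ i = 0\<^sub>v (length bs) $ i" by simp
    then show ?thesis using i by simp
  qed
  have 3: "bs ! i \<in> V" if "i < length bs" for i using b that unfolding basis_mod_def by auto
  show ?thesis using that[of "\<lambda>v. SOME c. v - comb bs c \<in> W"] 2 3 someI_ex[OF 1] by blast
qed

end

text \<open>Padded with zeros to square matrices, a right inverse is a left inverse; for
  \<open>m < n\<close> the product in the other order would have a zero row.\<close>

lemma right_inverse_dim:
  fixes A B :: "'a::field mat"
  assumes A: "A \<in> carrier_mat n m" and B: "B \<in> carrier_mat m n" and AB: "A * B = 1\<^sub>m n"
  shows "n \<le> m"
proof (rule ccontr)
  assume "\<not> n \<le> m"
  then have mn: "m < n" by simp
  define A' where "A' = mat n n (\<lambda>(i, j). if j < m then A $$ (i, j) else 0)"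
  define B' where "B' = mat n n (\<lambda>(i, j). if i < m then B $$ (i, j) else 0)"
  have "A' * B' = 1\<^sub>m n"
  proof (rule eq_matI)
    fix i j assume "i < dim_row (1\<^sub>m n :: 'a mat)" "j < dim_col (1\<^sub>m n :: 'a mat)"
    then have ij: "i < n" "j < n" by auto
    have "(A' * B') $$ (i, j) = (\<Sum>k\<in>{0..<n}. (if k < m then A $$ (i, k) * B $$ (k, j) else 0))"
      using ij by (auto simp: A'_def B'_def scalar_prod_def intro!: sum.cong)
    also have "\<dots> = (\<Sum>k\<in>{0..<m}. A $$ (i, k) * B $$ (k, j))"
      using mn by (intro sum.mono_neutral_cong_right) auto
    also have "\<dots> = (A * B) $$ (i, j)" using ij A B by (simp add: scalar_prod_def)
    finally show "(A' * B') $$ (i, j) = 1\<^sub>m n $$ (i, j)" unfolding AB .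
  qed (auto simp: A'_def B'_def)
  then have BA: "B' * A' = 1\<^sub>m n"
    by (rule mat_mult_left_right_inverse[rotated 2]) (auto simp: A'_def B'_def)
  have "(B' * A') $$ (m, m) = 0"
    using mn by (simp add: A'_def B'_def scalar_prod_def)
  then show False unfolding BA using mn by simp
qed

section \<open>Bilinear forms on V / W and their Gram matrices\<close>

locale subquotient_form = subquotient \<iota> V W
  for \<iota> :: "'a::field \<Rightarrow> 'l::field" and V W :: "'l set" +
  fixes \<beta> :: "'l \<Rightarrow> 'l \<Rightarrow> 'a"
  assumes form_add: "u \<in> V \<Longrightarrow> v \<in> V \<Longrightarrow> w \<in> V \<Longrightarrow> \<beta> (u + v) w = \<beta> u w + \<beta> v w"
    and form_scale: "u \<in> V \<Longrightarrow> w \<in> V \<Longrightarrow> \<beta> (\<iota> c * u) w = c * \<beta> u w"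
    and form_sym: "u \<in> V \<Longrightarrow> w \<in> V \<Longrightarrow> \<beta> u w = \<beta> w u"
    and form_radical: "u \<in> W \<Longrightarrow> w \<in> V \<Longrightarrow> \<beta> u w = 0"
begin

lemma form_comb:
  "finite S \<Longrightarrow> (\<And>i. i \<in> S \<Longrightarrow> b i \<in> V) \<Longrightarrow> w \<in> V \<Longrightarrow> \<beta> (\<Sum>i\<in>S. \<iota> (c i) * b i) w = (\<Sum>i\<in>S. c i * \<beta> (b i) w)"
proof (induction S rule: finite_induct)
  case empty
  then show ?case using form_radical[OF W_zero] by simp
next
  case (insert x F)
  then show ?case by (simp add: form_add form_scale V_scale V_comb)
qed

lemma form_comb_right:
  "finite S \<Longrightarrow> (\<And>i. i \<in> S \<Longrightarrow> b i \<in> V) \<Longrightarrow> w \<in> V \<Longrightarrow> \<beta> w (\<Sum>i\<in>S. \<iota> (c i) * b i) = (\<Sum>i\<in>S. c i * \<beta> w (b i))"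
  using form_comb[of S b w c] form_sym[of w] V_comb[of S b c] by simp

lemma form_cong:
  assumes "u - u' \<in> W" "v - v' \<in> W" "u' \<in> V" "v' \<in> V"
  shows "\<beta> u v = \<beta> u' v'"
proof -
  have V: "u \<in> V" "v \<in> V"
    using V_add[of "u - u'" u'] V_add[of "v - v'" v'] assms W_sub by auto
  have "\<beta> u v = \<beta> (u - u') v + \<beta> u' v"
    using form_add[of "u - u'" u' v] assms W_sub V by auto
  moreover have "\<beta> v u' = \<beta> (v - v') u' + \<beta> v' u'"
    using form_add[of "v - v'" v' u'] assms W_sub V by auto
  ultimately show ?thesis using form_radical assms V form_sym by simp
qed

definition gram :: "'l list \<Rightarrow> 'a mat" where
  "gram bs = mat (length bs) (length bs) (\<lambda>(i, j). \<beta> (bs ! i) (bs ! j))"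

lemma has_gw_class_altdef:
  "has_gw_class \<iota> V W \<beta> c \<longleftrightarrow> (\<exists>bs. basis_mod \<iota> V W bs \<and> nondeg_sym (gram bs) \<and> c = gw_class (gram bs))"
  unfolding has_gw_class_def gram_def Let_def ..

text \<open>The lengths of the two bases are not yet known to agree, so only a one-sided inverse is
  claimed; exchanging the bases and using \<open>right_inverse_dim\<close> twice gives the equality
  of lengths afterwards.\<close>

lemma change_of_basis:
  assumes bs: "basis_mod \<iota> V W bs" and bs': "basis_mod \<iota> V W bs'"
  obtains P Q where "P \<in> carrier_mat (length bs) (length bs')" "Q \<in> carrier_mat (length bs') (length bs)"
    "P * Q = 1\<^sub>m (length bs)" "gram bs' = P\<^sup>T * gram bs * P"
proof -
  define n m where "n = length bs" and "m = length bs'"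
  obtain co where co: "\<And>v. v \<in> V \<Longrightarrow> v - (\<Sum>i<n. \<iota> (co v i) * bs ! i) \<in> W"
    "\<And>c i. (\<Sum>i<n. \<iota> (c i) * bs ! i) \<in> W \<Longrightarrow> i < n \<Longrightarrow> c i = 0"
    "\<And>i. i < n \<Longrightarrow> bs ! i \<in> V"
    unfolding n_def using basis_modE[OF bs] by metis
  obtain co' where co': "\<And>v. v \<in> V \<Longrightarrow> v - (\<Sum>i<m. \<iota> (co' v i) * bs' ! i) \<in> W"
    "\<And>c i. (\<Sum>i<m. \<iota> (c i) * bs' ! i) \<in> W \<Longrightarrow> i < m \<Longrightarrow> c i = 0"
    "\<And>i. i < m \<Longrightarrow> bs' ! i \<in> V"
    unfolding m_def using basis_modE[OF bs'] by metis
  have comb: "(\<Sum>k<n. \<iota> (c k) * bs ! k) \<in> V"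
    "w \<in> V \<Longrightarrow> \<beta> (\<Sum>k<n. \<iota> (c k) * bs ! k) w = (\<Sum>k<n. c k * \<beta> (bs ! k) w)"
    "w \<in> V \<Longrightarrow> \<beta> w (\<Sum>k<n. \<iota> (c k) * bs ! k) = (\<Sum>k<n. c k * \<beta> w (bs ! k))" for c w
    using co(3) by (auto intro!: V_comb form_comb form_comb_right)
  define P where "P = mat n m (\<lambda>(i, j). co (bs' ! j) i)"
  define Q where "Q = mat m n (\<lambda>(i, j). co' (bs ! j) i)"
  have "P * Q = 1\<^sub>m n"
  proof (rule eq_matI)
    fix k j assume "k < dim_row (1\<^sub>m n :: 'a mat)" "j < dim_col (1\<^sub>m n :: 'a mat)"
    then have kj: "k < n" "j < n" by auto
    define v where "v = bs ! j"
    have v: "v \<in> V" unfolding v_def using co(3) kj by simp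
    \<comment> \<open>Expanding \<open>v\<close> in \<open>bs'\<close> and the members of
      \<open>bs'\<close> in \<open>bs\<close> gives a second expansion of \<open>v\<close> in
      \<open>bs\<close> modulo \<open>W\<close>; independence identifies it with the trivial
      one.\<close>
    have "(\<Sum>i<m. \<iota> (co' v i) * (bs' ! i - (\<Sum>k<n. \<iota> (co (bs' ! i) k) * bs ! k))) \<in> W"
      using co(1) co'(3) by (intro W_comb) auto
    moreover have "(\<Sum>i<m. \<iota> (co' v i) * (\<Sum>k<n. \<iota> (co (bs' ! i) k) * bs ! k))
        = (\<Sum>k<n. \<iota> (\<Sum>i<m. co (bs' ! i) k * co' v i) * bs ! k)"
      unfolding sum_distrib_left hom_sum sum_distrib_right
      by (subst sum.swap) (simp add: hom_distribs mult_ac)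
    ultimately have "(\<Sum>i<m. \<iota> (co' v i) * bs' ! i) - (\<Sum>k<n. \<iota> (\<Sum>i<m. co (bs' ! i) k * co' v i) * bs ! k) \<in> W"
      by (simp add: right_diff_distrib sum_subtractf)
    then have "v - (\<Sum>k<n. \<iota> (\<Sum>i<m. co (bs' ! i) k * co' v i) * bs ! k) \<in> W"
      using W_add[OF co'(1)[OF v]] by fastforce
    moreover have "v = (\<Sum>k<n. \<iota> (if k = j then 1 else 0) * bs ! k)"
      using kj by (simp add: v_def if_distrib[of \<iota>] if_distrib[of "\<lambda>u. u * _"] cong: if_cong)
    ultimately have "(\<Sum>k<n. \<iota> ((if k = j then 1 else 0) - (\<Sum>i<m. co (bs' ! i) k * co' v i)) * bs ! k) \<in> W"
      by (simp add: hom_distribs left_diff_distrib sum_subtractf)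
    then have "(if k = j then 1 else 0) - (\<Sum>i<m. co (bs' ! i) k * co' v i) = 0"
      using co(2)[of "\<lambda>k. (if k = j then 1 else 0) - (\<Sum>i<m. co (bs' ! i) k * co' v i)"] kj by blast
    then show "(P * Q) $$ (k, j) = 1\<^sub>m n $$ (k, j)"
      using kj by (simp add: P_def Q_def scalar_prod_def v_def atLeast0LessThan)
  qed (auto simp: P_def Q_def)
  moreover have "gram bs' = P\<^sup>T * gram bs * P"
  proof (rule eq_matI)
    fix i j assume "i < dim_row (P\<^sup>T * gram bs * P)" "j < dim_col (P\<^sup>T * gram bs * P)"
    then have ij: "i < m" "j < m" by (auto simp: P_def)
    have "gram bs' $$ (i, j) = \<beta> (bs' ! i) (bs' ! j)" using ij by (simp add: gram_def m_def)
    also have "\<dots> = \<beta> (\<Sum>k<n. \<iota> (co (bs' ! i) k) * bs ! k) (\<Sum>k<n. \<iota> (co (bs' ! j) k) * bs ! k)"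
      using ij by (intro form_cong co(1) co'(3) V_comb) (auto intro: co(3))
    also have "\<dots> = (\<Sum>k<n. co (bs' ! i) k * (\<Sum>k'<n. co (bs' ! j) k' * \<beta> (bs ! k) (bs ! k')))"
      by (simp add: comb(1,2)) (simp add: comb(3) co(3))
    also have "\<dots> = (P\<^sup>T * (gram bs * P)) $$ (i, j)"
      using ij by (simp add: P_def gram_def scalar_prod_def n_def[symmetric] atLeast0LessThan mult_ac)
    also have "P\<^sup>T * (gram bs * P) = P\<^sup>T * gram bs * P"
      by (rule assoc_mult_mat[symmetric, of _ m n _ n _ m]) (auto simp: P_def gram_def n_def)
    finally show "gram bs' $$ (i, j) = (P\<^sup>T * gram bs * P) $$ (i, j)" .
  qed (auto simp: P_def gram_def m_def)
  ultimately show ?thesis using that[of P Q] by (auto simp: P_def Q_def n_def m_def)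
qed

lemma gram_isometric:
  assumes bs: "basis_mod \<iota> V W bs" and bs': "basis_mod \<iota> V W bs'" and nd: "nondeg_sym (gram bs)"
  shows "isometric (gram bs) (gram bs')"
proof -
  obtain P Q where PQ: "P \<in> carrier_mat (length bs) (length bs')" "Q \<in> carrier_mat (length bs') (length bs)"
    "P * Q = 1\<^sub>m (length bs)" "gram bs' = P\<^sup>T * gram bs * P"
    using change_of_basis[OF bs bs'] .
  obtain P' Q' where PQ': "P' \<in> carrier_mat (length bs') (length bs)" "Q' \<in> carrier_mat (length bs) (length bs')"
    "P' * Q' = 1\<^sub>m (length bs')" "gram bs = P'\<^sup>T * gram bs' * P'"
    by (rule change_of_basis[OF bs' bs])
  have len: "length bs' = length bs"
    using right_inverse_dim[OF PQ(1-3)] right_inverse_dim[OF PQ'(1-3)] by simp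
  show ?thesis
    using PQ nd by (intro isometricI[of _ "length bs" P]) (auto simp: len gram_def intro: invertible_matI)
qed

lemma has_gw_class_unique:
  assumes "has_gw_class \<iota> V W \<beta> c" "has_gw_class \<iota> V W \<beta> c'"
  shows "c = c'"
  using assms gram_isometric gw_class_cong unfolding has_gw_class_altdef by metis

text \<open>A kernel vector of the Gram matrix consists of the coordinates of an element orthogonal
  to \<open>V\<close>. Invertibility thus becomes a condition on the form, to be checked by
  divisibility of polynomials or by separability.\<close>

lemma nondeg_sym_gram:
  assumes bs: "basis_mod \<iota> V W bs" and nd: "\<And>u. u \<in> V \<Longrightarrow> (\<And>v. v \<in> V \<Longrightarrow> \<beta> v u = 0) \<Longrightarrow> u \<in> W"
  shows "nondeg_sym (gram bs)"
proof -
  define n where "n = length bs"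
  obtain co where co: "\<And>v. v \<in> V \<Longrightarrow> v - (\<Sum>i<n. \<iota> (co v i) * bs ! i) \<in> W"
    "\<And>c i. (\<Sum>i<n. \<iota> (c i) * bs ! i) \<in> W \<Longrightarrow> i < n \<Longrightarrow> c i = 0"
    "\<And>i. i < n \<Longrightarrow> bs ! i \<in> V"
    unfolding n_def using basis_modE[OF bs] by metis
  have comb: "(\<Sum>k<n. \<iota> (c k) * bs ! k) \<in> V"
    "w \<in> V \<Longrightarrow> \<beta> (\<Sum>k<n. \<iota> (c k) * bs ! k) w = (\<Sum>k<n. c k * \<beta> (bs ! k) w)"
    "w \<in> V \<Longrightarrow> \<beta> w (\<Sum>k<n. \<iota> (c k) * bs ! k) = (\<Sum>k<n. c k * \<beta> w (bs ! k))" for c w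
    using co(3) by (auto intro!: V_comb form_comb form_comb_right)
  have c: "gram bs \<in> carrier_mat n n" by (simp add: gram_def n_def)
  have "det (gram bs) \<noteq> 0"
  proof
    assume "det (gram bs) = 0"
    then obtain v where v: "v \<in> carrier_vec n" "v \<noteq> 0\<^sub>v n" "gram bs *\<^sub>v v = 0\<^sub>v n"
      using det_0_iff_vec_prod_zero[OF c] by blast
    define u where "u = (\<Sum>i<n. \<iota> (v $ i) * bs ! i)"
    have u: "u \<in> V" unfolding u_def by (intro V_comb) (auto intro: co(3))
    have "\<beta> (bs ! i) u = 0" if "i < n" for i
    proof -
      have "\<beta> (bs ! i) u = (gram bs *\<^sub>v v) $ i"
        unfolding u_def using that v(1) co(3)
        by (simp add: comb gram_def scalar_prod_def n_def[symmetric] atLeast0LessThan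
          mult.commute[of "v $ _"])
      then show ?thesis using v(3) that by simp
    qed
    then have "\<beta> w u = 0" if "w \<in> V" for w
      using form_cong[OF co(1)[OF that], of u u] u W_zero
      by (simp add: comb)
    then have "u \<in> W" using nd u by blast
    then have "v $ i = 0" if "i < n" for i
      using that co(2)[of "\<lambda>i. v $ i" i] unfolding u_def by blast
    then show False using v(1,2) by (auto intro!: eq_vecI)
  qed
  then have "gram bs \<in> Units (ring_mat TYPE('a) n ())" by (rule det_non_zero_imp_unit[OF c])
  then have "invertible_mat (gram bs)"
    unfolding Units_def ring_mat_def by (auto intro: invertible_matI[OF c])
  moreover have "transpose_mat (gram bs) = gram bs"
    by (intro eq_matI) (auto simp: gram_def form_sym co(3) n_def[symmetric])
  ultimately show ?thesis using c by (intro nondeg_symI)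
qed

end

section \<open>Bezoutians\<close>

text \<open>This is (p(T1) - p(T2)) / (T1 - T2) written out: the coefficient of T1^i T2^j is that of
  index i + j + 1 in \<open>p\<close>. The inner variable is T1.\<close>

definition bez :: "'a::field poly \<Rightarrow> 'a poly poly" where
  "bez p = (\<Sum>j<degree p. monom (poly_shift (Suc j) p) j)"

lemma coeff_bez: "coeff (bez p) j = poly_shift (Suc j) p"
proof (cases "j < degree p")
  case True
  then show ?thesis by (simp add: bez_def coeff_sum)
next
  case False
  then have "poly_shift (Suc j) p = 0" by (intro poly_eqI) (simp add: coeff_poly_shift coeff_eq_0)
  then show ?thesis using False by (simp add: bez_def coeff_sum)
qed

lemma bez_0: "bez 0 = 0"
  by (simp add: bez_def)

lemma bez_pCons: "bez (pCons a p) = pCons p (bez p)"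
  by (intro poly_eqI) (simp add: coeff_bez coeff_poly_shift coeff_pCons split: nat.split)

lemma bez_difference:
  "bez G * ([:[:0, 1:]:] - [:0, 1:]) = [:G:] - map_poly (\<lambda>c. [:c:]) G"
proof (induction G)
  case (pCons a G)
  have "bez (pCons a G) * ([:[:0, 1:]:] - [:0, 1:])
      = [:G:] * ([:[:0, 1:]:] - [:0, 1:]) + [:0, 1:] * (bez G * ([:[:0, 1:]:] - [:0, 1:]))"
  proof -
    have "pCons G (bez G) = [:G:] + [:0, 1:] * bez G" by simp
    then show ?thesis unfolding bez_pCons by (simp only: distrib_right mult.assoc)
  qed
  also have "\<dots> = [:pCons a G:] - map_poly (\<lambda>c. [:c:]) (pCons a G)"
    unfolding pCons.IH using pCons.hyps by (simp add: map_poly_pCons algebra_simps)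
  finally show ?case .
qed (simp add: bez_0)


lemma difference_factor_nonzero: "[:[:0, 1:]:] - [:0, 1:] \<noteq> (0 :: 'a::field poly poly)"
  by simp

text \<open>The Leibniz rule for difference quotients, from P(T1) U(T1) - P(T2) U(T2) = U(T1) (P(T1)
  - P(T2)) + P(T2) (U(T1) - U(T2)). This asymmetric version is the one whose second term dies modulo
  P(T2).\<close>

lemma bez_mult: "bez (P * U) = [:U:] * bez P + map_poly (\<lambda>c. [:c:]) P * bez U"
proof -
  interpret C: map_poly_comm_ring_hom "\<lambda>c::'a. [:c:]" by standard (auto simp: one_pCons)
  let ?D = "[:[:0, 1:]:] - [:0, 1:] :: 'a poly poly"
  have "bez (P * U) * ?D = ([:U:] * bez P + map_poly (\<lambda>c. [:c:]) P * bez U) * ?D"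
  proof -
    have "([:U:] * bez P + map_poly (\<lambda>c. [:c:]) P * bez U) * ?D
        = [:U:] * (bez P * ?D) + map_poly (\<lambda>c. [:c:]) P * (bez U * ?D)"
      by (simp only: distrib_right mult.assoc)
    also have "\<dots> = [:P * U:] - map_poly (\<lambda>c. [:c:]) P * map_poly (\<lambda>c. [:c:]) U"
      unfolding bez_difference by (simp add: algebra_simps)
    also have "\<dots> = bez (P * U) * ?D" unfolding bez_difference by (simp add: C.hom_mult)
    finally show ?thesis ..
  qed
  then show ?thesis by (simp only: mult_right_cancel[OF difference_factor_nonzero])
qed

text \<open>On the diagonal T2 = T1 a difference quotient is the derivative; this is where the
  derivative in Euler's formula comes from.\<close>

lemma bez_diagonal: "poly (bez p) [:0, 1:] = pderiv p"
  by (induction p) (simp_all add: bez_0 bez_pCons pderiv_pCons)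

section \<open>Linear functionals on F[T] and the top coefficient modulo P\<close>

definition poly_functional :: "('a::field poly \<Rightarrow> 'a) \<Rightarrow> bool" where
  "poly_functional \<tau> \<longleftrightarrow> (\<forall>u v. \<tau> (u + v) = \<tau> u + \<tau> v) \<and> (\<forall>c u. \<tau> (Polynomial.smult c u) = c * \<tau> u)"

lemma poly_functionalD:
  assumes "poly_functional \<tau>"
  shows "\<tau> (u + v) = \<tau> u + \<tau> v" "\<tau> (Polynomial.smult c u) = c * \<tau> u" "\<tau> 0 = 0" "\<tau> (u - v) = \<tau> u - \<tau> v"
    "\<tau> (sum h S) = (\<Sum>i\<in>S. \<tau> (h i))"
proof -
  show 1: "\<tau> (u + v) = \<tau> u + \<tau> v" "\<tau> (Polynomial.smult c u) = c * \<tau> u" for u v c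
    using assms unfolding poly_functional_def by auto
  show 2: "\<tau> 0 = 0" using 1(2)[of 0 0] by simp
  show "\<tau> (u - v) = \<tau> u - \<tau> v" using 1(1)[of "u - v" v] by simp
  show "\<tau> (sum h S) = (\<Sum>i\<in>S. \<tau> (h i))"
    by (induction S rule: infinite_finite_induct) (simp_all add: 1 2)
qed

lemma poly_functional_mult: "poly_functional \<tau> \<Longrightarrow> poly_functional (\<lambda>q. \<tau> (u * q))"
  unfolding poly_functional_def by (simp add: distrib_left)

lemma coeff_map_functional: "poly_functional \<tau> \<Longrightarrow> coeff (map_poly \<tau> B) j = \<tau> (coeff B j)"
  by (simp add: coeff_map_poly poly_functionalD)

lemma map_functional_add: "poly_functional \<tau> \<Longrightarrow> map_poly \<tau> (A + B) = map_poly \<tau> A + map_poly \<tau> B"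
  by (intro poly_eqI) (simp add: coeff_map_functional poly_functionalD)

lemma map_functional_diff: "poly_functional \<tau> \<Longrightarrow> map_poly \<tau> (A - B) = map_poly \<tau> A - map_poly \<tau> B"
  by (intro poly_eqI) (simp add: coeff_map_functional poly_functionalD)

lemma map_functional_const:
  "poly_functional \<tau> \<Longrightarrow> map_poly \<tau> ([:u:] * B) = map_poly (\<lambda>q. \<tau> (u * q)) B"
  by (intro poly_eqI) (simp add: coeff_map_functional poly_functional_mult)

text \<open>\<open>map_poly \<tau>\<close> is \<tau> tensor id on F[T1, T2]. It is linear over
  polynomials in the outer variable T2, the variable in which congruences are read.\<close>

lemma map_functional_lift:
  assumes "poly_functional \<tau>"
  shows "map_poly \<tau> (map_poly (\<lambda>c. [:c:]) p * B) = p * map_poly \<tau> B"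
  by (intro poly_eqI)
    (simp add: coeff_map_functional[OF assms] coeff_mult coeff_map_poly poly_functionalD[OF assms])

text \<open>For monic \<open>P\<close> this is the coefficient of 1/T in the expansion of q/P at
  infinity. It solves the Bezoutian equation for \<open>P\<close> itself; the forms for multiples of
  \<open>P\<close> are twists of it.\<close>

definition top_coeff :: "'a::field poly \<Rightarrow> 'a poly \<Rightarrow> 'a" where
  "top_coeff P q = coeff (q mod P) (degree P - 1)"

lemma top_coeff_functional: "poly_functional (top_coeff P)"
  unfolding poly_functional_def top_coeff_def by (simp add: poly_mod_add_left mod_smult_left)

lemma top_coeff_dvd: "P dvd q \<Longrightarrow> top_coeff P q = 0"
  unfolding top_coeff_def by (simp add: mod_eq_0_iff_dvd)

lemma top_coeff_mod: "top_coeff P (q mod P) = top_coeff P q"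
  unfolding top_coeff_def by simp

lemma degree_poly_shift: "degree (poly_shift n p) \<le> degree p - n"
  by (intro degree_le) (auto simp: coeff_poly_shift coeff_eq_0)

context
  fixes P :: "'a::field poly"
  assumes monic: "lead_coeff P = 1" and deg: "degree P > 0"
begin

text \<open>The coefficients of \<open>bez P\<close> have degree below \<open>degree P\<close> and
  need no reduction; the top coefficient of the j-th is the coefficient of \<open>P\<close> at
  \<open>degree P + j\<close>, which is 1 for j = 0 and 0 otherwise.\<close>

lemma top_coeff_bez: "map_poly (top_coeff P) (bez P) = 1"
proof (rule poly_eqI)
  fix j
  have "degree (poly_shift (Suc j) P) < degree P"
    using degree_poly_shift[of "Suc j" P] deg by linarith
  then have "top_coeff P (poly_shift (Suc j) P) = coeff P (degree P - 1 + Suc j)"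
    unfolding top_coeff_def by (simp add: mod_poly_less coeff_poly_shift)
  also have "\<dots> = coeff 1 j"
    using monic deg by (cases "j = 0") (simp_all add: coeff_eq_0)
  finally show "coeff (map_poly (top_coeff P) (bez P)) j = coeff 1 j"
    by (simp add: coeff_map_functional top_coeff_functional coeff_bez)
qed

text \<open>For j < \<open>degree P\<close> the polynomials \<open>poly_shift (Suc j) P\<close> are
  monic, one in each degree below \<open>degree P\<close>. They form a basis modulo
  \<open>P\<close>, and the Bezoutian equation prescribes \<tau> exactly on it.\<close>

lemma functional_eq_top_coeff:
  assumes \<tau>: "poly_functional \<tau>" and kill: "\<And>q. P dvd q \<Longrightarrow> \<tau> q = 0"
    and bez: "map_poly \<tau> (bez P) = 1"
  shows "\<tau> q = top_coeff P q"
proof -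
  note lin = poly_functionalD[OF \<tau>] and lin' = poly_functionalD[OF top_coeff_functional[of P]]
  have shift: "\<tau> (poly_shift (Suc j) P) = top_coeff P (poly_shift (Suc j) P)" for j
    using arg_cong[OF trans[OF bez top_coeff_bez[symmetric]], of "\<lambda>p. coeff p j"]
    by (simp add: coeff_map_functional \<tau> top_coeff_functional coeff_bez)
  have "\<tau> q = top_coeff P q" if "degree q < degree P" for q
    using that
  proof (induction "degree q" arbitrary: q rule: less_induct)
    case less
    define s where "s = poly_shift (degree P - degree q) P"
    have s: "s = poly_shift (Suc (degree P - degree q - 1)) P" using less.prems by (simp add: s_def Suc_diff_Suc)
    have ds: "degree s \<le> degree q" "coeff s (degree q) = 1"
      using degree_poly_shift[of "degree P - degree q" P] less.prems monic by (simp_all add: s_def coeff_poly_shift)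
    define r where "r = q - Polynomial.smult (lead_coeff q) s"
    have "r = 0 \<or> degree r < degree q"
    proof (cases "degree q = 0")
      case True
      then have "s = [:1:]" using ds degree_0_id[of s] by simp
      moreover have "q = [:coeff q 0:]" using True degree_0_id[of q] by simp
      ultimately have "r = 0" unfolding r_def using True by (metis diff_self mult.right_neutral smult_0_right smult_pCons)
      then show ?thesis ..
    next
      case False
      have "degree r \<le> degree q" unfolding r_def using ds by (intro degree_diff_le) auto
      moreover have "coeff r (degree q) = 0" unfolding r_def using ds by simp
      ultimately show ?thesis using eq_zero_or_degree_less by blast
    qed
    then have "\<tau> r = top_coeff P r"
    proof
      assume "r = 0"
      then show ?thesis by (simp add: lin(3) lin'(3))
    next
      assume "degree r < degree q"
      then show ?thesis using less.hyps less.prems by simp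
    qed
    moreover have "\<tau> s = top_coeff P s" unfolding s by (rule shift)
    ultimately have "\<tau> (r + Polynomial.smult (lead_coeff q) s) = top_coeff P (r + Polynomial.smult (lead_coeff q) s)"
      by (simp only: lin(1,2) lin'(1,2))
    then show ?case by (simp add: r_def)
  qed
  moreover have "degree (q mod P) < degree P" proof -
    have "P \<noteq> 0" using deg by auto
    then show ?thesis using degree_mod_less[of P q] deg by auto
  qed
  moreover have "\<tau> q = \<tau> (q mod P)"
    using kill[of "q - q mod P"] lin(4)[of q "q mod P"] by (simp add: minus_mod_eq_mult_div)
  ultimately show ?thesis by (simp add: top_coeff_mod)
qed

text \<open>Modulo \<open>P(T\<^sub>2)\<close> the quotient for \<open>G = P U\<close> is \<open>U(T\<^sub>1)\<close> times that for \<open>P\<close>, and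
  \<^term>\<open>top_coeff P\<close> solves the equation for \<open>P\<close>.\<close>

lemma bezoutian_functional_iff:
  assumes \<tau>: "poly_functional \<tau>" and kill: "\<And>q. P dvd q \<Longrightarrow> \<tau> q = 0"
  shows "P dvd map_poly \<tau> (bez (P * U)) - 1 \<longleftrightarrow> (\<forall>q. \<tau> (U * q) = top_coeff P q)"
proof -
  define \<mu> where "\<mu> q = \<tau> (U * q)" for q
  have \<mu>: "poly_functional \<mu>" unfolding \<mu>_def using \<tau> by (rule poly_functional_mult)
  have "map_poly \<tau> (bez (P * U)) = map_poly \<mu> (bez P) + P * map_poly \<tau> (bez U)"
    unfolding bez_mult \<mu>_def
    by (simp only: map_functional_add map_functional_const map_functional_lift \<tau>)
  then have "P dvd map_poly \<tau> (bez (P * U)) - 1 \<longleftrightarrow> P dvd (map_poly \<mu> (bez P) - 1) + P * map_poly \<tau> (bez U)"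
    by (simp only: diff_add_eq)
  also have "\<dots> \<longleftrightarrow> P dvd map_poly \<mu> (bez P) - 1" by (rule dvd_add_left_iff) simp
  \<comment> \<open>Both polynomials have degree below \<open>degree P\<close>, so congruence modulo
    \<open>P\<close> is equality.\<close>
  also have "\<dots> \<longleftrightarrow> map_poly \<mu> (bez P) = 1"
  proof
    assume dvd: "P dvd map_poly \<mu> (bez P) - 1"
    have "degree (map_poly \<mu> (bez P)) \<le> degree P - 1"
    proof (rule degree_le, intro allI impI)
      fix j assume "degree P - 1 < j"
      then have "poly_shift (Suc j) P = 0"
        by (intro poly_eqI) (simp add: coeff_poly_shift coeff_eq_0)
      then show "coeff (map_poly \<mu> (bez P)) j = 0"
        by (simp add: coeff_map_functional \<mu> coeff_bez poly_functionalD(3)[OF \<mu>])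
    qed
    then have "degree (map_poly \<mu> (bez P) - 1) \<le> degree P - 1" by (intro degree_diff_le) auto
    then have "degree (map_poly \<mu> (bez P) - 1) < degree P" using deg by linarith
    then show "map_poly \<mu> (bez P) = 1" using dvd_imp_degree_le[OF dvd]
      by (cases "map_poly \<mu> (bez P) - 1 = 0") auto
  qed simp
  also have "\<dots> \<longleftrightarrow> (\<forall>q. \<mu> q = top_coeff P q)"
  proof
    assume "map_poly \<mu> (bez P) = 1"
    moreover have "\<mu> q = 0" if "P dvd q" for q unfolding \<mu>_def using that by (intro kill) simp
    ultimately show "\<forall>q. \<mu> q = top_coeff P q" using functional_eq_top_coeff[OF \<mu>] by blast
  next
    assume "\<forall>q. \<mu> q = top_coeff P q"
    then have "\<mu> = top_coeff P" by auto
    then show "map_poly \<mu> (bez P) = 1" using top_coeff_bez by simp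
  qed
  finally show ?thesis unfolding \<mu>_def .
qed

text \<open>The coefficients of the Bezoutian are the basis dual to the powers of the variable.\<close>

lemma coeff_mod_dual: "coeff (u mod P) j = top_coeff P (u * poly_shift (Suc j) P)"
proof -
  interpret C: map_poly_comm_ring_hom "\<lambda>c::'a. [:c:]" by standard (auto simp: one_pCons)
  let ?D = "[:[:0, 1:]:] - [:0, 1:] :: 'a poly poly" and ?L = "map_poly (\<lambda>c::'a. [:c:])"
  define w where "w = map_poly (\<lambda>q. top_coeff P (u * q)) (bez P)"
  note lin = top_coeff_functional[of P]
  \<comment> \<open>Both sides are (u(T1) - u(T2)) (P(T1) - P(T2)). Applying the top coefficient in
    T1 kills the multiples of P(T1) and leaves a congruence between \<open>w\<close> and
    \<open>u\<close> modulo P(T2).\<close>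
  have "([:u:] - ?L u) * bez P * ?D = bez u * ([:P:] - ?L P) * ?D"
    unfolding bez_difference[symmetric] by (simp only: mult_ac)
  then have eq: "([:u:] - ?L u) * bez P = bez u * ([:P:] - ?L P)"
    by (simp only: mult_right_cancel[OF difference_factor_nonzero])
  have "w - u = map_poly (top_coeff P) (([:u:] - ?L u) * bez P)"
    unfolding w_def left_diff_distrib map_functional_diff[OF lin] map_functional_const[OF lin]
      map_functional_lift[OF lin] top_coeff_bez by simp
  also have "([:u:] - ?L u) * bez P = [:P:] * bez u - ?L P * bez u"
    unfolding eq by (simp only: mult.commute left_diff_distrib right_diff_distrib)
  also have "map_poly (top_coeff P) \<dots> = - (P * map_poly (top_coeff P) (bez u))"
  proof -
    have "map_poly (\<lambda>q. top_coeff P (P * q)) (bez u) = 0"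
      by (intro poly_eqI) (simp add: coeff_map_poly top_coeff_dvd)
    then show ?thesis
      unfolding map_functional_diff[OF lin] map_functional_const[OF lin] map_functional_lift[OF lin] by simp
  qed
  finally have "P dvd u - w" by (metis dvd_minus_iff dvd_triv_left minus_diff_eq)
  then have "u mod P = w mod P" by (simp add: mod_eq_dvd_iff)
  moreover have "degree w \<le> degree P - 1"
  proof (rule degree_le, intro allI impI)
    fix j assume "degree P - 1 < j"
    then have "poly_shift (Suc j) P = 0"
      by (intro poly_eqI) (simp add: coeff_poly_shift coeff_eq_0)
    then show "coeff w j = 0"
      by (simp add: w_def coeff_map_functional poly_functional_mult lin coeff_bez top_coeff_dvd)
  qed
  then have "w mod P = w" using deg by (intro mod_poly_less) linarith
  ultimately have "u mod P = w" by simp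
  then show ?thesis
    by (simp add: w_def coeff_map_functional poly_functional_mult lin coeff_bez)
qed

lemma top_coeff_nondegenerate:
  assumes "\<And>v. top_coeff P (u * v) = 0"
  shows "P dvd u"
proof -
  have "u mod P = 0" by (intro poly_eqI) (simp add: coeff_mod_dual assms)
  then show ?thesis by (simp add: dvd_eq_mod_eq_0)
qed

text \<open>The left side is the trace of multiplication by \<open>u\<close> on F[T]/(P). Pairing
  the powers of T with their dual basis and summing the products gives the Bezoutian on the
  diagonal, that is, the derivative of \<open>P\<close>.\<close>

lemma trace_eq_top_coeff:
  "(\<Sum>j<degree P. coeff ((u * monom 1 j) mod P) j) = top_coeff P (u * pderiv P)"
proof -
  have "(\<Sum>j<degree P. monom 1 j * poly_shift (Suc j) P) = pderiv P"
  proof -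
    have "pderiv P = (\<Sum>j<degree P. poly (monom (poly_shift (Suc j) P) j) [:0, 1:])"
      unfolding bez_diagonal[symmetric] bez_def by (simp add: poly_sum)
    then show ?thesis by (simp add: poly_monom monom_altdef mult.commute)
  qed
  then show ?thesis
    by (simp only: coeff_mod_dual mult.assoc poly_functionalD(5)[OF top_coeff_functional, symmetric]
      sum_distrib_left[symmetric])
qed

end

section \<open>The trace of a simple separable extension\<close>

lemma block_index_less:
  fixes r s n d :: nat
  assumes "r < n" "s < d"
  shows "r * d + s < n * d"
proof -
  have "r * d + s < Suc r * d" using assms by simp
  also have "\<dots> \<le> n * d" using assms by (intro mult_le_mono1) simp
  finally show ?thesis .
qed

lemma sum_div_mod:
  fixes h :: "nat \<Rightarrow> nat \<Rightarrow> 'b::comm_monoid_add"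
  shows "(\<Sum>i<n * d. h (i div d) (i mod d)) = (\<Sum>r<n. \<Sum>s<d. h r s)"
proof (cases "d = 0")
  case False
  have "(\<Sum>i<n * d. h (i div d) (i mod d)) = (\<Sum>(r, s)\<in>{..<n} \<times> {..<d}. h r s)"
    using False
    by (intro sum.reindex_bij_witness[of _ "\<lambda>(r, s). r * d + s" "\<lambda>i. (i div d, i mod d)"])
      (auto simp: less_mult_imp_div_less block_index_less)
  then show ?thesis by (simp add: sum.cartesian_product)
qed simp

context comm_ring_hom
begin

lemma eval_simps:
  "poly (map_poly hom 0) z = 0" (is ?P1) "poly (map_poly hom 1) z = 1" (is ?P2)
  "poly (map_poly hom (A + B)) z = poly (map_poly hom A) z + poly (map_poly hom B) z" (is ?P3)
  "poly (map_poly hom (A - B)) z = poly (map_poly hom A) z - poly (map_poly hom B) z" (is ?P4)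
  "poly (map_poly hom (A * B)) z = poly (map_poly hom A) z * poly (map_poly hom B) z" (is ?P5)
  "poly (map_poly hom (- A)) z = - poly (map_poly hom A) z" (is ?P6)
  "poly (map_poly hom (A ^ n)) z = poly (map_poly hom A) z ^ n" (is ?P7)
  "poly (map_poly hom (monom c n)) z = hom c * z ^ n" (is ?P8)
  "poly (map_poly hom (pCons c A)) z = hom c + z * poly (map_poly hom A) z" (is ?P9)
  "poly (map_poly hom (Polynomial.smult c A)) z = hom c * poly (map_poly hom A) z" (is ?P10)
  "poly (map_poly hom (sum h S)) z = (\<Sum>i\<in>S. poly (map_poly hom (h i)) z)" (is ?P11)
proof -
  interpret mp: map_poly_comm_ring_hom hom ..
  show ?P1 ?P2 ?P3 ?P4 ?P5 ?P6 ?P7 ?P8 ?P9 ?P10 ?P11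
    by (simp_all add: hom_distribs mp.hom_mult mp.hom_minus mp.hom_uminus mp.hom_power mp.hom_sum poly_monom poly_sum)
qed

end

locale simple_extension = field_hom \<kappa>
  for \<kappa> :: "'a::field \<Rightarrow> 'k::field" and \<theta> :: 'k and m :: "'a poly" +
  assumes generates: "\<And>z. \<exists>q. z = poly (map_poly \<kappa> q) \<theta>"
    and min_poly: "\<And>q. poly (map_poly \<kappa> q) \<theta> = 0 \<longleftrightarrow> m dvd q"
    and monic_m: "lead_coeff m = 1"
    and separable: "poly (map_poly \<kappa> (pderiv m)) \<theta> \<noteq> 0"
begin

abbreviation evt :: "'a poly \<Rightarrow> 'k" where "evt q \<equiv> poly (map_poly \<kappa> q) \<theta>"

abbreviation tr :: "'k \<Rightarrow> 'a" where "tr \<equiv> field_trace \<kappa>"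

abbreviation d :: nat where "d \<equiv> degree m"

lemma degree_m: "0 < d"
proof (rule ccontr)
  assume "\<not> 0 < d"
  then have "m = 1" using monic_m degree_0_id[of m] by (simp add: one_pCons)
  then have "evt 1 = 0" unfolding min_poly by simp
  then show False by (simp add: eval_simps)
qed

lemma m_nonzero: "m \<noteq> 0"
  using degree_m by auto

lemma at_mod: "evt (q mod m) = evt q"
proof -
  have "evt (q - q mod m) = 0" unfolding min_poly by (simp add: minus_mod_eq_mult_div)
  then show ?thesis by (simp add: eval_simps)
qed

definition lift :: "'k \<Rightarrow> 'a poly" where
  "lift z = (SOME q. z = evt q)"

lemma at_lift: "evt (lift z) = z"
  unfolding lift_def by (rule someI2_ex[OF generates]) simp

lemma eq_mod_m: "evt p = evt q \<Longrightarrow> p mod m = q mod m"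
  using min_poly[of "p - q"] by (simp add: eval_simps mod_eq_dvd_iff)

lemma at_sum_coeffs: "evt q = (\<Sum>i<d. \<kappa> (coeff (q mod m) i) * \<theta> ^ i)"
proof -
  have "degree (q mod m) \<le> d - 1"
    using degree_mod_less[OF m_nonzero, of q] degree_m by auto
  moreover have "{..d - 1} = {..<d}" using degree_m by auto
  ultimately have "(\<Sum>i<d. monom (coeff (q mod m) i) i) = q mod m"
    using poly_as_sum_of_monoms'[of "q mod m" "d - 1"] by simp
  from arg_cong[OF this, of evt] have "(\<Sum>i<d. \<kappa> (coeff (q mod m) i) * \<theta> ^ i) = evt (q mod m)"
    unfolding eval_simps .
  then show ?thesis by (simp add: at_mod)
qed

sublocale whole: subquotient \<kappa> UNIV "{0}"
  by standard auto

lemma power_basis: "basis_mod \<kappa> UNIV {0} (map (\<lambda>i. \<theta> ^ i) [0..<d])"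
proof (rule whole.basis_modI)
  fix v
  show "\<exists>c. v - (\<Sum>i<length (map (\<lambda>i. \<theta> ^ i) [0..<d]). \<kappa> (c i) * map (\<lambda>i. \<theta> ^ i) [0..<d] ! i) \<in> {0}"
    using at_sum_coeffs[of "lift v"] by (intro exI[of _ "coeff (lift v mod m)"]) (simp add: at_lift)
next
  fix c :: "nat \<Rightarrow> 'a" and i
  assume c: "(\<Sum>i<length (map (\<lambda>i. \<theta> ^ i) [0..<d]). \<kappa> (c i) * map (\<lambda>i. \<theta> ^ i) [0..<d] ! i) \<in> {0}"
    and i: "i < length (map (\<lambda>i. \<theta> ^ i) [0..<d])"
  define q where "q = (\<Sum>i<d. monom (c i) i)"
  have "evt q = 0" using c unfolding q_def eval_simps by simp
  then have "m dvd q" using min_poly by blast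
  moreover have "degree q < d"
  proof -
    have "degree q \<le> d - 1" unfolding q_def
      by (intro degree_sum_le) (auto intro: order.trans[OF degree_monom_le])
    then show ?thesis using degree_m by linarith
  qed
  ultimately have "q = 0" by (cases "q = 0") (auto dest: dvd_imp_degree_le)
  moreover have "coeff q i = c i" using i by (simp add: q_def coeff_sum)
  ultimately show "c i = 0" by simp
qed simp

lemma ext_basis: "basis_mod \<kappa> UNIV {0} (ext_basis \<kappa>)"
  unfolding ext_basis_def by (rule someI[of "basis_mod \<kappa> UNIV {0}", OF power_basis])

abbreviation b :: "nat \<Rightarrow> 'k" where "b i \<equiv> ext_basis \<kappa> ! i"

abbreviation e :: nat where "e \<equiv> length (ext_basis \<kappa>)"

lemma ext_coords:
  "ext_coords \<kappa> z \<in> carrier_vec e" "z = (\<Sum>i<e. \<kappa> (ext_coords \<kappa> z $ i) * b i)"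
proof -
  have "\<exists>!c. c \<in> carrier_vec e \<and> z = (\<Sum>i<e. \<kappa> (c $ i) * b i)"
    using ext_basis unfolding basis_mod_def by simp
  from theI'[OF this]
  show "ext_coords \<kappa> z \<in> carrier_vec e" "z = (\<Sum>i<e. \<kappa> (ext_coords \<kappa> z $ i) * b i)"
    unfolding ext_coords_def by auto
qed

lemma ext_coords_eqI:
  assumes "z = (\<Sum>i<e. \<kappa> (c i) * b i)" "i < e"
  shows "ext_coords \<kappa> z $ i = c i"
proof -
  have "\<exists>!c. c \<in> carrier_vec e \<and> z = (\<Sum>i<e. \<kappa> (c $ i) * b i)"
    using ext_basis unfolding basis_mod_def by simp
  moreover have "vec e c \<in> carrier_vec e \<and> z = (\<Sum>i<e. \<kappa> (vec e c $ i) * b i)"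
    using assms(1) by simp
  moreover have "ext_coords \<kappa> z \<in> carrier_vec e \<and> z = (\<Sum>i<e. \<kappa> (ext_coords \<kappa> z $ i) * b i)"
    using ext_coords by blast
  ultimately have "ext_coords \<kappa> z = vec e c" by blast
  then show ?thesis using assms(2) by simp
qed

lemma ext_coords_sum:
  assumes "i < e" "finite S"
  shows "ext_coords \<kappa> (\<Sum>j\<in>S. \<kappa> (c j) * z j) $ i = (\<Sum>j\<in>S. c j * ext_coords \<kappa> (z j) $ i)"
proof (rule ext_coords_eqI)
  have "(\<Sum>j\<in>S. \<kappa> (c j) * z j) = (\<Sum>j\<in>S. \<kappa> (c j) * (\<Sum>i<e. \<kappa> (ext_coords \<kappa> (z j) $ i) * b i))"
    using ext_coords(2) by simp
  also have "\<dots> = (\<Sum>i<e. \<kappa> (\<Sum>j\<in>S. c j * ext_coords \<kappa> (z j) $ i) * b i)"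
    unfolding sum_distrib_left hom_sum sum_distrib_right
    by (subst sum.swap) (simp add: hom_distribs mult_ac)
  finally show "(\<Sum>j\<in>S. \<kappa> (c j) * z j) = (\<Sum>i<e. \<kappa> (\<Sum>j\<in>S. c j * ext_coords \<kappa> (z j) $ i) * b i)" .
qed fact

text \<open>Coordinates in the power basis of \<theta>. \<open>ext_coords\<close> refers to a basis
  about which only its existence is known, so the trace has to be compared between the two.\<close>

definition power_coord :: "'k \<Rightarrow> nat \<Rightarrow> 'a" where
  "power_coord z i = coeff (lift z mod m) i"

lemma power_coord_at: "power_coord (evt q) i = coeff (q mod m) i"
  unfolding power_coord_def using eq_mod_m[of "lift (evt q)" q] by (simp add: at_lift)

lemma power_coord_sum:
  "power_coord (\<Sum>j\<in>S. \<kappa> (c j) * z j) i = (\<Sum>j\<in>S. c j * power_coord (z j) i)"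
proof -
  have eq: "(\<Sum>j\<in>S. \<kappa> (c j) * z j) = evt (\<Sum>j\<in>S. Polynomial.smult (c j) (lift (z j)))"
    by (simp add: eval_simps at_lift)
  have "(\<Sum>j\<in>S. Polynomial.smult (c j) (lift (z j))) mod m = (\<Sum>j\<in>S. Polynomial.smult (c j) (lift (z j) mod m))"
    by (induction S rule: infinite_finite_induct) (simp_all add: poly_mod_add_left mod_smult_left)
  then show ?thesis unfolding eq power_coord_at by (simp add: coeff_sum power_coord_def)
qed

text \<open>The trace computed in any basis is the trace computed in the power basis, and there it is
  Euler's formula for the dual basis.\<close>

lemma field_trace_at: "tr (evt q) = top_coeff m (q * pderiv m)"
proof -
  define z where "z = evt q"
  have "tr z = (\<Sum>i<e. ext_coords \<kappa> (z * b i) $ i)"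
    unfolding field_trace_def ..
  \<comment> \<open>Basis invariance of the trace: expand \<open>z * b i\<close> in powers of
    \<theta>, exchange the sums, and collect the expansion of \<open>\<theta> ^ j\<close> in the
    basis \<open>b\<close>.\<close>
  also have "\<dots> = (\<Sum>i<e. \<Sum>j<d. power_coord (z * b i) j * ext_coords \<kappa> (\<theta> ^ j) $ i)"
  proof (rule sum.cong)
    fix i assume "i \<in> {..<e}"
    then show "ext_coords \<kappa> (z * b i) $ i = (\<Sum>j<d. power_coord (z * b i) j * ext_coords \<kappa> (\<theta> ^ j) $ i)"
      using ext_coords_sum[of i "{..<d}" "power_coord (z * b i)" "\<lambda>j. \<theta> ^ j"] at_sum_coeffs[of "lift (z * b i)"]
      by (simp add: power_coord_def at_lift)
  qed simp
  also have "\<dots> = (\<Sum>j<d. \<Sum>i<e. ext_coords \<kappa> (\<theta> ^ j) $ i * power_coord (z * b i) j)"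
    by (subst sum.swap) (simp add: mult.commute)
  also have "\<dots> = (\<Sum>j<d. power_coord (z * \<theta> ^ j) j)"
  proof (rule sum.cong)
    fix j
    have "z * \<theta> ^ j = (\<Sum>i<e. \<kappa> (ext_coords \<kappa> (\<theta> ^ j) $ i) * (z * b i))"
      by (subst ext_coords(2)[of "\<theta> ^ j"]) (simp add: sum_distrib_left mult_ac)
    then show "(\<Sum>i<e. ext_coords \<kappa> (\<theta> ^ j) $ i * power_coord (z * b i) j) = power_coord (z * \<theta> ^ j) j"
      by (simp add: power_coord_sum)
  qed simp
  also have "\<dots> = (\<Sum>j<d. coeff ((q * monom 1 j) mod m) j)"
    unfolding power_coord_at[symmetric] eval_simps z_def by simp
  also have "\<dots> = top_coeff m (q * pderiv m)"
    by (rule trace_eq_top_coeff[OF monic_m degree_m])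
  finally show ?thesis unfolding z_def .
qed

lemma field_trace_linear:
  "tr (u + v) = tr u + tr v"
  "tr (\<kappa> c * u) = c * tr u"
proof -
  have "u + v = evt (lift u + lift v)" "\<kappa> c * u = evt (Polynomial.smult c (lift u))"
    by (simp_all add: eval_simps at_lift)
  then show "tr (u + v) = tr u + tr v"
    "tr (\<kappa> c * u) = c * tr u"
    by (simp_all only: field_trace_at distrib_right mult_smult_left poly_functionalD[OF top_coeff_functional])
      (simp_all add: field_trace_at[symmetric] at_lift)
qed

lemma field_trace_simps:
  "tr 0 = 0" "tr (- u) = - tr u"
  "tr (sum h S) = (\<Sum>i\<in>S. tr (h i))"
proof -
  show 0: "tr 0 = 0" using field_trace_linear(2)[of 0 0] by simp
  show "tr (- u) = - tr u"
    using field_trace_linear(1)[of u "- u"] 0 by (simp add: eq_neg_iff_add_eq_0 add.commute)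
  show "tr (sum h S) = (\<Sum>i\<in>S. tr (h i))"
    by (induction S rule: infinite_finite_induct) (simp_all add: 0 field_trace_linear)
qed

text \<open>By Euler's formula the trace form is the top coefficient form twisted by m'(\<theta>), a
  unit by separability.\<close>

lemma field_trace_nondegenerate:
  assumes "\<And>v. tr (u * v) = 0"
  shows "u = 0"
proof -
  have "top_coeff m ((lift u * pderiv m) * v) = 0" for v
    using assms[of "evt v"] field_trace_at[of "lift u * v"] by (simp add: eval_simps at_lift mult_ac)
  then have "m dvd lift u * pderiv m" by (rule top_coeff_nondegenerate[OF monic_m degree_m])
  then have "evt (lift u * pderiv m) = 0" using min_poly by blast
  then show ?thesis using separable by (simp add: eval_simps at_lift)
qed

lemma trace_form: "subquotient_form \<kappa> UNIV {0} (\<lambda>u v. tr (c * u * v))"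
proof unfold_locales
  fix u v w :: 'k and a
  show "tr (c * (u + v) * w) = tr (c * u * w) + tr (c * v * w)"
    by (simp add: distrib_left distrib_right field_trace_linear)
  show "tr (c * (\<kappa> a * u) * w) = a * tr (c * u * w)"
    using field_trace_linear(2)[of a "c * u * w"] by (simp add: mult_ac)
  show "tr (c * u * w) = tr (c * w * u)" by (simp add: mult_ac)
  show "u \<in> {0} \<Longrightarrow> tr (c * u * w) = 0" by (simp add: field_trace_simps)
qed

lemma trace_form_nondegenerate:
  assumes "c \<noteq> 0" "\<And>v. tr (c * v * u) = 0"
  shows "u = 0"
  using field_trace_nondegenerate[of "c * u"] assms by (simp add: mult_ac)

text \<open>The coefficients of \<open>b'\<close> come from the inverse Gram matrix of the trace
  form. The first identity is what contracts a product of matrices of traces to a matrix of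
  traces.\<close>

lemma dual_basis:
  obtains b' where "\<And>u v. (\<Sum>s<e. tr (u * b s) * tr (b' s * v)) = tr (u * v)"
    "\<And>i j. i < e \<Longrightarrow> j < e \<Longrightarrow> tr (b' i * b j) = (if i = j then 1 else 0)"
proof -
  interpret tf: subquotient_form \<kappa> UNIV "{0}" "\<lambda>u v. tr (1 * u * v)" by (rule trace_form)
  define T where "T = tf.gram (ext_basis \<kappa>)"
  have cT: "T \<in> carrier_mat e e" unfolding T_def tf.gram_def by simp
  have T: "T $$ (i, j) = tr (b i * b j)" if "i < e" "j < e" for i j
    unfolding T_def tf.gram_def using that by simp
  have "nondeg_sym T" unfolding T_def
    by (rule tf.nondeg_sym_gram[OF ext_basis]) (use trace_form_nondegenerate[of 1] in auto)
  then obtain N where N: "N \<in> carrier_mat e e" "N * T = 1\<^sub>m e"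
    using nondeg_sym_dest(4) invertible_mat_iff[OF cT] by blast
  define b' where "b' s = (\<Sum>k<e. \<kappa> (N $$ (s, k)) * b k)" for s
  have dual: "tr (b' i * b j) = (if i = j then 1 else 0)" if "i < e" "j < e" for i j
  proof -
    have "tr (b' i * b j) = (\<Sum>k<e. N $$ (i, k) * tr (b k * b j))"
      by (simp add: b'_def sum_distrib_right mult.assoc field_trace_simps(3) field_trace_linear)
    also have "\<dots> = (N * T) $$ (i, j)"
      using that N(1) cT by (simp add: T scalar_prod_def atLeast0LessThan)
    finally show ?thesis unfolding N(2) using that by simp
  qed
  have "(\<Sum>s<e. tr (u * b s) * tr (b' s * v)) = tr (u * v)" for u v
  proof -
    let ?c = "\<lambda>i. ext_coords \<kappa> v $ i"
    have "tr (b' s * v) = ?c s" if "s < e" for s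
    proof -
      have "tr (b' s * v) = tr (\<Sum>i<e. \<kappa> (?c i) * (b' s * b i))"
        by (subst ext_coords(2)[of v]) (simp add: sum_distrib_left mult_ac)
      also have "\<dots> = ?c s" using that by (simp add: field_trace_simps(3) field_trace_linear dual if_distrib cong: if_cong)
      finally show ?thesis .
    qed
    then have "(\<Sum>s<e. tr (u * b s) * tr (b' s * v)) = (\<Sum>s<e. ?c s * tr (u * b s))"
      by (intro sum.cong) auto
    also have "\<dots> = tr (\<Sum>i<e. \<kappa> (?c i) * (u * b i))"
      by (simp add: field_trace_simps(3) field_trace_linear)
    also have "(\<Sum>i<e. \<kappa> (?c i) * (u * b i)) = u * v"
      by (subst (2) ext_coords(2)[of v]) (simp add: sum_distrib_left mult_ac)
    finally show ?thesis .
  qed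
  then show ?thesis using that dual by blast
qed

end

section \<open>The transfer on Grothendieck--Witt groups\<close>

lemma to_completion_eq_iff: "to_completion a = to_completion b \<longleftrightarrow> (\<exists>c. a + c = b + c)"
  by transfer (simp add: completion_rel_def)

lemma completion_diff: "abs_group_completion (p, q) = to_completion p - to_completion q"
  unfolding diff_conv_add_uminus by transfer (simp add: completion_rel_def)

text \<open>\<open>completion_map\<close> uses a chosen representative (p', q'). Two representatives
  of one class agree only after adding a stabilizing summand, which an additive \<open>h\<close>
  carries along.\<close>

lemma completion_map_diff:
  assumes h: "\<And>a b. h (a + b) = h a + h b"
  shows "completion_map h (to_completion p - to_completion q) = to_completion (h p) - to_completion (h q)"
proof -
  define u where "u = to_completion p - to_completion q"
  obtain p' q' where r: "rep_group_completion u = (p', q')" by (cases "rep_group_completion u")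
  then have "u = to_completion p' - to_completion q'"
    using Quotient3_abs_rep[OF Quotient3_group_completion, of u] by (simp add: completion_diff)
  then have "to_completion (p' + q) = to_completion (p + q')"
    unfolding u_def by (simp add: to_completion_add algebra_simps)
  then obtain c where "p' + q + c = p + q' + c" unfolding to_completion_eq_iff by blast
  from arg_cong[OF this, of h] have "to_completion (h p' + h q) = to_completion (h p + h q')"
    unfolding to_completion_eq_iff h by blast
  then show ?thesis
    unfolding u_def[symmetric] completion_map_def r by (simp add: to_completion_add algebra_simps)
qed

lemma completion_map_add:
  assumes h: "\<And>a b. h (a + b) = h a + h b"
  shows "completion_map h (u + v) = completion_map h u + completion_map h v"
proof -
  have "\<exists>p q. w = to_completion p - to_completion q" for w :: "'a group_completion"
    by (metis Quotient3_abs_rep[OF Quotient3_group_completion] completion_diff surj_pair)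
  then obtain p q p' q' where u: "u = to_completion p - to_completion q"
    and v: "v = to_completion p' - to_completion q'" by metis
  have "u + v = to_completion (p + p') - to_completion (q + q')"
    by (simp add: u v to_completion_add)
  then show ?thesis by (simp only: u v completion_map_diff[OF h]) (simp add: h to_completion_add)
qed

lemma completion_map_to_completion:
  assumes h: "\<And>a b. h (a + b) = h a + h b" "h 0 = 0"
  shows "completion_map h (to_completion p) = to_completion (h p)"
proof -
  have "to_completion (0 :: 'a) = 0" "to_completion (0 :: 'b) = 0" by (transfer, simp add: completion_rel_def)+
  then show ?thesis using completion_map_diff[OF h(1), of p 0] h(2) by simp
qed

lemma isometry_class_cases:
  obtains A where "nondeg_sym A" "c = abs_isometry_class A"
  using Quotient3_abs_rep[OF Quotient3_isometry_class, of c]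
    Quotient3_rep_reflp[OF Quotient3_isometry_class, of c] unfolding isometric_def by metis

section \<open>Restriction of scalars for Gram matrices\<close>

context simple_extension
begin

text \<open>\<open>trace_mat\<close> is the case \<open>u = v = b\<close>. Two independent families
  are allowed because with a dual family on one side \<open>blk\<close> becomes multiplicative, so
  it also describes matrices of linear maps and inverses.\<close>

definition blk :: "'k mat \<Rightarrow> (nat \<Rightarrow> 'k) \<Rightarrow> (nat \<Rightarrow> 'k) \<Rightarrow> 'a mat" where
  "blk M u v = mat (dim_row M * e) (dim_col M * e)
     (\<lambda>(i, j). tr (M $$ (i div e, j div e) * u (i mod e) * v (j mod e)))"

lemma blk_mult:
  assumes dual: "\<And>x y. (\<Sum>s<e. tr (x * c s) * tr (c' s * y)) = tr (x * y)"
    and M: "M \<in> carrier_mat n n'" and N: "N \<in> carrier_mat n' n''"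
  shows "blk M u c * blk N c' v = blk (M * N) u v"
proof (rule eq_matI)
  fix i j assume "i < dim_row (blk (M * N) u v)" "j < dim_col (blk (M * N) u v)"
  then have ij: "i < n * e" "j < n'' * e" using M N by (auto simp: blk_def)
  have lt: "i div e < n" "j div e < n''"
    using ij by (simp_all add: less_mult_imp_div_less)
  have "(blk M u c * blk N c' v) $$ (i, j) = (\<Sum>k<n' * e. (blk M u c) $$ (i, k) * (blk N c' v) $$ (k, j))"
    using ij M N by (simp add: blk_def scalar_prod_def atLeast0LessThan)
  also have "\<dots> = (\<Sum>k<n' * e. (\<lambda>r s. tr ((M $$ (i div e, r) * u (i mod e)) * c s)
      * tr (c' s * (N $$ (r, j div e) * v (j mod e)))) (k div e) (k mod e))"
    using ij M N by (intro sum.cong) (auto simp: blk_def mult_ac)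
  also have "\<dots> = (\<Sum>r<n'. \<Sum>s<e. tr ((M $$ (i div e, r) * u (i mod e)) * c s)
      * tr (c' s * (N $$ (r, j div e) * v (j mod e))))"
    by (rule sum_div_mod)
  also have "\<dots> = tr (\<Sum>r<n'. (M $$ (i div e, r) * u (i mod e)) * (N $$ (r, j div e) * v (j mod e)))"
    unfolding dual field_trace_simps(3) ..
  also have "(\<Sum>r<n'. (M $$ (i div e, r) * u (i mod e)) * (N $$ (r, j div e) * v (j mod e)))
      = (M * N) $$ (i div e, j div e) * u (i mod e) * v (j mod e)"
    using lt M N by (simp add: scalar_prod_def atLeast0LessThan sum_distrib_right sum_distrib_left mult_ac)
  finally show "(blk M u c * blk N c' v) $$ (i, j) = blk (M * N) u v $$ (i, j)"
    using ij M N by (simp add: blk_def)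
qed (use M N in \<open>auto simp: blk_def\<close>)

lemma trace_mat_blk: "M \<in> carrier_mat n n \<Longrightarrow> trace_mat \<kappa> M = blk M b b"
  unfolding trace_mat_def blk_def Let_def by auto

lemma blk_one:
  assumes "\<And>i j. i < e \<Longrightarrow> j < e \<Longrightarrow> tr (u i * v j) = (if i = j then 1 else 0)"
  shows "blk (1\<^sub>m n) u v = 1\<^sub>m (n * e)"
proof (rule eq_matI)
  fix i j assume "i < dim_row (1\<^sub>m (n * e) :: 'a mat)" "j < dim_col (1\<^sub>m (n * e) :: 'a mat)"
  then have ij: "i < n * e" "j < n * e" by auto
  then have "e > 0" by (cases e) auto
  have "(i div e = j div e \<and> i mod e = j mod e) = (i = j)"
    using div_mult_mod_eq[of i e] div_mult_mod_eq[of j e] by metis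
  then show "blk (1\<^sub>m n) u v $$ (i, j) = 1\<^sub>m (n * e) $$ (i, j)"
    using ij \<open>e > 0\<close> assms[of "i mod e" "j mod e"]
    by (auto simp: blk_def less_mult_imp_div_less field_trace_simps)
qed (auto simp: blk_def)

lemma blk_transpose: "transpose_mat (blk M u v) = blk M\<^sup>T v u"
  by (intro eq_matI) (auto simp: blk_def less_mult_imp_div_less mult_ac)

text \<open>If \<open>C\<close> inverts \<open>A\<close>, then \<open>blk C b' b'\<close> inverts
  \<open>blk A b b\<close>, and a congruence \<open>P\<close> over k becomes the congruence
  \<open>blk P b' b\<close> over F. Hence the trace preserves nondegeneracy and descends to isometry
  classes.\<close>

lemma trace_mat_isometric:
  assumes "isometric A B"
  shows "isometric (trace_mat \<kappa> A) (trace_mat \<kappa> B)"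
proof -
  define n where "n = dim_row A"
  obtain P where P: "P \<in> carrier_mat n n" "invertible_mat P" "B = P\<^sup>T * A * P"
    and A: "nondeg_sym A"
    unfolding n_def using assms by (rule isometricE)
  have cA: "A \<in> carrier_mat n n" unfolding n_def by (rule nondeg_sym_dest(1)[OF A])
  have cB: "B \<in> carrier_mat n n" unfolding P(3) using P(1) cA by simp
  obtain Q where Q: "Q \<in> carrier_mat n n" "P * Q = 1\<^sub>m n"
    using P invertible_mat_iff by blast
  obtain C where C: "C \<in> carrier_mat n n" "A * C = 1\<^sub>m n"
    using nondeg_sym_dest(4)[OF A] invertible_mat_iff[OF cA] by blast
  obtain b' where b': "\<And>u v. (\<Sum>s<e. tr (u * b s) * tr (b' s * v)) = tr (u * v)"
    "\<And>i j. i < e \<Longrightarrow> j < e \<Longrightarrow> tr (b' i * b j) = (if i = j then 1 else 0)"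
    by (rule dual_basis) blast
  have b'': "(\<Sum>s<e. tr (u * b' s) * tr (b s * v)) = tr (u * v)" for u v
    using b'(1)[of v u] by (simp add: mult.commute)
  have one: "blk (1\<^sub>m n) b' b = 1\<^sub>m (n * e)" "blk (1\<^sub>m n) b b' = 1\<^sub>m (n * e)"
  proof -
    show "blk (1\<^sub>m n) b' b = 1\<^sub>m (n * e)" by (rule blk_one) (rule b'(2))
    have "tr (b i * b' j) = (if i = j then 1 else 0)" if "i < e" "j < e" for i j
      unfolding mult.commute[of "b i" "b' j"] b'(2)[OF that(2,1)] by auto
    then show "blk (1\<^sub>m n) b b' = 1\<^sub>m (n * e)" by (rule blk_one)
  qed
  have c: "blk M u v \<in> carrier_mat (n * e) (n * e)" if "M \<in> carrier_mat n n" for M u v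
    using that by (auto simp: blk_def)
  have tA: "trace_mat \<kappa> A = blk A b b" and tB: "trace_mat \<kappa> B = blk B b b"
    using trace_mat_blk cA cB by auto
  have "blk A b b * blk C b' b' = 1\<^sub>m (n * e)"
    using blk_mult[OF b'(1) cA C(1)] C(2) one by simp
  then have "invertible_mat (blk A b b)" by (rule invertible_matI[OF c c, OF cA C(1)])
  then have nA: "nondeg_sym (trace_mat \<kappa> A)"
    unfolding tA by (intro nondeg_symI[OF c[OF cA]]) (simp_all only: blk_transpose nondeg_sym_dest(3)[OF A])
  have "blk P b' b * blk Q b' b = 1\<^sub>m (n * e)"
    using blk_mult[OF b'(1) P(1) Q(1)] Q(2) one by simp
  then have "invertible_mat (blk P b' b)" by (rule invertible_matI[OF c c, OF P(1) Q(1)])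
  moreover have "blk B b b = transpose_mat (blk P b' b) * blk A b b * blk P b' b"
  proof -
    have tP: "P\<^sup>T \<in> carrier_mat n n" "P\<^sup>T * A \<in> carrier_mat n n" using P(1) cA by auto
    show ?thesis
      unfolding blk_transpose P(3) blk_mult[OF b'' tP(1) cA] blk_mult[OF b'(1) tP(2) P(1)] ..
  qed
  ultimately show ?thesis
    using nA unfolding tA tB by (intro isometricI[OF _ c[OF cA] c[OF P(1)]])
qed

lemma trace_mat_nondeg: "nondeg_sym A \<Longrightarrow> nondeg_sym (trace_mat \<kappa> A)"
  using trace_mat_isometric[OF isometric_refl] by (simp add: isometric_def)

text \<open>An equality rather than an isometry: in the product basis the standard basis supplies
  the major index, so the first \<open>n * e\<close> indices are exactly those of
  \<open>A\<close>.\<close>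

lemma trace_mat_orth_sum:
  assumes "A \<in> carrier_mat n n" "B \<in> carrier_mat n' n'"
  shows "trace_mat \<kappa> (orth_sum A B) = orth_sum (trace_mat \<kappa> A) (trace_mat \<kappa> B)"
proof (rule eq_matI)
  have t: "trace_mat \<kappa> (orth_sum A B) = blk (orth_sum A B) b b" "trace_mat \<kappa> A = blk A b b" "trace_mat \<kappa> B = blk B b b"
    using trace_mat_blk orth_sum_carrier assms by blast+
  have c: "orth_sum A B \<in> carrier_mat (n + n') (n + n')" using orth_sum_carrier assms by blast
  show "dim_row (trace_mat \<kappa> (orth_sum A B)) = dim_row (orth_sum (trace_mat \<kappa> A) (trace_mat \<kappa> B))"
    "dim_col (trace_mat \<kappa> (orth_sum A B)) = dim_col (orth_sum (trace_mat \<kappa> A) (trace_mat \<kappa> B))"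
    unfolding t using assms c by (auto simp: blk_def orth_sum_def distrib_right)
  fix i j assume "i < dim_row (orth_sum (trace_mat \<kappa> A) (trace_mat \<kappa> B))" "j < dim_col (orth_sum (trace_mat \<kappa> A) (trace_mat \<kappa> B))"
  then have ij: "i < n * e + n' * e" "j < n * e + n' * e"
    unfolding t using assms by (auto simp: blk_def orth_sum_def)
  then have e: "e > 0" by (cases e) auto
  have div: "(k < n * e) = (k div e < n)" "k div e < n + n'" if "k < n * e + n' * e" for k
    using that div_less_iff_less_mult[OF e, of k n] div_less_iff_less_mult[OF e, of k "n + n'"]
    by (simp_all only: distrib_right)
  have sub: "(k - n * e) div e = k div e - n" "(k - n * e) mod e = k mod e" if "\<not> k < n * e" for k
  proof -
    define k' where "k' = k - n * e"
    have k': "k = n * e + k'" using that by (simp add: k'_def)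
    show "(k - n * e) div e = k div e - n" "(k - n * e) mod e = k mod e" unfolding k' using e by simp_all
  qed
  have os: "orth_sum X Y $$ (k, k') = (if k < p then if k' < p then X $$ (k, k') else 0
      else if k' < p then 0 else Y $$ (k - p, k' - p))"
    if "X \<in> carrier_mat p p" "Y \<in> carrier_mat q q" "k < p + q" "k' < p + q" for X Y :: "'z::field mat" and p q k k'
    using that by (simp add: orth_sum_def)
  have cA: "blk A b b \<in> carrier_mat (n * e) (n * e)" and cB: "blk B b b \<in> carrier_mat (n' * e) (n' * e)"
    using assms by (auto simp: blk_def)
  have entry: "blk M b b $$ (k, k') = tr (M $$ (k div e, k' div e) * b (k mod e) * b (k' mod e))"
    if "M \<in> carrier_mat p p" "k < p * e" "k' < p * e" for M p k k'
    using that by (simp add: blk_def)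
  have ij': "i < (n + n') * e" "j < (n + n') * e" using ij by (simp_all add: distrib_right)
  have lt: "k - n * e < n' * e" if "k < n * e + n' * e" "\<not> k < n * e" for k using that by linarith
  show "trace_mat \<kappa> (orth_sum A B) $$ (i, j) = orth_sum (trace_mat \<kappa> A) (trace_mat \<kappa> B) $$ (i, j)"
    unfolding t entry[OF c ij'] os[OF cA cB ij] os[OF assms div(2)[OF ij(1)] div(2)[OF ij(2)]]
      div(1)[OF ij(1), symmetric] div(1)[OF ij(2), symmetric]
    using entry[OF assms(1), of i j] entry[OF assms(2), of "i - n * e" "j - n * e"]
      sub[of i] sub[of j] lt[OF ij(1)] lt[OF ij(2)]
    by (cases "i < n * e"; cases "j < n * e") (simp_all add: field_trace_simps)
qed

definition trace_class :: "'k isometry_class \<Rightarrow> 'a isometry_class" where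
  "trace_class c = abs_isometry_class (trace_mat \<kappa> (rep_isometry_class c))"

lemma trace_class_abs:
  assumes "nondeg_sym A"
  shows "trace_class (abs_isometry_class A) = abs_isometry_class (trace_mat \<kappa> A)"
  unfolding trace_class_def
  by (rule Quotient3_rel_abs[OF Quotient3_isometry_class trace_mat_isometric[OF
        Quotient3_rep_abs[OF Quotient3_isometry_class isometric_refl[OF assms]]]])

lemma trace_class_add: "trace_class (c + c') = trace_class c + trace_class c'"
proof -
  obtain A B where A: "nondeg_sym A" "c = abs_isometry_class A" and B: "nondeg_sym B" "c' = abs_isometry_class B"
    using isometry_class_cases by metis
  note dims = nondeg_sym_dest(1)[OF A(1)] nondeg_sym_dest(1)[OF B(1)]
  show ?thesis
    unfolding A(2) B(2) plus_isometry_class.abs_eq[OF isometric_refl isometric_refl, OF A(1) B(1)]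
      trace_class_abs[OF nondeg_sym_orth_sum, OF A(1) B(1)] trace_class_abs[OF A(1)] trace_class_abs[OF B(1)]
      plus_isometry_class.abs_eq[OF isometric_refl isometric_refl, OF trace_mat_nondeg trace_mat_nondeg, OF A(1) B(1)]
      trace_mat_orth_sum[OF dims] ..
qed

lemma trace_class_zero: "trace_class 0 = 0"
proof -
  have "trace_mat \<kappa> (0\<^sub>m 0 0) = 0\<^sub>m 0 0" unfolding trace_mat_def Let_def by (intro eq_matI) auto
  then show ?thesis unfolding zero_isometry_class.abs_eq trace_class_abs[OF nondeg_sym_empty] by simp
qed

lemma gw_trace_eq: "gw_trace \<kappa> = completion_map trace_class"
  unfolding gw_trace_def trace_class_def[abs_def] ..

lemma gw_trace_add: "gw_trace \<kappa> (u + v) = gw_trace \<kappa> u + gw_trace \<kappa> v"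
  unfolding gw_trace_eq by (rule completion_map_add[OF trace_class_add])

lemma gw_trace_class:
  assumes "nondeg_sym A"
  shows "gw_trace \<kappa> (gw_class A) = gw_class (trace_mat \<kappa> A)"
  unfolding gw_class_def gw_trace_eq completion_map_to_completion[OF trace_class_add trace_class_zero]
    trace_class_abs[OF assms] ..

lemma nondeg_sym_unit:
  fixes c :: "'f::field"
  assumes "c \<noteq> 0"
  shows "nondeg_sym (mat 1 1 (\<lambda>_. c))"
proof -
  have "mat 1 1 (\<lambda>_. c) = c \<cdot>\<^sub>m 1\<^sub>m 1" by (intro eq_matI) auto
  then show ?thesis using nondeg_sym_smult_one[OF assms] by metis
qed

text \<open>The basis of multiples s \<theta>^i puts the square of \<open>s\<close> into the form,
  and Euler's formula turns the trace into the top coefficient at the cost of the factor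
  m'(\<theta>). Together they account for \<open>w\<close>.\<close>

lemma gw_trace_unit:
  assumes c: "c \<noteq> 0" and w: "evt w = c * s * s * evt (pderiv m)" "s \<noteq> 0"
  defines "C \<equiv> mat d d (\<lambda>(i, j). top_coeff m (w * monom 1 i * monom 1 j))"
  shows "nondeg_sym C" "gw_trace \<kappa> (gw_unit c) = gw_class C"
proof -
  interpret tf: subquotient_form \<kappa> UNIV "{0}" "\<lambda>u v. tr (c * u * v)" by (rule trace_form)
  let ?pb = "map (\<lambda>i. s * \<theta> ^ i) [0..<d]"
  have basis: "basis_mod \<kappa> UNIV {0} ?pb"
  proof (rule whole.basis_modI)
    let ?b = "map (\<lambda>i. \<theta> ^ i) [0..<d]"
    obtain co where co: "\<And>v. v \<in> UNIV \<Longrightarrow> v - (\<Sum>i<length ?b. \<kappa> (co v i) * ?b ! i) \<in> {0}"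
      and ind: "\<And>c i. (\<Sum>i<length ?b. \<kappa> (c i) * ?b ! i) \<in> {0} \<Longrightarrow> i < length ?b \<Longrightarrow> c i = 0"
      and "\<And>i. i < length ?b \<Longrightarrow> ?b ! i \<in> UNIV"
      by (rule whole.basis_modE[OF power_basis]) (rule that)
    have eq: "(\<Sum>i<length ?pb. \<kappa> (a i) * ?pb ! i) = s * (\<Sum>i<length ?b. \<kappa> (a i) * ?b ! i)" for a
      by (simp add: sum_distrib_left mult_ac)
    show "\<exists>a. v - (\<Sum>i<length ?pb. \<kappa> (a i) * ?pb ! i) \<in> {0}" for v
      unfolding eq using co[of "v / s"] w(2) by (intro exI[of _ "co (v / s)"]) (simp add: field_simps)
    show "a i = 0" if "(\<Sum>i<length ?pb. \<kappa> (a i) * ?pb ! i) \<in> {0}" "i < length ?pb" for a i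
      using that ind[of a i] w(2) unfolding eq by simp
  qed simp
  have "C = tf.gram ?pb"
  proof (rule eq_matI)
    fix i j assume "i < dim_row (tf.gram ?pb)" "j < dim_col (tf.gram ?pb)"
    then have ij: "i < d" "j < d" by (auto simp: tf.gram_def)
    define q where "q = lift (c * (s * \<theta> ^ i) * (s * \<theta> ^ j))"
    have "evt (q * pderiv m) = evt (w * monom 1 i * monom 1 j)"
      unfolding eval_simps q_def at_lift w(1) by (simp add: mult_ac)
    then have "top_coeff m (w * monom 1 i * monom 1 j) = top_coeff m (q * pderiv m)"
      using eq_mod_m top_coeff_mod by metis
    also have "\<dots> = tr (c * (s * \<theta> ^ i) * (s * \<theta> ^ j))"
      unfolding field_trace_at[symmetric] q_def at_lift ..
    finally show "C $$ (i, j) = tf.gram ?pb $$ (i, j)" using ij by (simp add: C_def tf.gram_def)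
  qed (auto simp: C_def tf.gram_def)
  moreover have nd: "nondeg_sym (tf.gram ?pb)"
    by (rule tf.nondeg_sym_gram[OF basis]) (use trace_form_nondegenerate[OF c] in auto)
  ultimately show "nondeg_sym C" by simp
  have "trace_mat \<kappa> (mat 1 1 (\<lambda>_. c)) = tf.gram (ext_basis \<kappa>)"
    unfolding trace_mat_def tf.gram_def by (intro eq_matI) (auto simp: Let_def)
  then have "gw_trace \<kappa> (gw_unit c) = gw_class (tf.gram (ext_basis \<kappa>))"
    unfolding gw_unit_def gw_trace_class[OF nondeg_sym_unit[OF c]] by simp
  also have "\<dots> = gw_class C"
    unfolding \<open>C = _\<close> by (rule gw_class_cong[OF isometric_sym[OF tf.gram_isometric[OF basis ext_basis nd], THEN isometric_sym, THEN isometric_sym]])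
  finally show "gw_trace \<kappa> (gw_unit c) = gw_class C" .
qed

text \<open>The plane is represented by its split Gram matrix instead of diag(1, -1): its trace then
  has zero diagonal blocks, hence a visible Lagrangian of dimension [k : F].\<close>

lemma gw_trace_hyperbolic:
  assumes two: "(2::'a) \<noteq> 0"
  shows "gw_trace \<kappa> gw_hyperbolic = hyp e"
proof -
  have two': "(2::'k) \<noteq> 0" using two hom_0_iff[of 2] hom_add[of 1 1] by auto
  let ?H = "four_block_mat (0\<^sub>m 1 1) (1\<^sub>m 1) (1\<^sub>m 1) (0\<^sub>m 1 1) :: 'k mat"
  note H = gw_class_hyperbolic[OF two', of 1]
  define T where "T = mat e e (\<lambda>(i, j). tr (b i * b j))"
  have index: "k div e = (if k < e then 0 else 1)" "k mod e = (if k < e then k else k - e)" if "k < e + e" for k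
    using that by (auto simp: le_mod_geq not_less intro: div_nat_eqI)
  have T: "trace_mat \<kappa> ?H = four_block_mat (0\<^sub>m e e) T T\<^sup>T (0\<^sub>m e e)"
    unfolding trace_mat_def Let_def
    by (intro eq_matI) (auto simp: T_def field_trace_simps index mult.commute)
  have "gw_trace \<kappa> gw_hyperbolic = gw_class (trace_mat \<kappa> ?H)"
    unfolding gw_trace_class[OF H(2), symmetric] H(1) by simp
  also have "\<dots> = hyp e"
    using trace_mat_nondeg[OF H(2)] unfolding T by (intro gw_class_metabolic[OF two]) (auto simp: T_def)
  finally show ?thesis .
qed

lemma length_ext_basis: "e = d"
proof -
  interpret tf: subquotient_form \<kappa> UNIV "{0}" "\<lambda>u v. tr (1 * u * v)" by (rule trace_form)
  let ?b = "map (\<lambda>i. \<theta> ^ i) [0..<d]"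
  have "e \<le> length ?b"
    by (rule tf.change_of_basis[OF ext_basis power_basis]) (rule right_inverse_dim)
  moreover have "length ?b \<le> e"
    by (rule tf.change_of_basis[OF power_basis ext_basis]) (rule right_inverse_dim)
  ultimately show ?thesis by simp
qed

lemma gw_trace_sum: "finite S \<Longrightarrow> gw_trace \<kappa> (sum h S) = (\<Sum>i\<in>S. gw_trace \<kappa> (h i))"
proof (induction S rule: finite_induct)
  case empty
  show ?case using gw_trace_add[of 0 0] by simp
qed (simp add: gw_trace_add)

lemma gw_trace_formula:
  assumes two: "(2::'a) \<noteq> 0" and c: "c \<noteq> 0" and w: "evt w = c * s * s * evt (pderiv m)" "s \<noteq> 0"
  defines "C \<equiv> mat d d (\<lambda>(i, j). top_coeff m (w * monom 1 i * monom 1 j))"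
  shows "gw_trace \<kappa> (hyp r + gw_unit c) = gw_class C + hyp (r * d)"
proof -
  have "(\<Sum>_<r. \<Sum>_<d. gw_hyperbolic) = (\<Sum>_<r * d. gw_hyperbolic :: 'a GW)"
    by (rule sum_div_mod[symmetric])
  then show ?thesis
    using gw_trace_unit(2)[OF c w] gw_trace_hyperbolic[OF two]
    by (simp add: gw_trace_add gw_trace_sum length_ext_basis C_def add.commute)
qed

end

section \<open>The Hasse Wronskian of the powers of a function\<close>

text \<open>Put \<open>E s = \<Sum>\<^sub>k D\<^sub>k s T\<^sup>k\<close>, which is multiplicative. Expanding \<open>E x\<^sup>j = (x + \<xi>)\<^sup>j\<close> binomially
  factors the Wronskian matrix into a lower triangular one, with diagonal \<open>(D\<^sub>1 x)\<^sup>i\<close>, and a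
  unipotent one.\<close>

lemma det_power_series_powers:
  fixes F :: "'l::field fps"
  shows "det (mat n n (\<lambda>(i, j). fps_nth (F ^ j) i)) = (fps_nth F 1) ^ (\<Sum>i<n. i)"
proof -
  define c where "c = fps_nth F 0"
  define \<xi> where "\<xi> = F - fps_const c"
  have \<xi>: "fps_nth \<xi> 0 = 0" "fps_nth \<xi> 1 = fps_nth F 1" by (simp_all add: \<xi>_def c_def)
  define A where "A = mat n n (\<lambda>(i, k). fps_nth (\<xi> ^ k) i)"
  define B where "B = mat n n (\<lambda>(k, j). of_nat (j choose k) * c ^ (j - k))"
  have cA: "A \<in> carrier_mat n n" and cB: "B \<in> carrier_mat n n" by (auto simp: A_def B_def)
  have "mat n n (\<lambda>(i, j). fps_nth (F ^ j) i) = A * B"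
  proof (rule eq_matI)
    fix i j assume "i < dim_row (A * B)" "j < dim_col (A * B)"
    then have ij: "i < n" "j < n" by (auto simp: A_def B_def)
    have "F ^ j = (\<xi> + fps_const c) ^ j" by (simp add: \<xi>_def)
    also have "\<dots> = (\<Sum>k\<le>j. fps_const (of_nat (j choose k) * c ^ (j - k)) * \<xi> ^ k)"
      by (simp add: binomial_ring fps_const_power fps_of_nat[symmetric] mult_ac flip: fps_const_mult)
    also have "\<dots> = (\<Sum>k<n. fps_const (of_nat (j choose k) * c ^ (j - k)) * \<xi> ^ k)"
      using ij by (intro sum.mono_neutral_left) (auto simp: binomial_eq_0)
    finally have "fps_nth (F ^ j) i = (\<Sum>k<n. fps_nth (\<xi> ^ k) i * (of_nat (j choose k) * c ^ (j - k)))"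
      by (simp add: fps_sum_nth mult_ac)
    then show "mat n n (\<lambda>(i, j). fps_nth (F ^ j) i) $$ (i, j) = (A * B) $$ (i, j)"
      using ij by (simp add: A_def B_def scalar_prod_def atLeast0LessThan)
  qed (auto simp: A_def B_def)
  moreover have "det A = (fps_nth F 1) ^ (\<Sum>i<n. i)"
  proof -
    have "det A = prod_list (diag_mat A)"
      by (rule det_lower_triangular[OF _ cA]) (simp add: A_def startsby_zero_power_prefix \<xi>)
    also have "\<dots> = (\<Prod>i<n. (fps_nth F 1) ^ i)"
      by (simp add: prod_list_diag_prod A_def startsby_zero_power_nth_same \<xi>(1) \<xi>(2)[simplified] atLeast0LessThan)
    finally show ?thesis by (simp add: power_sum)
  qed
  moreover have "det B = 1"
  proof -
    have "det B = prod_list (diag_mat B)"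
      by (rule det_upper_triangular[OF _ cB]) (auto simp: upper_triangular_def B_def binomial_eq_0)
    then show ?thesis by (simp add: prod_list_diag_prod B_def)
  qed
  ultimately show ?thesis using det_mult[OF cA cB] by simp
qed

lemma eval2_simps:
  assumes "comm_ring_hom h"
  shows "eval2 h X Y 0 = 0" (is ?P1) "eval2 h X Y 1 = 1" (is ?P2) "eval2 h X Y (A + B) = eval2 h X Y A + eval2 h X Y B" (is ?P3)
    "eval2 h X Y (A - B) = eval2 h X Y A - eval2 h X Y B" (is ?P4)
    "eval2 h X Y (- A) = - eval2 h X Y A" (is ?P5)
    "eval2 h X Y (A * B) = eval2 h X Y A * eval2 h X Y B" (is ?P6)
    "eval2 h X Y (A ^ n) = eval2 h X Y A ^ n" (is ?P7)
    "eval2 h X Y (pCons q A) = poly (map_poly h q) X + Y * eval2 h X Y A" (is ?P8)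
proof -
  interpret h: comm_ring_hom h by fact
  interpret g: comm_ring_hom "\<lambda>q. poly (map_poly h q) X"
    by unfold_locales (simp_all add: h.eval_simps)
  show ?P1 ?P2 ?P3 ?P4 ?P5 ?P6 ?P7 ?P8
    unfolding eval2_def by (rule g.eval_simps)+
qed

section \<open>Evaluation and Hasse derivatives on the affine curve\<close>

context hyperelliptic_curve
begin

abbreviation (input) powers :: "nat \<Rightarrow> 'l list" where "powers l \<equiv> map (\<lambda>j. x ^ j) [0..<Suc l]"

abbreviation (input) fn :: "'a poly poly \<Rightarrow> 'l" where "fn P \<equiv> eval2 \<iota> x y P"

lemmas eval2_hom = eval2_simps[OF comm_ring_hom_axioms]

lemma eval2_const: "fn [:A:] = ev A"
  by (simp add: eval2_pCons) (simp add: eval2_def)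

lemma eval2_linear: "fn [:[:0, a:], [:b:]:] = \<iota> a * x + \<iota> b * y"
  by (simp add: eval2_pCons ev_simps mult.commute) (simp add: eval2_def)

lemma eval2_jacobian:
  "fn (partial_X (curve_eq f) * partial_Y [:[:0, a:], [:b:]:] - partial_Y (curve_eq f) * partial_X [:[:0, a:], [:b:]:])
    = - (2 * \<iota> a * y + \<iota> b * ev (pderiv f))"
proof -
  have "partial_X (curve_eq f) = [:- pderiv f:]" "partial_Y (curve_eq f) = [:0, 2:]"
    "partial_Y [:[:0, a:], [:b:]:] = [:[:b:]:]" "partial_X [:[:0, a:], [:b:]:] = [:[:a:]:]"
    by (auto intro!: poly_eqI simp: partial_X_def curve_eq_def coeff_map_poly coeff_pCons pderiv_pCons pderiv_minus
      split: nat.splits)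
  then have "fn (partial_X (curve_eq f) * partial_Y [:[:0, a:], [:b:]:] - partial_Y (curve_eq f) * partial_X [:[:0, a:], [:b:]:])
    = fn ([:- pderiv f:] * [:[:b:]:] - [:0, 2:] * [:[:a:]:])"
    by simp
  also have "\<dots> = - (2 * \<iota> a * y + \<iota> b * ev (pderiv f))"
    unfolding eval2_hom ev_simps eval2_const
    using ev_simps(3)[of 1 1] by (simp add: ev_simps mult_ac)
  finally show ?thesis .
qed

lemma normal_form_at:
  assumes h: "comm_ring_hom h" and curve: "Y * Y = poly (map_poly h f) X"
  obtains A B where "fn P = ev A + ev B * y"
    "eval2 h X Y P = poly (map_poly h A) X + poly (map_poly h B) X * Y"
proof -
  interpret h: comm_ring_hom h by fact
  have "\<exists>A B. fn P = ev A + ev B * y \<and> eval2 h X Y P = poly (map_poly h A) X + poly (map_poly h B) X * Y"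
  proof (induction P)
    case 0
    show ?case
      by (intro exI[of _ 0]) (simp add: eval2_hom eval2_simps[OF h])
  next
    case (pCons c P)
    then obtain A B where "fn P = ev A + ev B * y"
      "eval2 h X Y P = poly (map_poly h A) X + poly (map_poly h B) X * Y" by blast
    then have "fn (pCons c P) = ev (c + B * f) + ev A * y \<and>
        eval2 h X Y (pCons c P) = poly (map_poly h (c + B * f)) X + poly (map_poly h A) X * Y"
      by (simp add: eval2_hom eval2_simps[OF h] ev_simps h.eval_simps
          y_square[symmetric] curve[symmetric] algebra_simps)
    then show ?case by blast
  qed
  then show ?thesis using that by blast
qed

text \<open>(x, y) is a generic point: the normal form modulo Y^2 - f(X) is unique there and is
  computed over F, so identities between functions hold at every point of the curve in every
  commutative ring. Used at the point (\<gamma>, 0) and at a point with power series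
  coordinates.\<close>

lemma specialization:
  assumes "comm_ring_hom h" "Y * Y = poly (map_poly h f) X" "fn P = fn Q"
  shows "eval2 h X Y P = eval2 h X Y Q"
proof -
  obtain A B where 1: "fn P = ev A + ev B * y"
    "eval2 h X Y P = poly (map_poly h A) X + poly (map_poly h B) X * Y"
    by (rule normal_form_at[OF assms(1,2)])
  obtain A' B' where 2: "fn Q = ev A' + ev B' * y"
    "eval2 h X Y Q = poly (map_poly h A') X + poly (map_poly h B') X * Y"
    by (rule normal_form_at[OF assms(1,2)])
  have "A = A'" "B = B'" using normal_form_unique[of A B A' B'] assms(3) 1 2 by auto
  then show ?thesis using 1 2 by simp
qed

lemma functions_on_closed:
  "u \<in> functions_on h \<Longrightarrow> v \<in> functions_on h \<Longrightarrow> u * v \<in> functions_on h"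
  "ev q \<in> functions_on h" "y \<in> functions_on h" "x \<in> functions_on h"
proof -
  show "ev q \<in> functions_on h"
    unfolding functions_on_def mem_Collect_eq by (rule exI[of _ "[:q:]"], rule exI[of _ 0]) (simp add: eval2_const)
  show "y \<in> functions_on h"
    unfolding functions_on_def mem_Collect_eq using eval2_linear[of 0 1]
    by (intro exI[of _ "[:[:0, 0:], [:1:]:]"] exI[of _ 0]) simp
  show "x \<in> functions_on h"
    unfolding functions_on_def mem_Collect_eq using eval2_linear[of 1 0]
    by (intro exI[of _ "[:[:0, 1:], [:0:]:]"] exI[of _ 0]) simp
  assume "u \<in> functions_on h" "v \<in> functions_on h"
  then obtain A n B k where "u = fn A / fn h ^ n" "v = fn B / fn h ^ k"
    unfolding functions_on_def by auto
  then have "u * v = fn (A * B) / fn h ^ (n + k)"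
    by (simp add: eval2_hom power_add)
  then show "u * v \<in> functions_on h" unfolding functions_on_def by blast
qed

text \<open>For the second claim, \<open>D 1\<close> is a derivation with value 1 on t; apply it to
  y^2 = f(x) and eliminate \<open>D 1 y\<close>. The factor of \<open>D 1 x\<close> is, up to sign,
  the Jacobian in \<open>etale_coordinate_on\<close>.\<close>

lemma hasse_wronskian_powers:
  assumes D: "hasse_derivatives (functions_on h) (\<iota> a * x + \<iota> b * y) D"
  shows "hasse_wronskian D (powers l) = D 1 x ^ (Suc l choose 2)"
    and "(2 * \<iota> a * y + \<iota> b * ev (pderiv f)) * D 1 x = 2 * y"
proof -
  let ?R = "functions_on h"
  have D_add: "D k (u + v) = D k u + D k v" if "u \<in> ?R" "v \<in> ?R" for k u v
    using D that unfolding hasse_derivatives_def by blast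
  have D_scale: "D k (\<iota> c * u) = \<iota> c * D k u" if "u \<in> ?R" for k u c
    using D that unfolding hasse_derivatives_def by blast
  have D_0: "D 0 u = u" if "u \<in> ?R" for u
    using D that unfolding hasse_derivatives_def by blast
  have D_mult: "D k (u * v) = (\<Sum>i\<le>k. D i u * D (k - i) v)" if "u \<in> ?R" "v \<in> ?R" for k u v
    using D that unfolding hasse_derivatives_def by blast
  have D_t: "D k ((\<iota> a * x + \<iota> b * y) ^ n) = of_nat (n choose k) * (\<iota> a * x + \<iota> b * y) ^ (n - k)" for k n
    using D unfolding hasse_derivatives_def by blast
  have D_1: "D k 1 = (if k = 0 then 1 else 0)" for k using D_t[of k 0] by (cases k) auto
  have R1: "1 \<in> ?R" using functions_on_closed(2)[of 1] by (simp add: ev_simps)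
  have Rc: "\<iota> c \<in> ?R" for c using functions_on_closed(2)[of "[:c:]"] by (simp add: ev_simps)
  note closed = functions_on_closed R1 Rc
  define F where "F = Abs_fps (\<lambda>k. D k x)"
  have xj: "x ^ j \<in> ?R" for j by (induction j) (auto intro: closed)
  have pow: "D i (x ^ j) = fps_nth (F ^ j) i" for i j
  proof (induction j arbitrary: i)
    case (Suc j)
    then show ?case by (simp add: D_mult closed xj fps_mult_nth F_def atLeast0AtMost)
  qed (simp add: D_1)
  have "mat (Suc l) (Suc l) (\<lambda>(i, j). D i (map (\<lambda>j. x ^ j) [0..<Suc l] ! j)) = mat (Suc l) (Suc l) (\<lambda>(i, j). fps_nth (F ^ j) i)"
    by (intro eq_matI) (auto simp: pow simp del: upt_Suc)
  then have "hasse_wronskian D (powers l) = (fps_nth F 1) ^ (\<Sum>i<Suc l. i)"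
    unfolding hasse_wronskian_def by (simp add: det_power_series_powers del: upt_Suc sum.lessThan_Suc)
  also have "(\<Sum>i<Suc l. i) = Suc l choose 2"
    using gauss_sum_nat[of l] by (simp add: choose_two atLeast0AtMost lessThan_Suc_atMost mult.commute)
  finally show "hasse_wronskian D (powers l) = D 1 x ^ (Suc l choose 2)" by (simp add: F_def)
  have D1_mult: "D 1 (u * v) = u * D 1 v + D 1 u * v" if "u \<in> ?R" "v \<in> ?R" for u v
    using that by (simp add: D_mult D_0)
  have D1_ev: "D 1 (ev q) = ev (pderiv q) * D 1 x" for q
  proof (induction q)
    case 0
    then show ?case using D_scale[of 1 1 0] R1 by (simp add: ev_simps)
  next
    case (pCons c q)
    have "D 1 (\<iota> c * 1 + x * ev q) = \<iota> c * D 1 1 + (x * D 1 (ev q) + D 1 x * ev q)"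
    proof -
      have "\<iota> c * 1 \<in> ?R" "x * ev q \<in> ?R" using closed by auto
      then show ?thesis using closed by (simp only: D_add D_scale D1_mult)
    qed
    then show ?case by (simp add: ev_simps pderiv_pCons D_1 pCons.IH algebra_simps del: One_nat_def)
  qed
  have "D 1 (y * y) = 2 * y * D 1 y" by (simp add: D1_mult closed del: One_nat_def)
  then have 1: "2 * y * D 1 y = ev (pderiv f) * D 1 x" unfolding y_square D1_ev by simp
  have "D 1 (\<iota> a * x + \<iota> b * y) = 1" using D_t[of 1 1] by simp
  then have 2: "\<iota> a * D 1 x + \<iota> b * D 1 y = 1" by (simp add: D_add D_scale closed del: One_nat_def)
  have "(2 * \<iota> a * y + \<iota> b * ev (pderiv f)) * D 1 x = 2 * y * (\<iota> a * D 1 x) + \<iota> b * (ev (pderiv f) * D 1 x)"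
    by (simp add: algebra_simps)
  also have "\<dots> = 2 * y * (\<iota> a * D 1 x + \<iota> b * D 1 y)" unfolding 1[symmetric] by (simp add: algebra_simps)
  finally show "(2 * \<iota> a * y + \<iota> b * ev (pderiv f)) * D 1 x = 2 * y" unfolding 2 by simp
qed

end

section \<open>The local ring at a ramification point\<close>

lemma (in field_hom) minimal_polynomial:
  assumes "q \<noteq> 0" "poly (map_poly hom q) z = 0"
  obtains m where "lead_coeff m = 1" "\<And>p. poly (map_poly hom p) z = 0 \<longleftrightarrow> m dvd p"
proof -
  define P where "P p \<longleftrightarrow> p \<noteq> 0 \<and> poly (map_poly hom p) z = 0" for p
  obtain p where p: "P p" and least: "\<And>r. P r \<Longrightarrow> degree p \<le> degree r"
  proof -
    have "P q" using assms by (simp add: P_def)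
    from ex_has_least_nat[of P q degree, OF this] show ?thesis using that by blast
  qed
  define m where "m = Polynomial.smult (inverse (lead_coeff p)) p"
  have p0: "p \<noteq> 0" "poly (map_poly hom p) z = 0" using p by (auto simp: P_def)
  have m: "lead_coeff m = 1" "m \<noteq> 0" "poly (map_poly hom m) z = 0" "degree m = degree p"
    using p0 unfolding m_def by (simp_all only: eval_simps) simp_all
  have 1: "m dvd r" if "poly (map_poly hom r) z = 0" for r
  proof -
    have 0: "poly (map_poly hom (r mod m)) z = 0"
      unfolding minus_mult_div_eq_mod[of r m, symmetric] eval_simps using that m(3) by simp
    have "r mod m = 0"
    proof (rule ccontr)
      assume "r mod m \<noteq> 0"
      then have "degree p \<le> degree (r mod m)" using least[of "r mod m"] 0 by (simp add: P_def)
      then show False using degree_mod_less[OF m(2), of r] \<open>r mod m \<noteq> 0\<close> m(4) by simp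
    qed
    then show ?thesis by (simp add: dvd_eq_mod_eq_0)
  qed
  have 2: "poly (map_poly hom r) z = 0" if dvd: "m dvd r" for r
  proof -
    obtain k where "r = m * k" by (rule dvdE[OF dvd])
    then show ?thesis using m(3) by (simp only: eval_simps mult_zero_left)
  qed
  show ?thesis by (rule that[OF m(1)]) (rule iffI, erule 1, erule 2)
qed

locale ramification_point = hyperelliptic_curve \<iota> x y f g + residue: field_hom \<kappa>
  for \<iota> :: "'a::field \<Rightarrow> 'l::field" and x y :: 'l and f :: "'a poly" and g :: nat
    and \<kappa> :: "'a \<Rightarrow> 'k::field" +
  fixes \<gamma> :: 'k
  assumes generates_residue: "\<And>z. \<exists>q. z = poly (map_poly \<kappa> q) \<gamma>"
    and ramified: "poly (map_poly \<kappa> f) \<gamma> = 0"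
begin

abbreviation (input) val :: "'a poly \<Rightarrow> 'k" where "val q \<equiv> poly (map_poly \<kappa> q) \<gamma>"

abbreviation R :: "'l set" where "R \<equiv> local_ring \<iota> x y \<kappa> \<gamma> 0"

abbreviation max_ideal :: "'l set" where "max_ideal \<equiv> local_max_ideal \<iota> x y \<kappa> \<gamma> 0"

abbreviation y_ideal :: "nat \<Rightarrow> 'l set" where "y_ideal n \<equiv> (\<lambda>s. y ^ n * s) ` R"

abbreviation (input) at0 :: "'a poly poly \<Rightarrow> 'k" where "at0 P \<equiv> eval2 \<kappa> \<gamma> 0 P"

lemmas eval2_residue = eval2_simps[OF residue.comm_ring_hom_axioms]

lemma two_nonzero: "(2::'a) \<noteq> 0" "(2::'k) \<noteq> 0" "(2::'l) \<noteq> 0"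
proof -
  show 1: "(2::'a) \<noteq> 0"
  proof
    assume "(2::'a) = 0"
    then have "of_nat 2 = (0::'a)" by simp
    then have "CHAR('a) dvd 2" by (simp only: of_nat_eq_0_iff_char_dvd)
    moreover have "k = Suc 0 \<or> k = 2" if "k dvd 2" for k :: nat
      using that two_is_prime_nat unfolding prime_nat_iff One_nat_def by blast
    ultimately show False using char_ne_2 CHAR_not_1' by blast
  qed
  have "\<kappa> 2 = 2" "\<iota> 2 = 2" using residue.hom_add[of 1 1] hom_add[of 1 1] by simp_all
  then show "(2::'k) \<noteq> 0" "(2::'l) \<noteq> 0" using 1 residue.hom_0_iff[of 2] hom_0_iff[of 2] by auto
qed

text \<open>At (\<gamma>, 0) the equation and its derivative 2Y in Y both vanish, so the unit ideal
  condition of smoothness leaves only the derivative in X.\<close>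

lemma pderiv_f_nonzero: "val (pderiv f) \<noteq> 0"
proof
  assume 0: "val (pderiv f) = 0"
  note ev2 = eval2_residue
  obtain p q r where "p * curve_eq f + q * partial_X (curve_eq f) + r * partial_Y (curve_eq f) = 1"
    using smooth unfolding smooth_affine_plane_curve_def by blast
  from arg_cong[OF this, of "eval2 \<kappa> \<gamma> 0"]
  have "at0 p * at0 (curve_eq f) + at0 q * at0 (partial_X (curve_eq f))
      + at0 r * at0 (partial_Y (curve_eq f)) = 1"
    by (simp only: ev2)
  moreover have "partial_X (curve_eq f) = [:- pderiv f:]" "partial_Y (curve_eq f) = [:0, 2:]"
    by (auto intro!: poly_eqI simp: partial_X_def curve_eq_def coeff_map_poly coeff_pCons pderiv_pCons pderiv_minus
      split: nat.splits)
  ultimately show False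
    using 0 ramified by (simp add: ev2 curve_eq_def residue.eval_simps)
qed

lemma f_nonzero: "f \<noteq> 0"
  using degree_f by auto

lemma y_nonzero: "y \<noteq> 0"
  using y_square ev_eq_iff[of f 0] f_nonzero by (auto simp: ev_simps)

lemma curve_at_point: "0 * 0 = val f"
  using ramified by simp

lemma fn_nonzero: "at0 Q \<noteq> 0 \<Longrightarrow> fn Q \<noteq> 0"
  using specialization[OF residue.comm_ring_hom_axioms curve_at_point, of Q 0]
  by (auto simp: eval2_hom eval2_residue)

lemma R_cases:
  assumes "r \<in> R"
  obtains P Q where "r = fn P / fn Q" "at0 Q \<noteq> 0"
  using assms unfolding local_ring_def by blast

text \<open>The residue map from R to k. All fractions for \<open>r\<close> give the same value,
  because \<open>specialization\<close> carries a cross-multiplied equality from L to k.\<close>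

definition res :: "'l \<Rightarrow> 'k" where
  "res r = (THE z. \<exists>P Q. r = fn P / fn Q \<and> at0 Q \<noteq> 0 \<and> z = at0 P / at0 Q)"

lemma quotient_in_R: "at0 Q \<noteq> 0 \<Longrightarrow> fn P / fn Q \<in> R"
  unfolding local_ring_def by blast

lemma res_quotient:
  assumes Q: "at0 Q \<noteq> 0"
  shows "res (fn P / fn Q) = at0 P / at0 Q"
  unfolding res_def
proof (rule the_equality)
  show "\<exists>P' Q'. fn P / fn Q = fn P' / fn Q' \<and> at0 Q' \<noteq> 0 \<and> at0 P / at0 Q = at0 P' / at0 Q'"
    using Q by blast
  fix z assume "\<exists>P' Q'. fn P / fn Q = fn P' / fn Q' \<and> at0 Q' \<noteq> 0 \<and> z = at0 P' / at0 Q'"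
  then obtain P' Q' where *: "fn P / fn Q = fn P' / fn Q'" "at0 Q' \<noteq> 0" "z = at0 P' / at0 Q'" by blast
  have "fn (P * Q') = fn (P' * Q)"
    using *(1) unfolding eval2_hom frac_eq_eq[OF fn_nonzero[OF Q] fn_nonzero[OF *(2)], symmetric] .
  from specialization[OF residue.comm_ring_hom_axioms curve_at_point this]
  have "at0 P * at0 Q' = at0 P' * at0 Q" by (simp only: eval2_residue)
  then show "z = at0 P / at0 Q" using frac_eq_eq[OF Q *(2), of "at0 P" "at0 P'"] *(3) by (simp only: simp_thms)
qed

lemma R_add: "r \<in> R \<Longrightarrow> s \<in> R \<Longrightarrow> r + s \<in> R" and R_mult: "r \<in> R \<Longrightarrow> s \<in> R \<Longrightarrow> r * s \<in> R"
  and res_add: "r \<in> R \<Longrightarrow> s \<in> R \<Longrightarrow> res (r + s) = res r + res s"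
  and res_mult: "r \<in> R \<Longrightarrow> s \<in> R \<Longrightarrow> res (r * s) = res r * res s"
proof -
  note ev2 = eval2_hom and res2 = eval2_residue
  assume "r \<in> R" "s \<in> R"
  then obtain P Q P' Q' where r: "r = fn P / fn Q" "at0 Q \<noteq> 0" and s: "s = fn P' / fn Q'" "at0 Q' \<noteq> 0"
    using R_cases by metis
  have nz: "fn Q \<noteq> 0" "fn Q' \<noteq> 0" "at0 (Q * Q') \<noteq> 0" using r(2) s(2) fn_nonzero by (auto simp: res2)
  have add: "r + s = fn (P * Q' + P' * Q) / fn (Q * Q')" using nz by (simp add: r(1) s(1) ev2 add_frac_eq)
  have mult: "r * s = fn (P * P') / fn (Q * Q')" by (simp add: r(1) s(1) ev2)
  show "r + s \<in> R" "r * s \<in> R" unfolding add mult by (rule quotient_in_R[OF nz(3)])+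
  show "res (r + s) = res r + res s" "res (r * s) = res r * res s"
    unfolding add mult res_quotient[OF nz(3)] unfolding r(1) s(1) res_quotient[OF r(2)] res_quotient[OF s(2)]
    using r(2) s(2) by (simp_all add: res2 add_frac_eq)
qed

lemma fn_in_R: "fn P \<in> R" and res_fn: "res (fn P) = at0 P"
  using quotient_in_R[of 1 P] res_quotient[of 1 P]
  by (simp_all add: eval2_hom eval2_residue)

lemma ev_in_R: "ev A \<in> R" and res_ev: "res (ev A) = val A"
  using fn_in_R[of "[:A:]"] res_fn[of "[:A:]"]
  by (simp_all add: eval2_hom eval2_residue)

lemma const_in_R: "\<iota> c \<in> R" and res_const: "res (\<iota> c) = \<kappa> c"
  using ev_in_R[of "[:c:]"] res_ev[of "[:c:]"] by (simp_all add: ev_simps residue.eval_simps)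

lemma x_in_R: "x \<in> R" and res_x: "res x = \<gamma>"
  using ev_in_R[of "[:0, 1:]"] res_ev[of "[:0, 1:]"] by (simp_all add: ev_simps residue.eval_simps)

lemma y_in_R: "y \<in> R" and res_y: "res y = 0"
  using fn_in_R[of "[:0, 1:]"] res_fn[of "[:0, 1:]"]
  by (simp_all add: eval2_hom eval2_residue ev_simps residue.eval_simps)

lemma one_in_R: "1 \<in> R" and res_one: "res 1 = 1" and zero_in_R: "0 \<in> R" and res_zero: "res 0 = 0"
  using const_in_R[of 1] res_const[of 1] const_in_R[of 0] res_const[of 0] by simp_all

lemma R_power: "r \<in> R \<Longrightarrow> r ^ n \<in> R" and res_power: "r \<in> R \<Longrightarrow> res (r ^ n) = res r ^ n"
proof -
  assume r: "r \<in> R"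
  have "r ^ n \<in> R \<and> res (r ^ n) = res r ^ n"
    by (induction n) (auto simp: one_in_R res_one R_mult res_mult r)
  then show "r ^ n \<in> R" "res (r ^ n) = res r ^ n" by auto
qed

lemma R_diff: "r \<in> R \<Longrightarrow> s \<in> R \<Longrightarrow> r - s \<in> R" and res_diff: "r \<in> R \<Longrightarrow> s \<in> R \<Longrightarrow> res (r - s) = res r - res s"
  using R_add[of r "\<iota> (-1) * s"] res_add[of r "\<iota> (-1) * s"] R_mult[of "\<iota> (-1)" s] res_mult[of "\<iota> (-1)" s]
    const_in_R[of "-1"] res_const[of "-1"] by (simp_all add: hom_distribs residue.hom_uminus)

lemma R_inverse: "r \<in> R \<Longrightarrow> res r \<noteq> 0 \<Longrightarrow> 1 / r \<in> R"
proof -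
  assume "r \<in> R" "res r \<noteq> 0"
  then obtain P Q where "r = fn P / fn Q" "at0 P \<noteq> 0" using R_cases res_quotient by (metis div_0)
  then show ?thesis using quotient_in_R[of P Q] by simp
qed

lemma res_inverse: "r \<in> R \<Longrightarrow> res r \<noteq> 0 \<Longrightarrow> res (1 / r) = 1 / res r"
proof -
  assume r: "r \<in> R" and nz: "res r \<noteq> 0"
  have "r \<noteq> 0" using nz res_zero by auto
  then have "res (1 / r) * res r = 1"
    using res_mult[OF R_inverse[OF r nz] r] by (simp add: res_one)
  then show ?thesis using nz by (simp add: field_simps)
qed

lemma ev_nonzero: "val C \<noteq> 0 \<Longrightarrow> ev C \<noteq> 0"
  using ev_eq_iff[of C 0] by (auto simp: ev_simps residue.eval_simps)

text \<open>The minimal polynomial of \<gamma> divides f exactly once, since f'(\<gamma>) is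
  nonzero; as f(x) = y^2, it therefore equals y^2 times a unit at x. This is ramification of index
  2.\<close>

lemma ev_vanishing:
  assumes "val A = 0"
  obtains w where "w \<in> R" "ev A = y * y * w"
proof -
  obtain \<mu> where \<mu>: "lead_coeff \<mu> = 1" "\<And>p. val p = 0 \<longleftrightarrow> \<mu> dvd p"
    using residue.minimal_polynomial[OF f_nonzero ramified] by blast
  obtain f1 where f1: "f = \<mu> * f1" using \<mu>(2) ramified by (auto simp: dvd_def)
  obtain A' where A': "A = \<mu> * A'" using \<mu>(2) assms by (auto simp: dvd_def)
  have "val \<mu> = 0" using \<mu>(2) by simp
  then have "val (pderiv f) = val (pderiv \<mu>) * val f1"
    by (simp add: f1 pderiv_mult residue.eval_simps)
  then have v: "val f1 \<noteq> 0" using pderiv_f_nonzero by auto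
  have "ev A * ev f1 = y * y * ev A'" by (simp add: y_square A' f1 ev_simps)
  then have "ev A = y * y * (ev A' * (1 / ev f1))" using ev_nonzero[OF v] by (simp add: field_simps)
  moreover have "ev A' * (1 / ev f1) \<in> R"
    using v by (intro R_mult R_inverse ev_in_R) (simp add: res_ev)
  ultimately show ?thesis using that by blast
qed

text \<open>y is a uniformizer: in a normal form A(x) + B(x) y that vanishes at the point, A(x) is
  even divisible by y^2.\<close>

lemma res_zero_cases:
  assumes "r \<in> R" "res r = 0"
  obtains s where "s \<in> R" "r = y * s"
proof -
  obtain P Q where r: "r = fn P / fn Q" "at0 Q \<noteq> 0" using assms(1) by (rule R_cases)
  obtain A B where AB: "fn P = ev A + ev B * y" "at0 P = val A + val B * 0"
    by (rule normal_form_at[OF residue.comm_ring_hom_axioms curve_at_point])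
  have "val A = 0" using assms(2) r AB(2) by (simp add: res_quotient)
  then obtain w where w: "w \<in> R" "ev A = y * y * w" by (rule ev_vanishing)
  have "r = y * ((y * w + ev B) * (1 / fn Q))" by (simp add: r AB(1) w algebra_simps add_divide_distrib)
  moreover have "(y * w + ev B) * (1 / fn Q) \<in> R"
    using r w by (intro R_mult R_add R_inverse ev_in_R y_in_R fn_in_R) (simp_all add: res_fn)
  ultimately show ?thesis using that by blast
qed

lemma local_max_ideal_eq: "max_ideal = (\<lambda>r. y * r) ` R"
proof (intro equalityI subsetI)
  fix r assume "r \<in> max_ideal"
  then obtain P Q where PQ: "r = fn P / fn Q" "at0 P = 0" "at0 Q \<noteq> 0"
    unfolding local_max_ideal_def by blast
  then have "r \<in> R" "res r = 0" by (auto simp: quotient_in_R res_quotient)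
  then show "r \<in> (\<lambda>r. y * r) ` R" using res_zero_cases by blast
next
  fix r assume "r \<in> (\<lambda>r. y * r) ` R"
  then obtain P Q where PQ: "r = y * (fn P / fn Q)" "at0 Q \<noteq> 0"
    unfolding local_ring_def by blast
  have "r = fn (pCons 0 P) / fn Q" "at0 (pCons 0 P) = 0"
    using PQ by (simp_all add: eval2_hom eval2_residue
      ev_simps residue.eval_simps)
  then show "r \<in> max_ideal" using PQ(2) unfolding local_max_ideal_def by blast
qed

lemma ideal_power_eq: "ideal_power R max_ideal n = y_ideal n"
proof (induction n)
  case (Suc n)
  have "(\<Sum>(u, v)\<leftarrow>zs. u * v) \<in> y_ideal (Suc n)"
    if "set zs \<subseteq> (\<lambda>r. y * r) ` R \<times> y_ideal n" for zs
    using that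
  proof (induction zs)
    case Nil
    then show ?case using zero_in_R by force
  next
    case (Cons z zs)
    then obtain r s where rs: "r \<in> R" "s \<in> R" "z = (y * r, y ^ n * s)" by auto
    obtain q where q: "q \<in> R" "(\<Sum>(u, v)\<leftarrow>zs. u * v) = y ^ Suc n * q" using Cons by auto
    have "(\<Sum>(u, v)\<leftarrow>z # zs. u * v) = y ^ Suc n * (r * s + q)" using rs q by (simp add: algebra_simps)
    then show ?case using rs q R_add R_mult by blast
  qed
  moreover have "\<exists>zs. y ^ Suc n * r = (\<Sum>(u, v)\<leftarrow>zs. u * v) \<and> set zs \<subseteq> (\<lambda>r. y * r) ` R \<times> y_ideal n"
    if "r \<in> R" for r
    using that one_in_R by (intro exI[of _ "[(y * 1, y ^ n * r)]"]) auto
  ultimately show ?case unfolding ideal_power.simps Suc unfolding local_max_ideal_eq by blast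
qed simp

text \<open>Stands in for the valuation of the local ring: an element with nonzero residue
  contributes nothing to the order in y.\<close>

lemma y_power_le:
  assumes "y ^ j * r = y ^ k * s" "r \<in> R" "s \<in> R" "res r \<noteq> 0"
  shows "k \<le> j"
proof (rule ccontr)
  assume "\<not> k \<le> j"
  then obtain i where i: "k = j + Suc i" by (metis less_imp_Suc_add not_le add_Suc_right)
  then have "r = y ^ Suc i * s" using assms(1) y_nonzero by (simp add: power_add mult.assoc)
  then have "res r = 0"
    using assms by (simp add: res_mult R_mult R_power y_in_R res_y mult.assoc)
  then show False using assms by simp
qed

end

section \<open>A Nisnevich coordinate\<close>

lemma (in comm_ring_hom) eval_pcompose:
  "poly (map_poly hom (pcompose p q)) z = poly (map_poly hom p) (poly (map_poly hom q) z)"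
  by (induction p) (simp_all add: pcompose_pCons eval_simps)

lemma power_decomposition:
  fixes m q :: "'a::field poly"
  assumes "q \<noteq> 0" "0 < degree m"
  obtains k p where "q = m ^ k * p" "\<not> m dvd p"
proof -
  have "\<exists>k p. q = m ^ k * p \<and> \<not> m dvd p"
    using assms(1)
  proof (induction "degree q" arbitrary: q rule: less_induct)
    case less
    show ?case
    proof (cases "m dvd q")
      case False
      then show ?thesis by (intro exI[of _ 0] exI[of _ q]) simp
    next
      case True
      then obtain r where r: "q = m * r" by (rule dvdE)
      then have "r \<noteq> 0" "m \<noteq> 0" using less.prems by auto
      then have "degree r < degree q" using assms(2) by (simp add: r degree_mult_eq)
      then obtain k p where "r = m ^ k * p" "\<not> m dvd p" using less.hyps \<open>r \<noteq> 0\<close> by blast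
      then show ?thesis by (intro exI[of _ "Suc k"] exI[of _ p]) (simp add: r mult.assoc)
    qed
  qed
  then show ?thesis using that by blast
qed

text \<open>\<theta> is a simple zero of f(T / \<alpha>) by smoothness, hence a simple zero of its
  minimal polynomial. For \<alpha> = 0 one has \<theta> = 0, and T itself serves.\<close>

lemma (in ramification_point) coordinate_extension:
  assumes gen: "\<And>z. \<exists>q. z = poly (map_poly \<kappa> q) (\<kappa> \<alpha> * \<gamma>)"
  obtains m where "simple_extension \<kappa> (\<kappa> \<alpha> * \<gamma>) m"
proof -
  define \<theta> where "\<theta> = \<kappa> \<alpha> * \<gamma>"
  let ?E = "\<lambda>q. poly (map_poly \<kappa> q) \<theta>"
  obtain q where q: "q \<noteq> 0" "?E q = 0" "?E (pderiv q) \<noteq> 0"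
  proof (cases "\<alpha> = 0")
    case True
    then show ?thesis
      using that[of "[:0, 1:]"] by (simp add: \<theta>_def pderiv_pCons residue.eval_simps)
  next
    case False
    define q where "q = pcompose f [:0, 1 / \<alpha>:]"
    have "poly (map_poly \<kappa> [:0, 1 / \<alpha>:]) \<theta> = \<kappa> (1 / \<alpha> * \<alpha>) * \<gamma>"
      by (simp add: \<theta>_def residue.eval_simps residue.hom_mult del: times_divide_eq_left)
    also have "\<dots> = \<gamma>" using False by simp
    finally have X: "poly (map_poly \<kappa> [:0, 1 / \<alpha>:]) \<theta> = \<gamma>" .
    have "?E q = 0" unfolding q_def residue.eval_pcompose X by (rule ramified)
    moreover have "?E (pderiv q) = val (pderiv f) * \<kappa> (1 / \<alpha>)"
      unfolding q_def pderiv_pcompose residue.eval_simps(5) residue.eval_pcompose X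
      by (simp add: pderiv_pCons residue.eval_simps)
    then have "?E (pderiv q) \<noteq> 0" using pderiv_f_nonzero False by simp
    moreover from this have "q \<noteq> 0" by (auto simp: residue.eval_simps)
    ultimately show ?thesis using that by blast
  qed
  obtain m where m: "lead_coeff m = 1" "\<And>p. ?E p = 0 \<longleftrightarrow> m dvd p"
    by (rule residue.minimal_polynomial[OF q(1,2)]) (rule that)
  obtain w where w: "q = m * w" using m(2) q(2) by (metis dvdE)
  have m0: "?E m = 0" unfolding m(2) by simp
  have "?E (pderiv m) \<noteq> 0"
  proof
    assume "?E (pderiv m) = 0"
    then have "?E (pderiv q) = 0" unfolding w pderiv_mult residue.eval_simps m0 by simp
    then show False using q(3) by simp
  qed
  then have "simple_extension \<kappa> \<theta> m"
    using gen m unfolding \<theta>_def by unfold_locales auto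
  then show ?thesis using that unfolding \<theta>_def by blast
qed

locale nisnevich_coordinate = ramification_point \<iota> x y f g \<kappa> \<gamma> + ext: simple_extension \<kappa> "\<kappa> \<alpha> * \<gamma>" m
  for \<iota> :: "'a::field \<Rightarrow> 'l::field" and x y :: 'l and f :: "'a poly" and g :: nat
    and \<kappa> :: "'a \<Rightarrow> 'k::field" and \<gamma> :: 'k and \<alpha> :: 'a and m :: "'a poly" +
  fixes \<beta> :: 'a
  assumes beta: "\<beta> \<noteq> 0"
begin

definition t :: 'l where "t = \<iota> \<alpha> * x + \<iota> \<beta> * y"

abbreviation (input) et :: "'a poly \<Rightarrow> 'l" where "et q \<equiv> poly (map_poly \<iota> q) t"

abbreviation (input) evt :: "'a poly \<Rightarrow> 'k" where "evt q \<equiv> poly (map_poly \<kappa> q) (\<kappa> \<alpha> * \<gamma>)"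

lemma t_in_R: "t \<in> R" and res_t: "res t = \<kappa> \<alpha> * \<gamma>"
  unfolding t_def
  by (simp_all add: R_add R_mult const_in_R x_in_R y_in_R res_add res_mult res_const res_x res_y)

lemma et_in_R: "et q \<in> R" and res_et: "res (et q) = evt q"
proof -
  have "et q \<in> R \<and> res (et q) = evt q"
  proof (induction q)
    case (pCons c q)
    then show ?case
      by (simp only: eval_simps residue.eval_simps R_add R_mult const_in_R t_in_R res_add res_mult res_const res_t)
  qed (simp add: zero_in_R res_zero)
  then show "et q \<in> R" "res (et q) = evt q" by auto
qed

lemma et_taylor:
  obtains w where "w \<in> R" "et q = ev (pcompose q [:0, \<alpha>:]) + \<iota> \<beta> * y * ev (pcompose (pderiv q) [:0, \<alpha>:]) + y * y * w"
proof -
  let ?S = "\<lambda>q. ev (pcompose q [:0, \<alpha>:])"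
  have "\<exists>w\<in>R. et q = ?S q + \<iota> \<beta> * y * ?S (pderiv q) + y * y * w"
  proof (induction q)
    case 0
    show ?case using zero_in_R by (intro bexI[of _ 0]) (simp_all add: ev_simps)
  next
    case (pCons c q)
    then obtain w where w: "w \<in> R" "et q = ?S q + \<iota> \<beta> * y * ?S (pderiv q) + y * y * w" by blast
    have S: "?S (pCons c q) = \<iota> c + \<iota> \<alpha> * x * ?S q" for c q
      by (simp add: pcompose_pCons eval_simps mult_ac)
    have S': "?S (pderiv (pCons c q)) = ?S q + \<iota> \<alpha> * x * ?S (pderiv q)"
      unfolding pderiv_pCons pcompose_add ev_simps(3) S by simp
    have "et (pCons c q) = ?S (pCons c q) + \<iota> \<beta> * y * ?S (pderiv (pCons c q))
        + y * y * (\<iota> \<beta> * \<iota> \<beta> * ?S (pderiv q) + t * w)"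
      unfolding eval_simps w(2) S S' by (simp add: t_def algebra_simps)
    moreover have "\<iota> \<beta> * \<iota> \<beta> * ?S (pderiv q) + t * w \<in> R"
      by (intro R_add R_mult const_in_R ev_in_R t_in_R w)
    ultimately show ?case by blast
  qed
  then show ?thesis using that by blast
qed

text \<open>In the Taylor expansion of m(\<alpha> x + \<beta> y) the term m(\<alpha> x) is a
  polynomial in x vanishing at \<gamma>, so it lies in y^2 R. The first order in y therefore comes
  from \<beta> m' alone.\<close>

lemma uniformizer:
  obtains u where "u \<in> R" "et m = y * u" "res u = \<kappa> \<beta> * evt (pderiv m)" "res u \<noteq> 0"
proof -
  obtain w where w: "w \<in> R"
    "et m = ev (pcompose m [:0, \<alpha>:]) + \<iota> \<beta> * y * ev (pcompose (pderiv m) [:0, \<alpha>:]) + y * y * w"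
    by (rule et_taylor)
  have X: "val [:0, \<alpha>:] = \<kappa> \<alpha> * \<gamma>" by (simp add: residue.eval_simps mult.commute)
  have "val (pcompose m [:0, \<alpha>:]) = 0"
    unfolding residue.eval_pcompose X ext.min_poly by simp
  then obtain w' where w': "w' \<in> R" "ev (pcompose m [:0, \<alpha>:]) = y * y * w'" by (rule ev_vanishing)
  define u where "u = \<iota> \<beta> * ev (pcompose (pderiv m) [:0, \<alpha>:]) + y * (w' + w)"
  have u: "u \<in> R" unfolding u_def by (intro R_add R_mult const_in_R ev_in_R y_in_R w w')
  have "et m = y * u" unfolding w(2) w'(2) u_def by (simp add: algebra_simps)
  moreover have r: "res u = \<kappa> \<beta> * evt (pderiv m)"
    unfolding u_def
    by (simp add: res_add res_mult R_add R_mult const_in_R ev_in_R y_in_R w w' res_const res_ev res_y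
      residue.eval_pcompose X[simplified])
  moreover have "res u \<noteq> 0" unfolding r using beta ext.separable by simp
  ultimately show ?thesis using that u by blast
qed

lemma coordinate_ideal: "(\<lambda>r. et m ^ n * r) ` R = y_ideal n"
proof -
  obtain u where u: "u \<in> R" "et m = y * u" "res u \<noteq> 0" by (rule uniformizer)
  have "u \<noteq> 0" using u(3) res_zero by auto
  then have eq: "y ^ n * r = et m ^ n * ((1 / u) ^ n * r)" "et m ^ n * r = y ^ n * (u ^ n * r)" for r
    by (simp_all add: u(2) power_mult_distrib power_one_over)
  have R: "(1 / u) ^ n * r \<in> R" "u ^ n * r \<in> R" if "r \<in> R" for r
    using that u by (auto intro!: R_mult R_power R_inverse)
  show ?thesis
    by (intro equalityI image_subsetI; rule image_eqI) (rule eq R | assumption)+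
qed

text \<open>F[t] maps onto R modulo y^n: successive digits of an m-adic expansion exist because
  every residue is a polynomial in \<theta>, the Nisnevich condition.\<close>

lemma coordinate_expansion:
  assumes "r \<in> R"
  shows "\<exists>q. \<exists>s\<in>R. r = et q + y ^ n * s"
proof -
  have "\<exists>q. \<exists>s\<in>R. r = et q + et m ^ n * s"
  proof (induction n)
    case 0
    show ?case using assms by (intro exI[of _ 0] bexI[of _ r]) simp_all
  next
    case (Suc n)
    then obtain q s where s: "s \<in> R" "r = et q + et m ^ n * s" by blast
    obtain p where p: "res s = evt p" using ext.generates by blast
    have "s - et p \<in> R" "res (s - et p) = 0" using s(1) by (simp_all add: R_diff et_in_R res_diff res_et p)
    then obtain s' where s': "s' \<in> R" "s - et p = y * s'" using res_zero_cases by blast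
    then have "s - et p \<in> (\<lambda>r. et m ^ 1 * r) ` R" unfolding coordinate_ideal by auto
    then obtain s'' where s'': "s'' \<in> R" "s - et p = et m * s''" by auto
    have "s = et p + et m * s''" using s''(2) by (simp add: algebra_simps)
    then have "r = et (q + m ^ n * p) + et m ^ Suc n * s''"
      unfolding s(2) by (simp add: eval_simps algebra_simps)
    then show ?case using s''(1) by blast
  qed
  then obtain q s where s: "s \<in> R" "r = et q + et m ^ n * s" by blast
  then have "et m ^ n * s \<in> y_ideal n" unfolding coordinate_ideal[symmetric] by blast
  then obtain s' where "s' \<in> R" "et m ^ n * s = y ^ n * s'" by blast
  then show ?thesis using s(2) by metis
qed

text \<open>Injectivity of F[T]/(m^n) into R modulo y^n. As m(t) is a uniformizer, the order of q(t)
  in y is the exact exponent of \<open>m\<close> in \<open>q\<close>.\<close>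

lemma et_in_ideal_iff: "et q \<in> y_ideal n \<longleftrightarrow> m ^ n dvd q"
proof
  assume "m ^ n dvd q"
  then obtain p where "q = m ^ n * p" by (rule dvdE)
  then have "et q = et m ^ n * et p" by (simp only: eval_simps)
  then show "et q \<in> y_ideal n" unfolding coordinate_ideal[symmetric] using et_in_R by blast
next
  assume "et q \<in> y_ideal n"
  then obtain s where s: "s \<in> R" "et q = y ^ n * s" by blast
  show "m ^ n dvd q"
  proof (cases "q = 0")
    case False
    obtain k p where p: "q = m ^ k * p" "\<not> m dvd p"
      by (rule power_decomposition[OF False ext.degree_m])
    obtain u where u: "u \<in> R" "et m = y * u" "res u \<noteq> 0" by (rule uniformizer)
    have "et q = y ^ k * (u ^ k * et p)"
      by (subst p(1)) (simp only: eval_simps u(2) power_mult_distrib mult.assoc)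
    moreover have "u ^ k * et p \<in> R" "res (u ^ k * et p) \<noteq> 0"
      using u p(2) ext.min_poly by (simp_all add: R_mult R_power et_in_R res_mult res_power res_et)
    ultimately have "n \<le> k" using y_power_le s by metis
    then show ?thesis unfolding p(1) by (intro dvd_mult2 le_imp_power_dvd)
  qed simp
qed

text \<open>If \<open>W\<close> inverts \<open>U\<close> modulo \<open>m\<close>, then (1 - U W)^n
  is divisible by m^n, and it differs from 1 by a multiple of U.\<close>

lemma inverse_mod_power:
  assumes "evt U \<noteq> 0"
  obtains V where "m ^ n dvd U * V - 1"
proof -
  obtain W where W: "1 / evt U = evt W" using ext.generates by blast
  have "evt (1 - U * W) = 0" using assms by (simp only: residue.eval_simps W[symmetric]) simp
  then have "m ^ n dvd (1 - U * W) ^ n" unfolding ext.min_poly by (rule dvd_power_same)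
  moreover obtain V where V: "(1 - U * W) ^ n - 1 = (1 - U * W - 1) * V"
    using power_diff_1_eq by blast
  have "U * (W * V) - 1 = - ((1 - U * W) ^ n)"
    using V by (simp add: algebra_simps)
  ultimately show ?thesis using that by (metis dvd_minus_iff)
qed

end

section \<open>The local index in a Nisnevich coordinate\<close>

lemma coeff_monic_mult:
  fixes p q :: "'a::field poly"
  assumes "lead_coeff p = 1" "degree q \<le> n"
  shows "coeff (p * q) (degree p + n) = coeff q n"
proof (cases "degree q = n")
  case True
  then show ?thesis using coeff_mult_degree_sum[of p q] assms(1) by simp
next
  case False
  then have "degree (p * q) < degree p + n" using degree_mult_le[of p q] assms(2) by linarith
  then show ?thesis using False assms(2) by (simp add: coeff_eq_0)
qed

text \<open>Reducing m^k q modulo m^(k+1) is reducing q modulo m, and a monic factor keeps the top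
  coefficient. This moves the form on the graded piece generated by m^r down to F[T]/(m).\<close>

lemma top_coeff_power:
  assumes m: "lead_coeff m = 1" "0 < degree m"
  shows "top_coeff (m ^ Suc k) (m ^ k * q) = top_coeff m q"
proof -
  have lk: "lead_coeff (m ^ k) = 1" using m by (simp add: lead_coeff_power)
  have m0: "m \<noteq> 0" using m by auto
  have "(m ^ k * q) mod (m ^ Suc k) = m ^ k * (q mod m)"
    unfolding power_Suc2 by (rule mod_mult_mult1)
  moreover have "degree (m ^ Suc k) - 1 = degree (m ^ k) + (degree m - 1)"
    using m m0 by (simp add: degree_power_eq degree_mult_eq)
  moreover have "degree (q mod m) \<le> degree m - 1"
    using degree_mod_less[OF m0, of q] m(2) by auto
  ultimately show ?thesis
    unfolding top_coeff_def by (simp only: coeff_monic_mult[OF lk])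
qed

lemma graded_basis:
  fixes E :: "nat \<Rightarrow> 'a::field poly"
  assumes E: "\<And>k. degree (E k) = k" "\<And>k. lead_coeff (E k) = 1"
  shows "(\<And>i. n \<le> i \<Longrightarrow> coeff q i = 0) \<Longrightarrow> \<exists>c. q = (\<Sum>k<n. Polynomial.smult (c k) (E k))"
    and "(\<Sum>k<n. Polynomial.smult (c k) (E k)) = 0 \<Longrightarrow> k < n \<Longrightarrow> c k = 0"
proof -
  show "\<exists>c. q = (\<Sum>k<n. Polynomial.smult (c k) (E k))" if "\<And>i. n \<le> i \<Longrightarrow> coeff q i = 0" for q
    using that
  proof (induction n arbitrary: q)
    case 0
    then have "q = 0" by (intro poly_eqI) simp
    then show ?case by simp
  next
    case (Suc n)
    define p where "p = q - Polynomial.smult (coeff q n) (E n)"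
    have "coeff p i = 0" if "n \<le> i" for i
      using that Suc.prems[of i] E[of n] by (cases "i = n") (auto simp: p_def coeff_eq_0)
    then obtain c where "p = (\<Sum>k<n. Polynomial.smult (c k) (E k))" using Suc.IH by blast
    then have "q = (\<Sum>k<Suc n. Polynomial.smult ((c(n := coeff q n)) k) (E k))"
      by (simp add: p_def algebra_simps)
    then show ?case by blast
  qed
  show "(\<Sum>k<n. Polynomial.smult (c k) (E k)) = 0 \<Longrightarrow> k < n \<Longrightarrow> c k = 0"
  proof (induction n)
    case (Suc n)
    have "coeff (\<Sum>k<n. Polynomial.smult (c k) (E k)) n = 0"
      unfolding coeff_sum by (intro sum.neutral) (simp add: coeff_eq_0 E)
    then have "c n = coeff (\<Sum>k<Suc n. Polynomial.smult (c k) (E k)) n" using E[of n] by simp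
    then have "c n = 0" unfolding Suc.prems(1) by simp
    then show ?case using Suc by (auto simp: less_Suc_eq)
  qed simp
qed

context nisnevich_coordinate
begin

text \<open>Monic of degree \<open>k\<close>, so initial segments are bases of residues modulo
  powers of \<open>m\<close>; the factor of \<open>m\<close> makes the same basis compatible with
  the m-adic filtration.\<close>

definition basis_poly :: "nat \<Rightarrow> 'a poly" where
  "basis_poly k = m ^ (k div degree m) * monom 1 (k mod degree m)"

lemma degree_basis_poly: "degree (basis_poly k) = k" and monic_basis_poly: "lead_coeff (basis_poly k) = 1"
proof -
  have "degree (basis_poly k) = k div degree m * degree m + k mod degree m"
    unfolding basis_poly_def using ext.m_nonzero
    by (simp add: degree_mult_eq degree_power_eq degree_monom_eq monom_eq_0_iff)
  then show "degree (basis_poly k) = k" by simp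
  show "lead_coeff (basis_poly k) = 1"
    unfolding basis_poly_def using ext.monic_m by (simp only: lead_coeff_mult lead_coeff_power lead_coeff_monom) simp
qed

text \<open>The order of the basis puts the vectors divisible by exactly \<open>m\<^sup>r\<close> first, then the isotropic
  ones divisible by \<open>m\<^bsup>r+1\<^esup>\<close>, then the rest.\<close>

definition basis_perm :: "nat \<Rightarrow> nat \<Rightarrow> nat" where
  "basis_perm r i = (if i < degree m + r * degree m then i + r * degree m else i - (degree m + r * degree m))"

definition adapted_basis :: "nat \<Rightarrow> 'l list" where
  "adapted_basis r = map (\<lambda>i. et (basis_poly (basis_perm r i))) [0..<degree m + (r * degree m + r * degree m)]"

lemma basis_perm_bij:
  fixes r :: nat
  defines "M \<equiv> ext.d + (r * ext.d + r * ext.d)"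
  shows "bij_betw (basis_perm r) {..<M} {..<M}"
  by (rule bij_betw_byWitness[where f' = "\<lambda>i. if i < r * ext.d then i + (ext.d + r * ext.d) else i - r * ext.d"])
    (auto simp: basis_perm_def M_def)

lemma residue_subquotient: "subquotient \<iota> R (y_ideal n)"
proof unfold_locales
  fix u v c
  show "u \<in> R \<Longrightarrow> v \<in> R \<Longrightarrow> u + v \<in> R" by (rule R_add)
  show "v \<in> R \<Longrightarrow> \<iota> c * v \<in> R" by (intro R_mult const_in_R)
  show "y_ideal n \<subseteq> R" by (auto intro!: R_mult R_power y_in_R)
  show "0 \<in> y_ideal n" using zero_in_R by (intro image_eqI[of _ _ 0]) auto
  show "u + v \<in> y_ideal n" if "u \<in> y_ideal n" "v \<in> y_ideal n"
  proof -
    obtain r s where "r \<in> R" "s \<in> R" "u = y ^ n * r" "v = y ^ n * s" using \<open>u \<in> _\<close> \<open>v \<in> _\<close> by blast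
    then show ?thesis by (intro image_eqI[of _ _ "r + s"]) (simp_all add: distrib_left R_add)
  qed
  show "\<iota> c * v \<in> y_ideal n" if "v \<in> y_ideal n"
  proof -
    obtain s where "s \<in> R" "v = y ^ n * s" using \<open>v \<in> _\<close> by blast
    then show ?thesis by (intro image_eqI[of _ _ "\<iota> c * s"]) (simp_all add: mult_ac R_mult const_in_R)
  qed
qed

lemma adapted_basis:
  "basis_mod \<iota> R (y_ideal (2 * r + 1)) (adapted_basis r)"
proof -
  define M where "M = ext.d + (r * ext.d + r * ext.d)"
  define I where "I = y_ideal (2 * r + 1)"
  define P where "P = m ^ (2 * r + 1)"
  interpret sq: subquotient \<iota> R I unfolding I_def by (rule residue_subquotient)
  have dP: "degree P = M" unfolding P_def M_def using ext.m_nonzero by (simp add: degree_power_eq degree_mult_eq)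
  have P0: "P \<noteq> 0" unfolding P_def using ext.m_nonzero by simp
  have M0: "0 < M" unfolding M_def using ext.degree_m by simp
  note graded = graded_basis[of basis_poly, OF degree_basis_poly monic_basis_poly]
  have len: "length (adapted_basis r) = M" by (simp add: adapted_basis_def M_def)
  have nth: "adapted_basis r ! i = et (basis_poly (basis_perm r i))" if "i < M" for i
    using that by (simp add: adapted_basis_def M_def)
  have sum: "(\<Sum>i<M. \<iota> (c i) * adapted_basis r ! i) = et (\<Sum>i<M. Polynomial.smult (c i) (basis_poly (basis_perm r i)))" for c
    by (simp add: eval_simps nth)
  define pos where "pos = inv_into {..<M} (basis_perm r)"
  have bij: "bij_betw (basis_perm r) {..<M} {..<M}" unfolding M_def by (rule basis_perm_bij)
  have pos: "pos (basis_perm r i) = i" "basis_perm r i < M" if "i < M" for i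
    using that bij bij_betw_inv_into_left[OF bij] bij_betwE[OF bij] unfolding pos_def by auto
  have reindex: "(\<Sum>i<M. Polynomial.smult (c i) (basis_poly (basis_perm r i))) = (\<Sum>k<M. Polynomial.smult (c (pos k)) (basis_poly k))"
    for c
    using sum.reindex_bij_betw[OF bij, of "\<lambda>k. Polynomial.smult (c (pos k)) (basis_poly k)"] pos
    by simp
  show ?thesis
    unfolding I_def[symmetric]
  proof (rule sq.basis_modI, unfold len)
    show "adapted_basis r ! i \<in> R" if "i < M" for i using nth[OF that] et_in_R by simp
  next
    fix v assume "v \<in> R"
    then obtain q s where q: "s \<in> R" "v = et q + y ^ (2 * r + 1) * s" using coordinate_expansion by blast
    have "coeff (q mod P) i = 0" if "M \<le> i" for i
      using that degree_mod_less[OF P0, of q] M0 dP by (auto simp: coeff_eq_0)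
    then obtain c where c: "q mod P = (\<Sum>k<M. Polynomial.smult (c k) (basis_poly k))" using graded(1) by blast
    have "(\<Sum>i<M. Polynomial.smult (c (basis_perm r i)) (basis_poly (basis_perm r i))) = q mod P"
      unfolding c by (rule sum.reindex_bij_betw[OF bij])
    then have "(\<Sum>i<M. \<iota> (c (basis_perm r i)) * adapted_basis r ! i) = et (q mod P)" unfolding sum by simp
    moreover have "v - et (q mod P) \<in> I"
    proof -
      have "et (q - q mod P) \<in> I" unfolding I_def et_in_ideal_iff P_def by (simp add: minus_mod_eq_mult_div)
      moreover have "y ^ (2 * r + 1) * s \<in> I" unfolding I_def using q(1) by blast
      ultimately have "et (q - q mod P) + y ^ (2 * r + 1) * s \<in> I" by (rule sq.W_add)
      then show ?thesis unfolding q(2) eval_simps by (simp add: algebra_simps)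
    qed
    ultimately show "\<exists>c. v - (\<Sum>i<M. \<iota> (c i) * adapted_basis r ! i) \<in> I"
      by (intro exI[of _ "\<lambda>i. c (basis_perm r i)"]) simp
  next
    fix c :: "nat \<Rightarrow> 'a" and i
    assume "(\<Sum>i<M. \<iota> (c i) * adapted_basis r ! i) \<in> I" and i: "i < M"
    then have "P dvd (\<Sum>k<M. Polynomial.smult (c (pos k)) (basis_poly k))"
      unfolding sum I_def et_in_ideal_iff P_def reindex by blast
    moreover have "degree (\<Sum>k<M. Polynomial.smult (c (pos k)) (basis_poly k)) \<le> M - 1"
      by (intro degree_sum_le) (auto intro: order.trans[OF degree_smult_le] simp: degree_basis_poly)
    then have "degree (\<Sum>k<M. Polynomial.smult (c (pos k)) (basis_poly k)) < degree P"
      unfolding dP using M0 by linarith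
    ultimately have "(\<Sum>k<M. Polynomial.smult (c (pos k)) (basis_poly k)) = 0"
      using dvd_imp_degree_le leD by blast
    then have "c (pos (basis_perm r i)) = 0" using graded(2)[where n = M and c = "\<lambda>k. c (pos k)"] pos(2)[OF i] by blast
    then show "c i = 0" by (simp add: pos(1)[OF i])
  qed
qed

lemma residue_form:
  assumes \<eta>_add: "\<And>u v. u \<in> R \<Longrightarrow> v \<in> R \<Longrightarrow> \<eta> (u + v) = \<eta> u + \<eta> v"
    and \<eta>_scale: "\<And>c u. u \<in> R \<Longrightarrow> \<eta> (\<iota> c * u) = c * \<eta> u"
    and \<eta>_zero: "\<And>u. u \<in> I \<Longrightarrow> \<eta> u = 0"
    and I: "I = y_ideal n"
  shows "subquotient_form \<iota> R I (\<lambda>u v. \<eta> (u * v))"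
proof -
  interpret sq: subquotient \<iota> R I unfolding I by (rule residue_subquotient)
  have I_mult: "u * v \<in> I" if "u \<in> I" "v \<in> R" for u v
    using that unfolding I by (auto simp: mult.assoc R_mult)
  show ?thesis
  proof unfold_locales
    fix u v w c
    show "u \<in> R \<Longrightarrow> v \<in> R \<Longrightarrow> w \<in> R \<Longrightarrow> \<eta> ((u + v) * w) = \<eta> (u * w) + \<eta> (v * w)"
      by (simp add: distrib_right \<eta>_add R_mult)
    show "u \<in> R \<Longrightarrow> w \<in> R \<Longrightarrow> \<eta> (\<iota> c * u * w) = c * \<eta> (u * w)"
      using \<eta>_scale[of "u * w" c] by (simp add: mult.assoc R_mult)
    show "\<eta> (u * w) = \<eta> (w * u)" by (simp add: mult.commute)
    show "u \<in> I \<Longrightarrow> w \<in> R \<Longrightarrow> \<eta> (u * w) = 0" using I_mult \<eta>_zero by blast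
  qed
qed

text \<open>For \<open>G = m\<^sup>N U\<close>, \<open>N = 2r + 1\<close>, the functional \<open>\<eta>\<close> is the top coefficient modulo \<open>m\<^sup>N\<close> twisted by
  the inverse \<open>V\<close> of \<open>U\<close>; its values enter the residual form only through \<open>V(t(p))\<close> modulo squares.\<close>

lemma residue_form_class:
  assumes \<eta>_add: "\<And>u v. u \<in> R \<Longrightarrow> v \<in> R \<Longrightarrow> \<eta> (u + v) = \<eta> u + \<eta> v"
    and \<eta>_scale: "\<And>c u. u \<in> R \<Longrightarrow> \<eta> (\<iota> c * u) = c * \<eta> u"
    and \<eta>_zero: "\<And>u. u \<in> I \<Longrightarrow> \<eta> u = 0"
    and I: "I = y_ideal (2 * r + 1)"
    and \<eta>_et: "\<And>q. \<eta> (et q) = top_coeff (m ^ (2 * r + 1)) (V * q)"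
    and c: "c \<noteq> 0" and V: "evt V = c * s * s * evt (pderiv m)" "s \<noteq> 0"
  shows "has_gw_class \<iota> R I (\<lambda>u v. \<eta> (u * v)) (gw_trace \<kappa> (hyp r + gw_unit c))"
proof -
  define P where "P = m ^ (2 * r + 1)"
  interpret sq: subquotient \<iota> R I unfolding I by (rule residue_subquotient)
  interpret sf: subquotient_form \<iota> R I "\<lambda>u v. \<eta> (u * v)"
    by (rule residue_form[OF \<eta>_add \<eta>_scale \<eta>_zero I])
  have I_mult: "u * v \<in> I" if "u \<in> I" "v \<in> R" for u v
    using that unfolding I by (auto simp: mult.assoc R_mult)
  have lP: "lead_coeff P = 1" unfolding P_def using ext.monic_m by (simp add: lead_coeff_power lead_coeff_mult)
  have dP: "degree P > 0" unfolding P_def using ext.m_nonzero ext.degree_m by (simp add: degree_power_eq degree_mult_eq)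
  have vV: "evt V \<noteq> 0" unfolding V(1) using c V(2) ext.separable by simp
  \<comment> \<open>An inverse of the twist \<open>V\<close> modulo \<open>P\<close>, by which
    \<open>V\<close> can be cancelled from \<open>P dvd V * q\<close>: the twisted form has no
    larger radical.\<close>
  obtain U where U: "P dvd V * U - 1" unfolding P_def by (rule inverse_mod_power[OF vV])
  have basis: "basis_mod \<iota> R I (adapted_basis r)" unfolding I by (rule adapted_basis)
  have nd: "nondeg_sym (sf.gram (adapted_basis r))"
  proof (rule sf.nondeg_sym_gram[OF basis])
    fix u assume u: "u \<in> R" and zero: "\<And>v. v \<in> R \<Longrightarrow> \<eta> (v * u) = 0"
    obtain q s' where q: "s' \<in> R" "u = et q + y ^ (2 * r + 1) * s'" using coordinate_expansion[OF u] by blast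
    then have "u - et q = y ^ (2 * r + 1) * s'" by (simp only: add_diff_cancel_left')
    then have uI: "u - et q \<in> I" unfolding I using q(1) by blast
    have "top_coeff P ((V * q) * p) = 0" for p
    proof -
      have "(u - et q) * et p \<in> I" using I_mult[OF uI et_in_R] .
      then have "\<eta> ((u - et q) * et p) = 0" by (rule \<eta>_zero)
      moreover have "\<eta> (u * et p) = \<eta> ((u - et q) * et p) + \<eta> (et q * et p)"
        using \<eta>_add[of "(u - et q) * et p" "et q * et p"] u by (simp add: R_mult R_diff et_in_R left_diff_distrib)
      moreover have "\<eta> (u * et p) = 0" using zero[OF et_in_R, of p] by (simp add: mult.commute)
      ultimately have "\<eta> (et (q * p)) = 0" by (simp add: eval_simps)
      then show ?thesis unfolding \<eta>_et P_def by (simp add: mult.assoc)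
    qed
    then have "P dvd V * q" by (rule top_coeff_nondegenerate[OF lP dP])
    then have "P dvd U * (V * q) - (V * U - 1) * q" using U by (intro dvd_diff) (auto intro: dvd_mult dvd_mult2)
    moreover have "U * (V * q) - (V * U - 1) * q = q" by (simp add: algebra_simps)
    ultimately have "et q \<in> I" unfolding I et_in_ideal_iff P_def by simp
    then show "u \<in> I" using sq.W_add[OF uI] by fastforce
  qed
  define w where "w = r * ext.d"
  define C where "C = mat ext.d ext.d (\<lambda>(i, j). top_coeff m (V * monom 1 i * monom 1 j))"
  have len: "length (adapted_basis r) = ext.d + (w + w)" by (simp add: adapted_basis_def w_def)
  have gram: "sf.gram (adapted_basis r) $$ (i, j) = top_coeff P (V * (basis_poly (basis_perm r i) * basis_poly (basis_perm r j)))"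
    if "i < ext.d + (w + w)" "j < ext.d + (w + w)" for i j
    using that \<eta>_et[of "basis_poly (basis_perm r i) * basis_poly (basis_perm r j)"]
    by (simp add: sf.gram_def len) (simp add: adapted_basis_def w_def eval_simps P_def)
  have "gw_class (sf.gram (adapted_basis r)) = gw_class C + hyp w"
  proof (rule gw_class_isotropic_reduction[OF two_nonzero(1) nd])
    show "sf.gram (adapted_basis r) \<in> carrier_mat (ext.d + (w + w)) (ext.d + (w + w))"
      by (simp add: sf.gram_def len)
    show "nondeg_sym C" unfolding C_def by (rule ext.gw_trace_unit(1)[OF c V])
    show "C \<in> carrier_mat ext.d ext.d" by (simp add: C_def)
  next
    fix i j assume ij: "i < ext.d + w" "ext.d \<le> j" "j < ext.d + w"
    \<comment> \<open>Indices below \<open>d + w\<close> carry at least m^r, and those from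
      \<open>d\<close> on at least m^(r+1); the product reaches P = m^(2r+1).\<close>
    have i: "r \<le> basis_perm r i div ext.d"
      using ij ext.degree_m unfolding less_eq_div_iff_mult_less_eq[OF ext.degree_m] by (simp add: basis_perm_def w_def)
    have j: "Suc r \<le> basis_perm r j div ext.d"
      using ij ext.degree_m unfolding less_eq_div_iff_mult_less_eq[OF ext.degree_m] by (simp add: basis_perm_def w_def)
    have "m ^ (r + Suc r) dvd basis_poly (basis_perm r i) * basis_poly (basis_perm r j)"
      unfolding power_add basis_poly_def
      by (intro mult_dvd_mono dvd_mult2 le_imp_power_dvd i j)
    then have "P dvd V * (basis_poly (basis_perm r i) * basis_poly (basis_perm r j))"
      unfolding P_def by (simp add: mult_2)
    then show "sf.gram (adapted_basis r) $$ (i, j) = 0"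
      using ij by (simp add: gram top_coeff_dvd)
  next
    fix i j assume ij: "i < ext.d" "j < ext.d"
    have b: "basis_poly (basis_perm r k) = m ^ r * monom 1 k" if "k < ext.d" for k
      using that by (simp add: basis_poly_def basis_perm_def)
    \<comment> \<open>On the first \<open>d\<close> vectors a factor m^(2r) splits off, so the top
      coefficient modulo m^(2r+1) becomes the one modulo \<open>m\<close>.\<close>
    have eq: "V * (basis_poly (basis_perm r i) * basis_poly (basis_perm r j)) = m ^ (2 * r) * (V * monom 1 i * monom 1 j)"
      unfolding b[OF ij(1)] b[OF ij(2)] mult_2 power_add by (simp add: mult_ac)
    have lt: "i < ext.d + (w + w)" "j < ext.d + (w + w)" using ij by auto
    show "sf.gram (adapted_basis r) $$ (i, j) = C $$ (i, j)"
      unfolding gram[OF lt] eq P_def Suc_eq_plus1[symmetric] top_coeff_power[OF ext.monic_m ext.degree_m]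
      using ij by (simp add: C_def)
  qed
  also have "\<dots> = gw_trace \<kappa> (hyp r + gw_unit c)"
    unfolding C_def w_def by (rule ext.gw_trace_formula[OF two_nonzero(1) c V, symmetric])
  finally show ?thesis unfolding sf.has_gw_class_altdef using basis nd by metis
qed

end

section \<open>Wronskian, representative and Bezoutian form at the point\<close>

context nisnevich_coordinate
begin

lemma jacobian_in_R: "2 * \<iota> \<alpha> * y + \<iota> \<beta> * ev (pderiv f) \<in> R"
  and res_jacobian: "res (2 * \<iota> \<alpha> * y + \<iota> \<beta> * ev (pderiv f)) = \<kappa> \<beta> * val (pderiv f)"
proof -
  have "2 * \<iota> \<alpha> * y + \<iota> \<beta> * ev (pderiv f) = \<iota> (\<alpha> + \<alpha>) * y + \<iota> \<beta> * ev (pderiv f)"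
    by (simp add: hom_distribs)
  then show "2 * \<iota> \<alpha> * y + \<iota> \<beta> * ev (pderiv f) \<in> R"
    "res (2 * \<iota> \<alpha> * y + \<iota> \<beta> * ev (pderiv f)) = \<kappa> \<beta> * val (pderiv f)"
    by (simp_all only: R_add R_mult const_in_R y_in_R ev_in_R res_add res_mult res_const res_y res_ev) simp_all
qed

text \<open>All vanishing comes from the numerator of dx/dt = 2y / J: the residue of
  \<open>J\<close> is \<beta> f'(\<gamma>), so \<open>J\<close> is a unit.\<close>

lemma wronskian_at_point:
  assumes D: "hasse_derivatives (functions_on h) t D"
  obtains v where "v \<in> R" "res v = (2 / (\<kappa> \<beta> * val (pderiv f))) ^ (Suc l choose 2)"
    "hasse_wronskian D (powers l) = y ^ (Suc l choose 2) * v"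
proof -
  define J where "J = 2 * \<iota> \<alpha> * y + \<iota> \<beta> * ev (pderiv f)"
  note W = hasse_wronskian_powers[OF D[unfolded t_def]]
  have J: "J \<in> R" "res J = \<kappa> \<beta> * val (pderiv f)"
    unfolding J_def by (rule jacobian_in_R, rule res_jacobian)
  then have rJ: "res J \<noteq> 0" using beta pderiv_f_nonzero by simp
  then have "J \<noteq> 0" using res_zero by auto
  then have "D 1 x = 2 * y / J" using W(2) unfolding J_def by (simp add: field_simps)
  then have D1: "D 1 x = y * (\<iota> 2 * (1 / J))" using hom_add[of 1 1] by simp
  have in_R: "\<iota> 2 * (1 / J) \<in> R" using J rJ by (intro R_mult const_in_R R_inverse)
  have "res (\<iota> 2 * (1 / J)) = 2 / (\<kappa> \<beta> * val (pderiv f))"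
    unfolding res_mult[OF const_in_R R_inverse[OF J(1) rJ]] res_inverse[OF J(1) rJ] res_const J(2)
    using residue.hom_add[of 1 1] by simp
  then have "res ((\<iota> 2 * (1 / J)) ^ (Suc l choose 2)) = (2 / (\<kappa> \<beta> * val (pderiv f))) ^ (Suc l choose 2)"
    by (simp only: res_power[OF in_R])
  then show ?thesis
    by (rule that[OF R_power[OF in_R]]) (simp only: W(1) D1 power_mult_distrib[of y])
qed

text \<open>As \<open>N < k\<close>, the polynomial \<open>G\<close> has the same order and the same
  leading coefficient in y as \<open>y ^ N * v\<close>. Its order is the exponent of
  \<open>m\<close>, and comparing leading coefficients through m(t) = y u gives the value of
  \<open>U\<close>.\<close>

lemma representative_factor:
  assumes G: "et G - y ^ N * v \<in> y_ideal k" and v: "v \<in> R" "res v \<noteq> 0" and k: "N < k"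
  obtains U where "G = m ^ N * U" "evt U * (\<kappa> \<beta> * evt (pderiv m)) ^ N = res v"
proof -
  obtain s where s: "s \<in> R" "et G = y ^ N * v + y ^ k * s" using G by (auto simp: algebra_simps)
  define v' where "v' = v + y ^ (k - N) * s"
  have v': "v' \<in> R" "res v' = res v"
    unfolding v'_def using k by (simp_all add: v s R_add R_mult R_power y_in_R res_add res_mult res_power res_y)
  have Gv: "et G = y ^ N * v'"
    unfolding s(2) v'_def using k by (simp add: distrib_left mult.assoc[symmetric] power_add[symmetric])
  have "v' \<noteq> 0" using v' v res_zero by auto
  then have "G \<noteq> 0" using Gv y_nonzero by auto
  then obtain j U where U: "G = m ^ j * U" "\<not> m dvd U" by (rule power_decomposition[OF _ ext.degree_m])
  obtain u where u: "u \<in> R" "et m = y * u" "res u = \<kappa> \<beta> * evt (pderiv m)" "res u \<noteq> 0" by (rule uniformizer)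
  have GU: "et G = y ^ j * (u ^ j * et U)"
    unfolding U(1) eval_simps u(2) by (simp add: power_mult_distrib mult.assoc)
  have w: "u ^ j * et U \<in> R" "res (u ^ j * et U) = res u ^ j * evt U"
    using u by (simp_all add: R_mult R_power et_in_R res_mult res_power res_et)
  have "res (u ^ j * et U) \<noteq> 0" unfolding w(2) using u U(2) ext.min_poly by simp
  then have "N \<le> j" "j \<le> N"
    using y_power_le[of j "u ^ j * et U" N v'] y_power_le[of N v' j "u ^ j * et U"] w v' v Gv GU by simp_all
  then have "j = N" by simp
  then have "u ^ N * et U = v'" using Gv GU y_nonzero by simp
  then have "evt U * (\<kappa> \<beta> * evt (pderiv m)) ^ N = res v" using w(2) v' u(3) \<open>j = N\<close> by (simp add: mult.commute)
  then show ?thesis using that U(1) \<open>j = N\<close> by blast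
qed

text \<open>Pulling \<eta> back to F[T] along t turns the equation in R / I into a divisibility by
  m^N, to which \<open>bezoutian_functional_iff\<close> applies.\<close>

lemma bezoutian_form_iff:
  assumes \<eta>_add: "\<And>u v. u \<in> R \<Longrightarrow> v \<in> R \<Longrightarrow> \<eta> (u + v) = \<eta> u + \<eta> v"
    and \<eta>_scale: "\<And>c u. u \<in> R \<Longrightarrow> \<eta> (\<iota> c * u) = c * \<eta> u"
    and \<eta>_zero: "\<And>u. u \<in> I \<Longrightarrow> \<eta> u = 0"
    and I: "I = y_ideal N" and N: "0 < N"
  shows "bezoutian_form R I t (m ^ N * U) \<eta> \<longleftrightarrow> (\<forall>q. \<eta> (et (U * q)) = top_coeff (m ^ N) q)"
proof -
  define \<tau> where "\<tau> q = \<eta> (et q)" for q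
  have \<tau>: "poly_functional \<tau>"
    unfolding poly_functional_def \<tau>_def by (simp add: eval_simps \<eta>_add \<eta>_scale et_in_R)
  have kill: "\<tau> q = 0" if "m ^ N dvd q" for q
    unfolding \<tau>_def using that et_in_ideal_iff \<eta>_zero unfolding I by blast
  have et_sum: "et q = (\<Sum>i\<le>degree q. \<iota> (coeff q i) * t ^ i)" for q
    by (simp add: poly_altdef)
  have sum: "(\<Sum>j\<le>degree B. \<Sum>i\<le>degree (coeff B j). \<iota> (\<eta> (\<iota> (coeff (coeff B j) i) * t ^ i)) * t ^ j) = et (map_poly \<tau> B)"
    for B
  proof -
    have "\<eta> (\<iota> (coeff q i) * t ^ i) = \<tau> (monom (coeff q i) i)" for q i
      by (simp only: \<tau>_def eval_simps)
    then have "(\<Sum>i\<le>degree q. \<iota> (\<eta> (\<iota> (coeff q i) * t ^ i))) = \<iota> (\<tau> q)" for q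
      using poly_functionalD(5)[OF \<tau>, of "\<lambda>i. monom (coeff q i) i" "{..degree q}"]
      by (simp only: hom_sum[symmetric] poly_as_sum_of_monoms)
    then have "(\<Sum>j\<le>degree B. \<Sum>i\<le>degree (coeff B j). \<iota> (\<eta> (\<iota> (coeff (coeff B j) i) * t ^ i)) * t ^ j)
        = (\<Sum>j\<le>degree B. \<iota> (\<tau> (coeff B j)) * t ^ j)"
      by (simp only: sum_distrib_right[symmetric])
    also have "\<dots> = et (\<Sum>j\<le>degree B. monom (coeff (map_poly \<tau> B) j) j)"
      by (simp only: eval_simps coeff_map_functional[OF \<tau>])
    also have "(\<Sum>j\<le>degree B. monom (coeff (map_poly \<tau> B) j) j) = map_poly \<tau> B"
      by (rule poly_as_sum_of_monoms') (rule degree_map_poly_le)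
    finally show ?thesis .
  qed
  \<comment> \<open>T1 - T2 is not a zero divisor, so the existential over \<open>B\<close> in
    \<open>bezoutian_form\<close> has a single witness.\<close>
  have dq: "difference_quotient G B \<longleftrightarrow> B = bez G" for G B
  proof
    assume "difference_quotient G B"
    then have "B * ([:[:0, 1:]:] - [:0, 1:]) = bez G * ([:[:0, 1:]:] - [:0, 1:])"
      unfolding difference_quotient_def bez_difference .
    then show "B = bez G" by (simp only: mult_right_cancel[OF difference_factor_nonzero])
  qed (simp only: difference_quotient_def bez_difference)
  have one: "et (map_poly \<tau> B) - 1 = et (map_poly \<tau> B - 1)" for B by (simp only: eval_simps)
  have "bezoutian_form R I t (m ^ N * U) \<eta> \<longleftrightarrow> m ^ N dvd map_poly \<tau> (bez (m ^ N * U)) - 1"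
    unfolding bezoutian_form_def sum dq one et_in_ideal_iff[symmetric] I[symmetric]
    using \<eta>_add \<eta>_scale \<eta>_zero by auto
  also have "\<dots> \<longleftrightarrow> (\<forall>q. \<tau> (U * q) = top_coeff (m ^ N) q)"
  proof (rule bezoutian_functional_iff[OF _ _ \<tau> kill])
    show "lead_coeff (m ^ N) = 1" unfolding lead_coeff_power using ext.monic_m by simp
    show "0 < degree (m ^ N)" using ext.m_nonzero ext.degree_m N by (simp add: degree_power_eq)
  qed
  finally show ?thesis unfolding \<tau>_def .
qed

lemma index_class:
  assumes D: "hasse_derivatives (functions_on h) t D" and N: "Suc l choose 2 = 2 * r + 1"
  defines "\<phi> \<equiv> hasse_wronskian D (powers l)"
  defines "I \<equiv> (\<lambda>u. \<phi> * u) ` R"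
  shows "I = y_ideal (2 * r + 1)"
    and "ideal_power R max_ideal n \<subseteq> I \<Longrightarrow>
      et G - \<phi> \<in> ideal_power R max_ideal (2 * n) \<Longrightarrow> bezoutian_form R I t G \<eta> \<Longrightarrow>
      has_gw_class \<iota> R I (\<lambda>u v. \<eta> (u * v)) (gw_trace \<kappa> (hyp r + gw_unit (val (pderiv f) / 2)))"
proof -
  define F where "F = val (pderiv f)"
  have F: "F \<noteq> 0" unfolding F_def by (rule pderiv_f_nonzero)
  have b: "\<kappa> \<beta> \<noteq> 0" using beta by simp
  obtain v where v: "v \<in> R" "res v = (2 / (\<kappa> \<beta> * F)) ^ (2 * r + 1)" "\<phi> = y ^ (2 * r + 1) * v"
    by (rule wronskian_at_point[OF D, of l]) (rule that, simp_all only: N \<phi>_def F_def)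
  have rv: "res v \<noteq> 0" using v(2) F b two_nonzero by simp
  then have v0: "v \<noteq> 0" using res_zero by auto
  show I: "I = y_ideal (2 * r + 1)"
  proof (intro equalityI image_subsetI subsetI)
    fix s assume "s \<in> I"
    then obtain u where u: "u \<in> R" "s = \<phi> * u" unfolding I_def by blast
    then have "s = y ^ (2 * r + 1) * (v * u)" by (simp only: v(3) mult.assoc)
    then show "s \<in> y_ideal (2 * r + 1)" using R_mult[OF v(1) u(1)] by blast
  next
    fix s assume s: "s \<in> R"
    have "y ^ (2 * r + 1) * s = \<phi> * ((1 / v) * s)" using v0 by (simp add: v(3))
    then show "y ^ (2 * r + 1) * s \<in> I" unfolding I_def using R_mult[OF R_inverse[OF v(1) rv] s] by blast
  qed
  assume n: "ideal_power R max_ideal n \<subseteq> I"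
    and G: "et G - \<phi> \<in> ideal_power R max_ideal (2 * n)"
    and bf: "bezoutian_form R I t G \<eta>"
  \<comment> \<open>Since \<open>y ^ n\<close> lies in \<open>I\<close>, n is at least the order
    \<open>2 * r + 1\<close> of the Wronskian; so \<open>2 * n\<close> exceeds it and
    \<open>G\<close> shares its leading term.\<close>
  have "y ^ n * 1 \<in> I" by (rule subsetD[OF n[unfolded ideal_power_eq] imageI[OF one_in_R]])
  then obtain s where "s \<in> R" "y ^ n * 1 = y ^ (2 * r + 1) * s" unfolding I by blast
  then have "2 * r + 1 \<le> n" using y_power_le[of n 1 "2 * r + 1" s] one_in_R res_one by simp
  then have n2: "2 * r + 1 < 2 * n" by simp
  obtain U where U: "G = m ^ (2 * r + 1) * U" "evt U * (\<kappa> \<beta> * evt (pderiv m)) ^ (2 * r + 1) = res v"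
    by (rule representative_factor[OF G[unfolded ideal_power_eq v(3)] v(1) rv n2])
  have vU: "evt U \<noteq> 0" using U(2) rv by auto
  obtain V where V: "m ^ (2 * r + 1) dvd U * V - 1" by (rule inverse_mod_power[OF vU])
  note bf' = bf[unfolded bezoutian_form_def]
  note bf1 = conjunct1[OF bf'] and bf2 = conjunct1[OF conjunct2[OF bf']]
    and bf3 = conjunct1[OF conjunct2[OF conjunct2[OF bf']]]
  have \<eta>: "\<eta> (u + v) = \<eta> u + \<eta> v" if "u \<in> R" "v \<in> R" for u v
    using bf1 that by blast
  have \<eta>': "\<eta> (\<iota> c * u) = c * \<eta> u" if "u \<in> R" for c u
    using bf2 that by blast
  have \<eta>'': "\<eta> u = 0" if "u \<in> I" for u
    using bf3 that by blast
  have \<eta>U: "\<eta> (et (U * q)) = top_coeff (m ^ (2 * r + 1)) q" for q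
    using bezoutian_form_iff[of \<eta> I "2 * r + 1" U, OF \<eta> \<eta>' \<eta>'' I] bf unfolding U(1) by simp
  have \<eta>_et: "\<eta> (et q) = top_coeff (m ^ (2 * r + 1)) (V * q)" for q
  proof -
    have "m ^ (2 * r + 1) dvd (U * V - 1) * q" using V by (rule dvd_mult2)
    then have "et ((U * V - 1) * q) \<in> I" unfolding I et_in_ideal_iff .
    then have "\<eta> (et ((U * V - 1) * q)) = 0" by (rule \<eta>'')
    moreover have "U * (V * q) = (U * V - 1) * q + q" by (simp add: algebra_simps)
    then have "\<eta> (et (U * (V * q))) = \<eta> (et ((U * V - 1) * q)) + \<eta> (et q)"
      using \<eta>[OF et_in_R et_in_R, of "(U * V - 1) * q" q] by (simp only: eval_simps(3)[symmetric])
    ultimately show ?thesis using \<eta>U[of "V * q"] by simp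
  qed
  define M where "M = evt (pderiv m)"
  have M: "M \<noteq> 0" unfolding M_def by (rule ext.separable)
  \<comment> \<open>V(\<theta>) is the power with odd exponent 2r + 1 of \<beta>^2 M F / 2. One
    factor M F / 2 is kept, and \<open>z\<close> is the square root of the rest.\<close>
  define z where "z = \<kappa> \<beta> ^ (2 * r + 1) * M ^ r * (F / 2) ^ r"
  have V': "evt V = F / 2 * z * z * M"
  proof -
    have "m dvd U * V - 1" using V dvd_trans[OF dvd_power[of "2 * r + 1" m]] by simp
    then have "evt (U * V - 1) = 0" unfolding ext.min_poly .
    then have UV: "evt U * evt V = 1" by (simp only: residue.eval_simps) simp
    have "F / 2 * z * z * M = \<kappa> \<beta> ^ (2 * r + 1) * \<kappa> \<beta> ^ (2 * r + 1) * (M ^ r * M ^ r * M) * ((F / 2) ^ r * (F / 2) ^ r * (F / 2))"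
      unfolding z_def by (simp only: mult_ac)
    also have "\<dots> = (\<kappa> \<beta> * M) ^ (2 * r + 1) * (\<kappa> \<beta> * (F / 2)) ^ (2 * r + 1)"
    proof -
      have pw: "u ^ (2 * r + 1) = u ^ r * u ^ r * u" for u :: 'k by (simp add: mult_2 power_add)
      show ?thesis unfolding power_mult_distrib pw[of M] pw[of "F / 2"] by (simp only: mult_ac)
    qed
    finally have "evt U * (F / 2 * z * z * M) = (evt U * (\<kappa> \<beta> * M) ^ (2 * r + 1)) * (\<kappa> \<beta> * (F / 2)) ^ (2 * r + 1)"
      by (simp only: mult.assoc)
    also have "\<dots> = (2 / (\<kappa> \<beta> * F) * (\<kappa> \<beta> * (F / 2))) ^ (2 * r + 1)"
      unfolding U(2)[folded M_def] v(2) by (simp only: power_mult_distrib)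
    also have "2 / (\<kappa> \<beta> * F) * (\<kappa> \<beta> * (F / 2)) = 1" using F b two_nonzero by simp
    finally have "evt U * (F / 2 * z * z * M) = evt U * evt V" unfolding UV power_one .
    then show ?thesis unfolding mult_left_cancel[OF vU] by (rule sym)
  qed
  have nz: "z \<noteq> 0" "F / 2 \<noteq> 0" using F b M two_nonzero by (simp_all add: z_def)
  show "has_gw_class \<iota> R I (\<lambda>u v. \<eta> (u * v)) (gw_trace \<kappa> (hyp r + gw_unit (val (pderiv f) / 2)))"
    unfolding F_def[symmetric] by (rule residue_form_class[OF \<eta> \<eta>' \<eta>'' I \<eta>_et nz(2) V'[unfolded M_def] nz(1)])
qed

text \<open>The solution for m^N U is the top coefficient modulo m^N twisted by the inverse
  \<open>V\<close> of \<open>U\<close>, extended from F[t] to R by polynomial representatives modulo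
  the ideal.\<close>

lemma bezoutian_form_exists:
  assumes U: "evt U \<noteq> 0" and N: "0 < N"
  obtains \<eta> where "bezoutian_form R (y_ideal N) t (m ^ N * U) \<eta>"
proof -
  define I where "I = y_ideal N"
  interpret sq: subquotient \<iota> R I unfolding I_def by (rule residue_subquotient)
  obtain V where V: "m ^ N dvd U * V - 1" by (rule inverse_mod_power[OF U])
  define rep where "rep r = (SOME q. r - et q \<in> I)" for r
  have rep: "r - et (rep r) \<in> I" if r: "r \<in> R" for r
  proof -
    obtain q s where "s \<in> R" "r = et q + y ^ N * s" using coordinate_expansion[OF r] by blast
    then have "r - et q \<in> I" unfolding I_def by (auto simp only: add_diff_cancel_left')
    then show ?thesis unfolding rep_def by (rule someI[of "\<lambda>q. r - et q \<in> I"])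
  qed
  define \<eta> where "\<eta> r = top_coeff (m ^ N) (V * rep r)" for r
  note lin = poly_functionalD[OF top_coeff_functional[of "m ^ N"]]
  have \<eta>_eq: "\<eta> r = top_coeff (m ^ N) (V * q)" if "r \<in> R" "r - et q \<in> I" for r q
  proof -
    have "(r - et q) - (r - et (rep r)) \<in> I" by (rule sq.W_diff[OF that(2) rep[OF that(1)]])
    then have "et (rep r - q) \<in> I" by (simp add: eval_simps)
    then have "m ^ N dvd V * (rep r - q)" unfolding I_def et_in_ideal_iff by (rule dvd_mult)
    then have "top_coeff (m ^ N) (V * (rep r - q)) = 0" by (rule top_coeff_dvd)
    then show ?thesis unfolding \<eta>_def right_diff_distrib lin by simp
  qed
  have add: "\<eta> (u + v) = \<eta> u + \<eta> v" if "u \<in> R" "v \<in> R" for u v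
  proof -
    have "(u - et (rep u)) + (v - et (rep v)) \<in> I" using that by (intro sq.W_add rep)
    then have "(u + v) - et (rep u + rep v) \<in> I" by (simp add: eval_simps algebra_simps)
    from \<eta>_eq[OF R_add[OF that] this] show ?thesis by (simp only: \<eta>_def distrib_left lin)
  qed
  have scale: "\<eta> (\<iota> c * u) = c * \<eta> u" if "u \<in> R" for c u
  proof -
    have "\<iota> c * (u - et (rep u)) \<in> I" using that by (intro sq.W_scale rep)
    then have "\<iota> c * u - et (Polynomial.smult c (rep u)) \<in> I" by (simp add: eval_simps algebra_simps)
    from \<eta>_eq[OF R_mult[OF const_in_R that] this] show ?thesis by (simp only: \<eta>_def mult_smult_right lin)
  qed
  have zero: "\<eta> u = 0" if "u \<in> I" for u
    using \<eta>_eq[of u 0] that sq.W_sub lin by auto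
  have "\<eta> (et (U * q)) = top_coeff (m ^ N) q" for q
  proof -
    have "\<eta> (et (U * q)) = top_coeff (m ^ N) (V * (U * q))"
      using et_in_R sq.W_zero by (intro \<eta>_eq) auto
    moreover have "V * (U * q) = (U * V - 1) * q + q" by (simp add: algebra_simps)
    moreover have "top_coeff (m ^ N) ((U * V - 1) * q) = 0" using V by (intro top_coeff_dvd dvd_mult2)
    ultimately show ?thesis by (simp only: lin) simp
  qed
  then have "bezoutian_form R I t (m ^ N * U) \<eta>"
    using bezoutian_form_iff[of \<eta> I N U, OF add scale zero I_def N] by simp
  then show ?thesis using that unfolding I_def by blast
qed

end

section \<open>Existence of Hasse derivatives\<close>

text \<open>Banach's argument in the T-adic metric: a factor \<open>L\<close> without constant term
  gains one coefficient per step. Closure under \<open>S\<close> passes to the limit because each of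
  its coefficients is a coefficient of an iterate.\<close>

lemma fps_contraction_fixed_point:
  fixes \<Phi> :: "'l::comm_ring_1 fps \<Rightarrow> 'l fps"
  assumes zero: "\<And>A. fps_nth A 0 = 0 \<Longrightarrow> fps_nth (\<Phi> A) 0 = 0"
    and contr: "\<And>A B. fps_nth A 0 = 0 \<Longrightarrow> fps_nth B 0 = 0 \<Longrightarrow> \<exists>L. fps_nth L 0 = 0 \<and> \<Phi> A - \<Phi> B = (A - B) * L"
    and closed: "\<And>A. (\<And>n. fps_nth A n \<in> S) \<Longrightarrow> (\<And>n. fps_nth (\<Phi> A) n \<in> S)" and S0: "0 \<in> S"
  obtains \<xi> where "\<Phi> \<xi> = \<xi>" "fps_nth \<xi> 0 = 0" "\<And>n. fps_nth \<xi> n \<in> S"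
proof -
  have agree: "fps_nth (\<Phi> A) k = fps_nth (\<Phi> B) k"
    if AB: "fps_nth A 0 = 0" "fps_nth B 0 = 0" "\<And>k. k < n \<Longrightarrow> fps_nth A k = fps_nth B k" "k < Suc n" for A B n k
  proof -
    obtain L where L: "fps_nth L 0 = 0" "\<Phi> A - \<Phi> B = (A - B) * L" using contr[OF AB(1,2)] by blast
    have "fps_nth ((A - B) * L) k = 0"
      unfolding fps_mult_nth
    proof (rule sum.neutral, rule ballI)
      fix i assume i: "i \<in> {0..k}"
      show "fps_nth (A - B) i * fps_nth L (k - i) = 0"
        using AB(3)[of i] AB(4) i L(1) by (cases "i < n") auto
    qed
    then show ?thesis unfolding L(2)[symmetric] by simp
  qed
  define It where "It n = (\<Phi> ^^ n) 0" for n
  have It: "It 0 = 0" "It (Suc n) = \<Phi> (It n)" for n by (simp_all add: It_def)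
  have It0: "fps_nth (It n) 0 = 0" for n by (induction n) (simp_all add: It zero)
  have ItS: "fps_nth (It n) k \<in> S" for n k
    by (induction n arbitrary: k) (simp_all add: It S0 closed)
  have step: "fps_nth (It (Suc n)) k = fps_nth (It n) k" if "k < Suc n" for n k
    using that
  proof (induction n arbitrary: k)
    case 0
    then show ?case using It0 by simp
  next
    case (Suc n)
    then show ?case unfolding It(2)[of "Suc n"] It(2)[of n]
      by (intro agree[where n = "Suc n"]) (auto simp: It0 It(2)[symmetric])
  qed
  have stable: "fps_nth (It (k + j)) k = fps_nth (It k) k" for j k
    by (induction j) (simp_all add: step)
  \<comment> \<open>Coefficient k is constant from the k-th iterate on, so the diagonal is the
    limit.\<close>
  define \<xi> where "\<xi> = Abs_fps (\<lambda>k. fps_nth (It k) k)"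
  have \<xi>: "fps_nth \<xi> k = fps_nth (It n) k" if "k \<le> n" for k n
    using stable[of k "n - k"] that by (simp add: \<xi>_def)
  have \<xi>0: "fps_nth \<xi> 0 = 0" by (simp add: \<xi>_def It0)
  have "\<Phi> \<xi> = \<xi>"
  proof (rule fps_ext)
    fix k
    have "fps_nth (\<Phi> \<xi>) k = fps_nth (\<Phi> (It k)) k"
      by (rule agree[where n = k]) (simp_all add: \<xi>0 It0 \<xi>)
    also have "\<dots> = fps_nth \<xi> k" unfolding It(2)[symmetric] by (rule \<xi>[symmetric]) simp
    finally show "fps_nth (\<Phi> \<xi>) k = fps_nth \<xi> k" .
  qed
  moreover have "fps_nth \<xi> n \<in> S" for n by (simp add: \<xi>_def ItS)
  ultimately show ?thesis using that \<xi>0 by blast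
qed

section \<open>Power series with coefficients in a subring\<close>

locale subring_of_field =
  fixes S :: "'l::field set"
  assumes S_add: "u \<in> S \<Longrightarrow> v \<in> S \<Longrightarrow> u + v \<in> S" and S_mult: "u \<in> S \<Longrightarrow> v \<in> S \<Longrightarrow> u * v \<in> S"
    and S_zero: "0 \<in> S" and S_one: "1 \<in> S" and S_uminus: "u \<in> S \<Longrightarrow> - u \<in> S"
begin

text \<open>Series are formed over the whole field, where inverses are at hand, and membership of
  the coefficients is carried along, because \<open>hasse_derivatives\<close> asks for operators
  that preserve the ring of functions.\<close>

definition over :: "'l fps \<Rightarrow> bool" where "over A \<longleftrightarrow> (\<forall>n. fps_nth A n \<in> S)"

lemma S_sum: "(\<And>i. i \<in> I \<Longrightarrow> h i \<in> S) \<Longrightarrow> sum h I \<in> S"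
  by (induction I rule: infinite_finite_induct) (auto intro: S_add S_zero)

lemma over_add: "over A \<Longrightarrow> over B \<Longrightarrow> over (A + B)"
  and over_uminus: "over A \<Longrightarrow> over (- A)"
  and over_mult: "over A \<Longrightarrow> over B \<Longrightarrow> over (A * B)"
  by (auto simp: over_def fps_mult_nth intro: S_add S_uminus S_mult S_sum)

lemma over_diff: "over A \<Longrightarrow> over B \<Longrightarrow> over (A - B)"
  using over_add[of A "- B"] over_uminus[of B] by simp

lemma over_const: "c \<in> S \<Longrightarrow> over (fps_const c)"
  by (auto simp: over_def S_zero)

lemma over_X: "over fps_X"
  by (auto simp: over_def fps_X_def S_zero S_one)

lemma over_power: "over A \<Longrightarrow> over (A ^ n)"
  by (induction n) (auto intro: over_mult over_const S_one simp flip: fps_const_1_eq_1)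

lemma over_poly: "(\<And>i. over (coeff p i)) \<Longrightarrow> over A \<Longrightarrow> over (poly p A)"
proof (induction p)
  case (pCons c p)
  have "over (coeff p i)" for i using pCons.prems(1)[of "Suc i"] by simp
  moreover have "over c" using pCons.prems(1)[of 0] by simp
  ultimately show ?case using pCons by (auto intro!: over_add over_mult)
qed (simp add: over_def S_zero)

lemma over_inverse:
  assumes A: "over A" and 0: "inverse (fps_nth A 0) \<in> S"
  shows "over (inverse A)"
proof -
  have "fps_nth (inverse A) n \<in> S" for n
  proof (induction n rule: less_induct)
    case (less n)
    show ?case
    proof (cases n)
      case 0
      then show ?thesis using assms(2) by (simp add: fps_inverse_def)
    next
      case (Suc k)
      have "(\<Sum>i = 1..n. fps_nth A i * fps_nth (inverse A) (n - i)) \<in> S"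
        using less A by (intro S_sum S_mult) (auto simp: over_def)
      then have "- inverse (fps_nth A 0) * (\<Sum>i = 1..n. fps_nth A i * fps_nth (inverse A) (n - i)) \<in> S"
        using 0 by (intro S_mult S_uminus)
      then show ?thesis using Suc by (simp add: fps_inverse_def)
    qed
  qed
  then show ?thesis by (simp add: over_def)
qed

end

section \<open>Taylor expansion along the coordinate x + y\<close>

context hyperelliptic_curve
begin

lemma functions_on_subring:
  assumes h: "fn h \<noteq> 0"
  shows "subring_of_field (functions_on h)"
proof
  note ev2 = eval2_hom
  fix u v
  show "u * v \<in> functions_on h" if "u \<in> functions_on h" "v \<in> functions_on h"
    using that by (rule functions_on_closed)
  show "0 \<in> functions_on h" "1 \<in> functions_on h"
    using functions_on_closed(2)[of 0 h] functions_on_closed(2)[of 1 h] by (simp_all add: ev_simps)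
  show "u + v \<in> functions_on h" if uv: "u \<in> functions_on h" "v \<in> functions_on h"
  proof -
    obtain A n B k where "u = fn A / fn h ^ n" "v = fn B / fn h ^ k"
      using uv unfolding functions_on_def by auto
    then have "u + v = fn (A * h ^ k + B * h ^ n) / fn h ^ (n + k)"
      using h by (simp add: ev2 power_add add_frac_eq)
    then show ?thesis unfolding functions_on_def by blast
  qed
  show "- u \<in> functions_on h" if u: "u \<in> functions_on h"
    using functions_on_closed(1)[OF functions_on_closed(2)[of "-1"] u] by (simp add: ev_simps)
qed

lemma functions_on_inverse: "1 / fn h \<in> functions_on h"
  unfolding functions_on_def mem_Collect_eq
  by (rule exI[of _ 1], rule exI[of _ 1]) (simp add: eval2_hom)

text \<open>The new point is \<open>(x + \<xi>, y + T - \<xi>)\<close>, so that \<open>x + y\<close> moves to \<open>x + y + T\<close>. The series \<open>\<xi>\<close>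
  comes from Newton's iteration with constant slope \<open>- J\<close>, the derivative of the equation at \<open>\<xi> = 0\<close>.\<close>

lemma deformation:
  assumes h: "fn h = - (2 * y + ev (pderiv f))" "fn h \<noteq> 0"
  obtains \<xi> where "fps_nth \<xi> 0 = 0" "\<And>n. fps_nth \<xi> n \<in> functions_on h"
    "(fps_const y + fps_X - \<xi>) ^ 2 = poly (map_poly (\<lambda>c. fps_const (\<iota> c)) f) (fps_const x + \<xi>)"
proof -
  define S where "S = functions_on h"
  interpret S: subring_of_field S unfolding S_def by (rule functions_on_subring[OF h(2)])
  interpret fc: comm_ring_hom "\<lambda>c. fps_const (\<iota> c)"
    by unfold_locales (simp_all add: hom_distribs)
  define j where "j = fn h"
  have j: "j \<noteq> 0" "1 / j \<in> S" using h(2) functions_on_inverse unfolding j_def S_def by auto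
  have yS: "y \<in> S" and xS: "x \<in> S" and evS: "ev q \<in> S" for q
    unfolding S_def by (rule functions_on_closed)+
  have cS: "\<iota> c \<in> S" for c using evS[of "[:c:]"] by (simp add: ev_simps)
  define e where "e p A = poly (map_poly (\<lambda>c. fps_const (\<iota> c)) p) (fps_const x + A)" for p A
  have e_simps: "e 0 A = 0" "e (pCons c p) A = fps_const (\<iota> c) + (fps_const x + A) * e p A" for c p A
    by (simp_all add: e_def fc.eval_simps)
  have e0: "fps_nth (e p A) 0 = ev p" if "fps_nth A 0 = 0" for p A
    by (induction p) (simp_all add: e_simps ev_simps that)
  have e_diff: "\<exists>K. e p A - e p B = (A - B) * K \<and> fps_nth K 0 = ev (pderiv p)"
    if A: "fps_nth A 0 = 0" and B: "fps_nth B 0 = 0" for p A B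
  proof (induction p)
    case 0
    show ?case by (intro exI[of _ 0]) (simp add: e_simps ev_simps)
  next
    case (pCons c p)
    then obtain K where K: "e p A - e p B = (A - B) * K" "fps_nth K 0 = ev (pderiv p)" by blast
    have "e (pCons c p) A - e (pCons c p) B = (A - B) * e p A + (fps_const x + B) * (e p A - e p B)"
      by (simp add: e_simps algebra_simps)
    also have "\<dots> = (A - B) * (e p A + (fps_const x + B) * K)" unfolding K(1) by (simp add: algebra_simps)
    finally show ?case
      by (intro exI[of _ "e p A + (fps_const x + B) * K"])
        (simp add: e0[OF A] K(2) B pderiv_pCons ev_simps)
  qed
  define \<Phi> where "\<Phi> A = A - fps_const (1 / j) * ((fps_const y + fps_X - A) ^ 2 - e f A)" for A
  obtain \<xi> where \<xi>: "\<Phi> \<xi> = \<xi>" "fps_nth \<xi> 0 = 0" "\<And>n. fps_nth \<xi> n \<in> S"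
  proof (rule fps_contraction_fixed_point[of \<Phi> S])
    fix A :: "'l fps"
    assume A: "fps_nth A 0 = 0"
    show "fps_nth (\<Phi> A) 0 = 0" by (simp add: \<Phi>_def A e0 power2_eq_square y_square)
    fix B :: "'l fps"
    assume B: "fps_nth B 0 = 0"
    obtain K where K: "e f A - e f B = (A - B) * K" "fps_nth K 0 = ev (pderiv f)" using e_diff[OF A B] by metis
    define Y where "Y = fps_const y + fps_X"
    define L where "L = 1 - fps_const (1 / j) * (A + B - 2 * Y - K)"
    have "\<Phi> A - \<Phi> B = (A - B) - fps_const (1 / j) * (((Y - A) ^ 2 - (Y - B) ^ 2) - (e f A - e f B))"
      unfolding \<Phi>_def Y_def by (simp only: right_diff_distrib) simp
    also have "\<dots> = (A - B) * L" unfolding K(1) L_def by (simp add: algebra_simps power2_eq_square)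
    finally have L: "\<Phi> A - \<Phi> B = (A - B) * L" .
    \<comment> \<open>The slope is chosen for this: the constant term of
      \<open>A + B - 2 * Y - K\<close> is - 2y - f'(x) = \<open>j\<close>, so that of
      \<open>L\<close> vanishes.\<close>
    have "fps_nth L 0 = 1 - (1 / j) * j" by (simp add: L_def Y_def A B K(2) j_def h(1))
    then have "fps_nth L 0 = 0" using j(1) by simp
    then show "\<exists>L. fps_nth L 0 = 0 \<and> \<Phi> A - \<Phi> B = (A - B) * L" using L by (intro exI[of _ L] conjI)
  next
    fix A :: "'l fps" and n
    assume "\<And>n. fps_nth A n \<in> S"
    then have A: "S.over A" by (simp add: S.over_def)
    have "S.over (e f A)"
      unfolding e_def by (intro S.over_poly S.over_add S.over_const xS A) (simp add: coeff_map_poly S.over_const cS)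
    then have "S.over (\<Phi> A)"
      unfolding \<Phi>_def by (intro S.over_diff S.over_mult S.over_power S.over_add S.over_const S.over_X A j(2) yS)
    then show "fps_nth (\<Phi> A) n \<in> S" by (simp add: S.over_def)
  next
    fix \<xi>
    assume "\<Phi> \<xi> = \<xi>" "fps_nth \<xi> 0 = 0" "\<And>n. fps_nth \<xi> n \<in> S"
    then show thesis by (rule that)
  qed (rule S.S_zero)
  have "(fps_const y + fps_X - \<xi>) ^ 2 = e f \<xi>"
    using \<xi>(1) j(1) unfolding \<Phi>_def by simp
  then show ?thesis using that[of \<xi>] \<xi>(2,3) unfolding e_def S_def by blast
qed

text \<open>The Hasse derivatives are the coefficients of the Taylor homomorphism that substitutes
  the deformed point for (x, y). Multiplicativity is the Leibniz rule, and x + y moving to x + y + T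
  gives the binomial coefficients. It extends to fractions since the series of \<open>h\<close> has
  the invertible constant term h(x, y).\<close>

lemma hasse_derivatives_exist:
  assumes h: "fn h = - (2 * y + ev (pderiv f))" "fn h \<noteq> 0"
  obtains D where "hasse_derivatives (functions_on h) (x + y) D"
proof -
  define S where "S = functions_on h"
  interpret S: subring_of_field S unfolding S_def by (rule functions_on_subring[OF h(2)])
  interpret fc: comm_ring_hom "\<lambda>c. fps_const (\<iota> c)"
    by unfold_locales (simp_all add: hom_distribs)
  obtain \<xi> where \<xi>: "fps_nth \<xi> 0 = 0" "\<And>n. fps_nth \<xi> n \<in> S"
    "(fps_const y + fps_X - \<xi>) ^ 2 = poly (map_poly (\<lambda>c. fps_const (\<iota> c)) f) (fps_const x + \<xi>)"
    by (rule deformation[OF h]) (rule that, unfold S_def)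
  define X where "X = fps_const x + \<xi>"
  define Y where "Y = fps_const y + fps_X - \<xi>"
  define e where "e q = poly (map_poly (\<lambda>c. fps_const (\<iota> c)) q) X" for q
  define E where "E P = eval2 (\<lambda>c. fps_const (\<iota> c)) X Y P" for P
  note E_simps = eval2_simps[OF fc.comm_ring_hom_axioms, of X Y, folded E_def]
  note ev2 = eval2_hom
  have YY: "Y * Y = e f" using \<xi>(3) by (simp add: Y_def X_def e_def power2_eq_square)
  have xS: "x \<in> S" and yS: "y \<in> S" and evS: "ev q \<in> S" for q unfolding S_def by (rule functions_on_closed)+
  have cS: "\<iota> c \<in> S" for c using evS[of "[:c:]"] by (simp add: ev_simps)
  have over_\<xi>: "S.over \<xi>" using \<xi>(2) by (simp add: S.over_def)
  have over_e: "S.over (e q)" for q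
    unfolding e_def X_def by (intro S.over_poly S.over_add S.over_const xS over_\<xi>) (simp add: coeff_map_poly S.over_const cS)
  have over_E: "S.over (E P)" for P
  proof (induction P)
    case 0
    then show ?case by (simp add: E_simps S.over_def S.S_zero)
  next
    case (pCons q P)
    then show ?case
      unfolding E_simps(8) e_def[symmetric] Y_def
      by (intro S.over_add S.over_mult S.over_diff S.over_const S.over_X over_e over_\<xi> yS)
  qed
  have e0: "fps_nth (e q) 0 = ev q" for q
    unfolding e_def by (induction q) (simp_all add: fc.eval_simps ev_simps X_def \<xi>(1))
  have E0: "fps_nth (E P) 0 = fn P" for P
  proof (induction P)
    case (pCons q P)
    then show ?case unfolding E_simps(8) ev2(8) e_def[symmetric] by (simp add: e0 Y_def \<xi>(1))
  qed (simp add: E_simps ev2)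
  have E_cong: "E P = E Q" if "fn P = fn Q" for P Q
    unfolding E_def by (rule specialization[OF fc.comm_ring_hom_axioms YY[unfolded e_def] that])
  have Eh: "fps_nth (E h) 0 \<noteq> 0" unfolding E0 by (rule h(2))
  then have inv: "E h * inverse (E h) = 1" by (simp add: inverse_mult_eq_1')
  define W where "W = inverse (E h)"
  have EhW: "E h ^ n * W ^ n = 1" for n using inv by (simp add: W_def power_mult_distrib[symmetric])
  have over_W: "S.over W"
    unfolding W_def using functions_on_inverse[of h]
    by (intro S.over_inverse over_E) (simp add: E0 S_def inverse_eq_divide)
  have W0: "fps_nth W 0 = 1 / fn h" unfolding W_def by (simp add: E0 inverse_eq_divide)
  define frac where "frac P n = fn P / fn h ^ n" for P n
  \<comment> \<open>Any fraction may represent \<open>s\<close>: after clearing denominators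
    \<open>E_cong\<close> shows that \<open>EE s\<close> does not depend on it.\<close>
  define rep where "rep s = (SOME Pn. s = frac (fst Pn) (snd Pn))" for s
  define EE where "EE s = E (fst (rep s)) * W ^ snd (rep s)" for s
  have EE: "EE (frac P n) = E P * W ^ n" for P n
  proof -
    define Q k where "Q = fst (rep (frac P n))" and "k = snd (rep (frac P n))"
    have frac_eq: "frac P n = frac Q k"
      unfolding Q_def k_def rep_def
      by (rule someI[of "\<lambda>Pn. frac P n = frac (fst Pn) (snd Pn)" "(P, n)"]) (simp only: fst_conv snd_conv)
    have "fn h ^ n \<noteq> 0" "fn h ^ k \<noteq> 0" using h(2) by simp_all
    from frac_eq[unfolded frac_def frac_eq_eq[OF this]]
    have "fn (P * h ^ k) = fn (Q * h ^ n)" unfolding ev2 .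
    then have "E (P * h ^ k) = E (Q * h ^ n)" by (rule E_cong)
    then have eq: "E P * E h ^ k = E Q * E h ^ n" unfolding E_simps .
    have "E Q * W ^ k = E Q * (E h ^ n * W ^ n) * W ^ k" by (simp add: EhW)
    also have "\<dots> = (E Q * E h ^ n) * W ^ n * W ^ k" by (simp only: mult_ac)
    also have "\<dots> = E P * W ^ n * (E h ^ k * W ^ k)" unfolding eq[symmetric] by (simp only: mult_ac)
    finally show ?thesis unfolding EE_def Q_def[symmetric] k_def[symmetric] EhW by simp
  qed
  have S_frac: "\<exists>P n. s = frac P n" if "s \<in> S" for s
    using that unfolding S_def functions_on_def frac_def by blast
  have EE_add: "EE (u + v) = EE u + EE v" and EE_mult: "EE (u * v) = EE u * EE v" if uv: "u \<in> S" "v \<in> S" for u v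
  proof -
    obtain P n Q k where u: "u = frac P n" and v: "v = frac Q k" using S_frac uv by metis
    have "u + v = frac (P * h ^ k + Q * h ^ n) (n + k)"
      using h(2) by (simp add: u v frac_def ev2 power_add add_frac_eq)
    then have "EE (u + v) = E P * (E h ^ k * W ^ k) * W ^ n + E Q * (E h ^ n * W ^ n) * W ^ k"
      by (simp add: EE E_simps power_add algebra_simps)
    then show "EE (u + v) = EE u + EE v" unfolding u v EE EhW by simp
    have "u * v = frac (P * Q) (n + k)" by (simp add: u v frac_def ev2 power_add)
    then show "EE (u * v) = EE u * EE v" unfolding u v by (simp add: EE E_simps power_add mult_ac)
  qed
  have EE_eval: "EE (fn P) = E P" for P
    using EE[of P 0] by (simp add: frac_def)
  have EE_const: "EE (\<iota> c) = fps_const (\<iota> c)" for c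
    using EE_eval[of "[:[:c:]:]"] by (simp add: eval2_const ev_simps E_simps fc.eval_simps)
  have EE_t: "EE (x + y) = fps_const (x + y) + fps_X"
  proof -
    have "E [:[:0, 1:], [:1:]:] = X + Y" by (simp add: E_simps fc.eval_simps)
    moreover have "fn [:[:0, 1:], [:1:]:] = x + y" using eval2_linear[of 1 1] by simp
    ultimately have "EE (x + y) = X + Y" using EE_eval[of "[:[:0, 1:], [:1:]:]"] by simp
    then show ?thesis by (simp add: X_def Y_def flip: fps_const_add)
  qed
  have tS: "(x + y) ^ n \<in> S" for n by (induction n) (auto intro: S.S_one S.S_mult S.S_add xS yS)
  have EE_tn: "EE ((x + y) ^ n) = (fps_const (x + y) + fps_X) ^ n" for n
  proof (induction n)
    case 0
    show ?case using EE_const[of 1] by simp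
  next
    case (Suc n)
    then show ?case by (simp add: EE_mult tS S.S_add xS yS EE_t)
  qed
  have binom: "fps_nth ((fps_const c + fps_X) ^ n) k = of_nat (n choose k) * c ^ (n - k)" for c :: 'l and n k
  proof -
    have "(fps_const c + fps_X) ^ n = (\<Sum>j\<le>n. fps_const (of_nat (n choose j) * c ^ (n - j)) * fps_X ^ j)"
      unfolding add.commute[of "fps_const c"]
      by (simp add: binomial_ring fps_const_power fps_of_nat[symmetric] mult_ac flip: fps_const_mult)
    then have "fps_nth ((fps_const c + fps_X) ^ n) k = (\<Sum>j\<le>n. (of_nat (n choose j) * c ^ (n - j)) * (if k = j then 1 else 0))"
      by (simp add: fps_sum_nth)
    also have "\<dots> = (\<Sum>j\<le>n. if k = j then of_nat (n choose j) * c ^ (n - j) else 0)"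
      by (intro sum.cong) simp_all
    also have "\<dots> = of_nat (n choose k) * c ^ (n - k)"
      unfolding sum.delta'[OF finite_atMost] by (simp add: binomial_eq_0)
    finally show ?thesis .
  qed
  have over_EE: "S.over (EE s)" for s
    unfolding EE_def by (intro S.over_mult S.over_power over_E over_W)
  have EE_0: "fps_nth (EE s) 0 = s" if s: "s \<in> S" for s
  proof -
    obtain P n where P: "s = frac P n" using S_frac s by metis
    have "fps_nth (W ^ n) 0 = (1 / fn h) ^ n" by (induction n) (simp_all add: W0)
    then show ?thesis unfolding P EE by (simp add: E0 frac_def power_one_over)
  qed
  have "hasse_derivatives (functions_on h) (x + y) (\<lambda>k s. fps_nth (EE s) k)"
    unfolding hasse_derivatives_def S_def[symmetric]
  proof (intro conjI allI ballI)
    fix k n and u v :: 'l and c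
    show "fps_nth (EE u) k \<in> S" using over_EE by (simp add: S.over_def)
    show "fps_nth (EE ((x + y) ^ n)) k = of_nat (n choose k) * (x + y) ^ (n - k)" unfolding EE_tn by (rule binom)
    assume u: "u \<in> S"
    show "fps_nth (EE u) 0 = u" by (rule EE_0[OF u])
    show "fps_nth (EE (\<iota> c * u)) k = \<iota> c * fps_nth (EE u) k" by (simp add: EE_mult cS u EE_const)
    assume v: "v \<in> S"
    show "fps_nth (EE (u + v)) k = fps_nth (EE u) k + fps_nth (EE v) k" by (simp add: EE_add u v)
    show "fps_nth (EE (u * v)) k = (\<Sum>i\<le>k. fps_nth (EE u) i * fps_nth (EE v) (k - i))"
      by (simp add: EE_mult u v fps_mult_nth atLeast0AtMost)
  qed
  then show ?thesis by (rule that)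
qed

end

text \<open>For l = 4k + 1 the binomial coefficient is (2k + 1)(4k + 1), a product of odd numbers,
  so halving after subtracting 1 is exact.\<close>

lemma odd_choose_two:
  assumes "l mod 4 = 1"
  shows "Suc l choose 2 = 2 * (((l + 1 choose 2) - 1) div 2) + 1"
proof -
  define k where "k = l div 4"
  have l: "l = 4 * k + 1" using assms by (simp add: k_def) presburger
  have "Suc l choose 2 = (4 * k + 2) * (4 * k + 1) div 2" by (simp add: l choose_two)
  also have "(4 * k + 2) * (4 * k + 1) = 2 * ((2 * k + 1) * (4 * k + 1))" by simp
  finally have "Suc l choose 2 = (2 * k + 1) * (4 * k + 1)" by (simp del: mult_Suc mult_Suc_right)
  then have "odd (Suc l choose 2)" by simp
  then show ?thesis by (simp add: odd_two_times_div_two_succ)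
qed

section \<open>Uniqueness and existence of the local index\<close>

context ramification_point
begin

lemma functions_on_in_R:
  assumes "at0 h \<noteq> 0" "u \<in> functions_on h"
  shows "u \<in> R"
proof -
  obtain A n where u: "u = fn A / fn h ^ n" using assms(2) unfolding functions_on_def by blast
  have "u = fn A / fn (h ^ n)" "at0 (h ^ n) \<noteq> 0"
    using assms(1) by (simp_all add: u eval2_hom eval2_residue)
  then show ?thesis unfolding local_ring_def by blast
qed

text \<open>For \<open>b = 0\<close> the Jacobian is a multiple of y, which vanishes at the point
  and so cannot divide 1 in the local ring: dx does not generate the differentials at a ramification
  point.\<close>

lemma etale_coordinate_nonzero:
  assumes h: "at0 h \<noteq> 0" and et: "etale_coordinate_on h [:[:0, a:], [:b:]:]"
  shows "b \<noteq> 0"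
proof
  assume b: "b = 0"
  obtain u where u: "u \<in> functions_on h" "u * - (2 * \<iota> a * y + \<iota> b * ev (pderiv f)) = 1"
    using et unfolding etale_coordinate_on_def eval2_jacobian by blast
  have one: "1 = (u * \<iota> (- (a + a))) * y" using u(2) b by (simp add: hom_distribs algebra_simps)
  have "u * \<iota> (- (a + a)) \<in> R" using functions_on_in_R[OF h u(1)] by (intro R_mult const_in_R)
  from res_mult[OF this y_in_R] have "res 1 = 0" unfolding one[symmetric] res_y by simp
  then show False by (simp add: res_one)
qed

text \<open>Arbitrary admissible data fit into \<open>nisnevich_coordinate\<close>, where
  \<open>index_class\<close> produces the same class each time; \<open>has_gw_class_unique\<close>
  then removes the choice of basis.\<close>

lemma local_index_unique:
  assumes c: "is_local_index l (powers l) \<kappa> \<gamma> 0 c" and N: "Suc l choose 2 = 2 * r + 1"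
  shows "c = gw_trace \<kappa> (hyp r + gw_unit (val (pderiv f) / 2))"
proof -
  obtain a b h D n G \<eta> where h: "at0 h \<noteq> 0"
    and et: "etale_coordinate_on h [:[:0, a:], [:b:]:]"
    and gen: "\<forall>z. \<exists>q. z = poly (map_poly \<kappa> q) (\<kappa> a * \<gamma> + \<kappa> b * 0)"
    and D: "hasse_derivatives (functions_on h) (\<iota> a * x + \<iota> b * y) D"
    and n: "ideal_power R max_ideal n \<subseteq> (\<lambda>u. hasse_wronskian D (powers l) * u) ` R"
    and G: "poly (map_poly \<iota> G) (\<iota> a * x + \<iota> b * y) - hasse_wronskian D (powers l)
      \<in> ideal_power R max_ideal (2 * n)"
    and bf: "bezoutian_form R ((\<lambda>u. hasse_wronskian D (powers l) * u) ` R) (\<iota> a * x + \<iota> b * y) G \<eta>"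
    and gw: "has_gw_class \<iota> R ((\<lambda>u. hasse_wronskian D (powers l) * u) ` R) (\<lambda>u v. \<eta> (u * v)) c"
    using c unfolding is_local_index_def Let_def by (elim conjE exE) (rule that)
  obtain m where "simple_extension \<kappa> (\<kappa> a * \<gamma>) m" using gen by (auto intro: coordinate_extension[of a])
  then interpret nisnevich_coordinate \<iota> x y f g \<kappa> \<gamma> a m b
    using etale_coordinate_nonzero[OF h et]
    by (intro nisnevich_coordinate.intro nisnevich_coordinate_axioms.intro ramification_point_axioms)
  note idx = index_class[OF D[folded t_def] N]
  note bf' = bf[unfolded bezoutian_form_def]
  have "subquotient_form \<iota> R ((\<lambda>u. hasse_wronskian D (powers l) * u) ` R) (\<lambda>u v. \<eta> (u * v))"
    by (rule residue_form[OF _ _ _ idx(1)])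
      (use conjunct1[OF bf'] conjunct1[OF conjunct2[OF bf']] conjunct1[OF conjunct2[OF conjunct2[OF bf']]] in blast)+
  from subquotient_form.has_gw_class_unique[OF this gw idx(2)[OF n G[folded t_def] bf[folded t_def]]]
  show ?thesis .
qed

lemma local_index_exists:
  assumes l: "l \<le> g" and N: "Suc l choose 2 = 2 * r + 1"
  shows "is_local_index l (powers l) \<kappa> \<gamma> 0
    (gw_trace \<kappa> (hyp r + gw_unit (val (pderiv f) / 2)))"
proof -
  \<comment> \<open>As a function \<open>h\<close> is the Jacobian for X + Y, so x + y is etale on
    its open set by construction. Its value at the point is - f'(\<gamma>), and x + y takes there
    the value \<gamma>, which generates k.\<close>
  define h :: "'a poly poly" where "h = [:- pderiv f, [:- (1 + 1):]:]"
  have h: "fn h = - (2 * y + ev (pderiv f))"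
    by (simp add: h_def eval2_hom ev_simps hom_distribs del: one_add_one)
  have h\<gamma>: "at0 h \<noteq> 0"
    using pderiv_f_nonzero by (simp add: h_def eval2_residue residue.eval_simps)
  have h0: "fn h \<noteq> 0"
  proof
    assume "fn h = 0"
    then have "ev (pderiv f) + ev [:1 + 1:] * y = 0"
      unfolding h by (simp add: ev_simps hom_distribs algebra_simps neg_eq_iff_add_eq_0 del: one_add_one)
    then have "pderiv f = 0" by (rule normal_form_zero)
    then show False using pderiv_f_nonzero by (simp add: residue.eval_simps)
  qed
  obtain m where "simple_extension \<kappa> (\<kappa> 1 * \<gamma>) m"
    using generates_residue by (auto intro: coordinate_extension[of 1])
  then interpret nisnevich_coordinate \<iota> x y f g \<kappa> \<gamma> 1 m 1
    by (intro nisnevich_coordinate.intro nisnevich_coordinate_axioms.intro ramification_point_axioms) simp_all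
  obtain D where "hasse_derivatives (functions_on h) (x + y) D" by (rule hasse_derivatives_exist[OF h h0])
  then have D: "hasse_derivatives (functions_on h) t D" unfolding t_def by simp
  define \<phi> where "\<phi> = hasse_wronskian D (powers l)"
  define I where "I = (\<lambda>u. \<phi> * u) ` R"
  note idx = index_class[OF D N, folded \<phi>_def, folded I_def]
  let ?N = "2 * r + 1"
  obtain v where v: "v \<in> R" "res v = (2 / (\<kappa> 1 * val (pderiv f))) ^ ?N" "\<phi> = y ^ ?N * v"
    by (rule wronskian_at_point[OF D, of l]) (rule that, simp_all only: N \<phi>_def)
  have rv: "res v \<noteq> 0" using v(2) pderiv_f_nonzero two_nonzero by simp
  have "\<phi> \<in> R" unfolding v(3) by (intro R_mult R_power y_in_R v)
  \<comment> \<open>With n chosen as the order \<open>?N\<close> of the Wronskian, the definition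
    asks for a polynomial in t that matches it up to order \<open>2 * ?N\<close>.\<close>
  then obtain G s where s: "s \<in> R" "\<phi> = et G + y ^ (2 * ?N) * s" using coordinate_expansion by blast
  have "et G - \<phi> = y ^ (2 * ?N) * (\<iota> (- 1) * s)" unfolding s(2) by (simp add: hom_distribs)
  then have G: "et G - \<phi> \<in> y_ideal (2 * ?N)" using R_mult[OF const_in_R s(1)] by blast
  obtain U where U: "G = m ^ ?N * U" "evt U * (\<kappa> 1 * evt (pderiv m)) ^ ?N = res v"
    by (rule representative_factor[OF G[unfolded v(3)] v(1) rv]) (simp, rule that)
  have "evt U \<noteq> 0" using U(2) rv by auto
  then obtain \<eta> where "bezoutian_form R ((\<lambda>s. y ^ ?N * s) ` R) t (m ^ ?N * U) \<eta>"
    by (rule bezoutian_form_exists[where N = ?N]) (simp, rule that)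
  then have bf: "bezoutian_form R I t G \<eta>" unfolding U(1) idx(1) .
  have np: "ideal_power R max_ideal ?N \<subseteq> I" unfolding ideal_power_eq idx(1) by simp
  have Gp: "et G - \<phi> \<in> ideal_power R max_ideal (2 * ?N)"
    unfolding ideal_power_eq by (rule G)
  have "etale_coordinate_on h [:[:0, 1:], [:1:]:]"
    unfolding etale_coordinate_on_def eval2_jacobian
    by (rule bexI[OF _ functions_on_inverse]) (use h h0 in simp)
  moreover have "\<forall>z. \<exists>q. z = poly (map_poly \<kappa> q) (\<kappa> 1 * \<gamma> + \<kappa> 1 * 0)" using generates_residue by simp
  moreover note h\<gamma> D np Gp bf idx(2)[OF np Gp bf] basis_sections_infinity[OF l]
  ultimately show ?thesis
    unfolding is_local_index_def Let_def t_def I_def \<phi>_def by blast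
qed

end

theorem theorem3p4:
  fixes \<iota> :: "'a::field \<Rightarrow> 'l::field" and x y :: 'l and f :: "'a poly" and g l :: nat
    and \<kappa> :: "'a \<Rightarrow> 'k::field" and \<gamma> :: 'k
  assumes curve: "hyperelliptic_curve \<iota> x y f g"
    and residue_field: "field_hom \<kappa>" "\<And>z. \<exists>q. z = poly (map_poly \<kappa> q) \<gamma>"
    and ramification: "poly (map_poly \<kappa> f) \<gamma> = 0"
    and l_range: "1 \<le> l" "l \<le> g" "l mod 4 = 1"
  shows "hyperelliptic_curve.local_index \<iota> x y f g l (map (\<lambda>j. x ^ j) [0..<Suc l]) \<kappa> \<gamma> 0 =
    gw_trace \<kappa> ((\<Sum>_<(((l + 1) choose 2) - 1) div 2. gw_hyperbolic)
                + gw_unit (poly (map_poly \<kappa> (pderiv f)) \<gamma> / 2))"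
proof -
  interpret ramification_point \<iota> x y f g \<kappa> \<gamma>
    using residue_field(2) ramification
    by (intro ramification_point.intro curve residue_field(1) ramification_point_axioms.intro)
  note N = odd_choose_two[OF l_range(3)]
  show ?thesis
    unfolding local_index_def
  proof (rule the_equality)
    show "is_local_index l (powers l) \<kappa> \<gamma> 0
        (gw_trace \<kappa> ((\<Sum>_<(((l + 1) choose 2) - 1) div 2. gw_hyperbolic) + gw_unit (val (pderiv f) / 2)))"
      by (rule local_index_exists[OF l_range(2) N])
  qed (rule local_index_unique[OF _ N])
qed

end
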